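(* There is an algorithm which, given a $2\times n$ Flood-It board whose squares are coloured with colours from a colour-set $C$ of size $c$, computes the minimum number of moves $m(G,\omega)$ needed to make the board monochromatic in the free variant of the game, in time $O(n^{11}\cdot 2^{c})$. In particular, $c$-\textsc{Free-Flood-It} restricted to $2\times n$ boards is fixed parameter tractable with parameter $c$.
   Context: A $2\times n$ board corresponds to the graph $G$ with vertex set $\{1,2\}\times\{1,\dots,n\}$, where two vertices are adjacent if they are horizontally adjacent ($(i,j),(i,j+1)$) or vertically adjacent ($(1,j),(2,j)$); each vertex gets the colour of its square, giving a (not necessarily proper) colouring $\omega:V(G)\to C$. A move $(v,d)$, with $v$ a vertex and $d\in C$, gives colour $d$ to every vertex of the monochromatic component containing $v$ (the connected component containing $v$ of the subgraph induced by vertices having the current colour of $v$). In the free variant moves may be played at any vertex. $m(G,\omega,d)$ is the minimum number of moves needed to give every vertex colour $d$, and $m(G,\omega)=\min_{d\in C} m(G,\omega,d)$. $c$-\textsc{Free-Flood-It} is the problem of computing $m(G,\omega)$ when only colours from a fixed set of size $c$ are used. *)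

theory Defs
  imports "HOL-Library.FuncSet" "HOL-Library.Log_Nat"
begin

section \<open>Random access machines\<close>

text \<open>
  Algorithms are programs for a random access machine over the natural numbers with indirect
  addressing, addition and truncated subtraction under the uniform cost criterion (Cook and
  Reckhow), with structured control instead of jumps. There is deliberately no multiplication,
  so that unit cost arithmetic stays polynomially related to Turing machine time.

  A state maps a memory bank and an address to the contents of that cell. The bank is a literal
  in the program text, so a program uses a fixed finite number of banks; these could be
  interleaved in a single memory at the price of a constant factor.
\<close>

type_synonym state = "nat \<Rightarrow> nat \<Rightarrow> nat"

datatype aexp = Num nat | Cell nat aexp | Add aexp aexp | Sub aexp aexp

datatype bexp = Less aexp aexp | Not bexp | And bexp bexp

datatype com =
    Skip
  | Store nat aexp aexp
  | Seq com com
  | If bexp com com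
  | While bexp com

fun aval :: "aexp \<Rightarrow> state \<Rightarrow> nat" where
  "aval (Num k) s = k"
| "aval (Cell b a) s = s b (aval a s)"
| "aval (Add a1 a2) s = aval a1 s + aval a2 s"
| "aval (Sub a1 a2) s = aval a1 s - aval a2 s"

fun bval :: "bexp \<Rightarrow> state \<Rightarrow> bool" where
  "bval (Less a1 a2) s = (aval a1 s < aval a2 s)"
| "bval (Not e) s = (\<not> bval e s)"
| "bval (And e1 e2) s = (bval e1 s \<and> bval e2 s)"

fun acost :: "aexp \<Rightarrow> nat" where
  "acost (Num k) = 1"
| "acost (Cell b a) = acost a + 1"
| "acost (Add a1 a2) = acost a1 + acost a2 + 1"
| "acost (Sub a1 a2) = acost a1 + acost a2 + 1"

fun bcost :: "bexp \<Rightarrow> nat" where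
  "bcost (Less a1 a2) = acost a1 + acost a2 + 1"
| "bcost (Not e) = bcost e + 1"
| "bcost (And e1 e2) = bcost e1 + bcost e2 + 1"

text \<open>\<open>exec P s t s'\<close>: started in \<open>s\<close>, the program \<open>P\<close> halts in \<open>s'\<close> after exactly \<open>t\<close> steps.\<close>

inductive exec :: "com \<Rightarrow> state \<Rightarrow> nat \<Rightarrow> state \<Rightarrow> bool" where
  Skip: "exec Skip s 1 s"
| Store: "exec (Store b a e) s (acost a + acost e + 1)
            (s(b := (s b)(aval a s := aval e s)))"
| Seq: "\<lbrakk>exec P s t1 s1; exec Q s1 t2 s2\<rbrakk> \<Longrightarrow> exec (Seq P Q) s (t1 + t2) s2"
| IfTrue: "\<lbrakk>bval e s; exec P s t s1\<rbrakk> \<Longrightarrow> exec (If e P Q) s (bcost e + t + 1) s1"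
| IfFalse: "\<lbrakk>\<not> bval e s; exec Q s t s1\<rbrakk> \<Longrightarrow> exec (If e P Q) s (bcost e + t + 1) s1"
| WhileFalse: "\<not> bval e s \<Longrightarrow> exec (While e P) s (bcost e + 1) s"
| WhileTrue: "\<lbrakk>bval e s; exec P s t1 s1; exec (While e P) s1 t2 s2\<rbrakk>
    \<Longrightarrow> exec (While e P) s (bcost e + t1 + t2 + 1) s2"

lemma exec_deterministic:
  "exec P s t s1 \<Longrightarrow> exec P s u s2 \<Longrightarrow> t = u \<and> s1 = s2"
proof (induction arbitrary: u s2 rule: exec.induct)
  case Skip then show ?case by (auto elim: exec.cases)
next
  case Store then show ?case by (auto elim: exec.cases)
next
  case (Seq P s t1 s1 Q t2 s')
  from Seq.prems show ?case by (cases rule: exec.cases) (use Seq.IH in blast)+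
next
  case (IfTrue e s P t s1 Q)
  from IfTrue.prems show ?case
    by (cases rule: exec.cases) (use IfTrue.hyps IfTrue.IH in blast)+
next
  case (IfFalse e s Q t s1 P)
  from IfFalse.prems show ?case
    by (cases rule: exec.cases) (use IfFalse.hyps IfFalse.IH in blast)+
next
  case (WhileFalse e s P)
  from WhileFalse.prems show ?case
    by (cases rule: exec.cases) (use WhileFalse.hyps in blast)+
next
  case (WhileTrue e s P t1 s1 t2 s')
  from WhileTrue.prems show ?case
    by (cases rule: exec.cases) (use WhileTrue.hyps WhileTrue.IH in blast)+
qed

text \<open>The input words are placed in bank 0, all other cells being 0; the output is read off
  cell 0 of bank 0.\<close>

definition load :: "nat list \<Rightarrow> state" where
  "load xs = (\<lambda>b i. if b = 0 \<and> i < length xs then xs ! i else 0)"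

definition computes_in :: "com \<Rightarrow> nat list \<Rightarrow> nat \<Rightarrow> nat \<Rightarrow> bool" where
  "computes_in P xs y t \<longleftrightarrow> (\<exists>s. exec P (load xs) t s \<and> s 0 0 = y)"

definition computable :: "(nat \<Rightarrow> nat) \<Rightarrow> bool" where
  "computable f \<longleftrightarrow> (\<exists>P. \<forall>x. \<exists>t. computes_in P [x] (f x) t)"


section \<open>Fixed parameter tractability\<close>

text \<open>Length of the input in bits, every word being charged one additional bit.\<close>

definition input_size :: "nat list \<Rightarrow> nat" where
  "input_size xs = (\<Sum>x\<leftarrow>xs. floorlog 2 x + 1)"

text \<open>
  For a problem with instances \<open>I\<close>, encoded by \<open>enc\<close>, with parameter \<open>par\<close>, where on
  instance \<open>x\<close> the number \<open>sol x\<close> is to be computed: solvable in time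
  \<open>f(parameter) * (input size)^O(1)\<close> for a computable \<open>f\<close>.
\<close>

definition fixed_parameter_tractable ::
    "'i set \<Rightarrow> ('i \<Rightarrow> nat list) \<Rightarrow> ('i \<Rightarrow> nat) \<Rightarrow> ('i \<Rightarrow> nat) \<Rightarrow> bool" where
  "fixed_parameter_tractable I enc par sol \<longleftrightarrow>
     (\<exists>P f k. computable f \<and>
        (\<forall>x\<in>I. \<exists>t. computes_in P (enc x) (sol x) t \<and>
                   t \<le> f (par x) * input_size (enc x) ^ k))"


section \<open>Free Flood-It\<close>

text \<open>A graph is given by its vertex set \<open>V\<close> and a symmetric adjacency relation \<open>E\<close>.
  Values of a colouring outside \<open>V\<close> are irrelevant.\<close>

definition mono_component ::
    "'v set \<Rightarrow> 'v rel \<Rightarrow> ('v \<Rightarrow> 'c) \<Rightarrow> 'v \<Rightarrow> 'v set" where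
  "mono_component V E \<omega> v =
     (let U = {u \<in> V. \<omega> u = \<omega> v} in {u. (v, u) \<in> (E \<inter> U \<times> U)\<^sup>*})"

definition play ::
    "'v set \<Rightarrow> 'v rel \<Rightarrow> 'v \<times> 'c \<Rightarrow> ('v \<Rightarrow> 'c) \<Rightarrow> 'v \<Rightarrow> 'c" where
  "play V E = (\<lambda>(v, d) \<omega> u. if u \<in> mono_component V E \<omega> v then d else \<omega> u)"

definition floods ::
    "'v set \<Rightarrow> 'v rel \<Rightarrow> 'c set \<Rightarrow> ('v \<Rightarrow> 'c) \<Rightarrow> 'c \<Rightarrow> ('v \<times> 'c) list \<Rightarrow> bool" where
  "floods V E C \<omega> d ms \<longleftrightarrow>
     set ms \<subseteq> V \<times> C \<and> (\<forall>u\<in>V. fold (play V E) ms \<omega> u = d)"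

definition min_moves_to ::
    "'v set \<Rightarrow> 'v rel \<Rightarrow> 'c set \<Rightarrow> ('v \<Rightarrow> 'c) \<Rightarrow> 'c \<Rightarrow> nat" where
  "min_moves_to V E C \<omega> d = (LEAST k. \<exists>ms. length ms = k \<and> floods V E C \<omega> d ms)"

definition min_moves ::
    "'v set \<Rightarrow> 'v rel \<Rightarrow> 'c set \<Rightarrow> ('v \<Rightarrow> 'c) \<Rightarrow> nat" where
  "min_moves V E C \<omega> = Min (min_moves_to V E C \<omega> ` C)"

text \<open>The minimum in \<^const>\<open>min_moves_to\<close> is always attained.\<close>

lemma floods_exists:
  assumes "finite V" "d \<in> C"
  shows "\<exists>ms. floods V E C \<omega> d ms"
proof -
  obtain vs where vs: "set vs = V" using finite_list[OF assms(1)] by blast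
  have keep: "fold (play V E) (map (\<lambda>v. (v, d)) ws) \<eta> u = d" if "\<eta> u = d" for ws \<eta> u
    using that by (induction ws arbitrary: \<eta>) (auto simp: play_def)
  have "fold (play V E) (map (\<lambda>v. (v, d)) ws) \<eta> u = d" if "u \<in> set ws" for ws \<eta> u
    using that
  proof (induction ws arbitrary: \<eta>)
    case (Cons w ws)
    show ?case
    proof (cases "u = w")
      case True
      have "play V E (w, d) \<eta> u = d"
        by (simp add: True play_def mono_component_def Let_def)
      then show ?thesis using keep by simp
    qed (use Cons in auto)
  qed simp
  then have "floods V E C \<omega> d (map (\<lambda>v. (v, d)) vs)"
    using vs assms(2) by (auto simp: floods_def)
  then show ?thesis ..
qed


section \<open>Boards with two rows\<close>

definition board :: "nat \<Rightarrow> (nat \<times> nat) set" where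
  "board n = {1, 2} \<times> {1..n}"

definition board_adj :: "nat \<Rightarrow> (nat \<times> nat) rel" where
  "board_adj n = {((i, j), (i', j')). (i, j) \<in> board n \<and> (i', j') \<in> board n \<and>
     (i = i' \<and> (j' = j + 1 \<or> j = j' + 1) \<or> i \<noteq> i' \<and> j = j')}"

text \<open>
  An instance consists of the number \<open>n\<close> of columns, the number \<open>c\<close> of colours and a colouring
  with the colour set \<open>{0..<c}\<close>. As input it is written as \<open>n\<close>, \<open>c\<close>, followed by the first and
  then the second row of the board.
\<close>

type_synonym flood_instance = "nat \<times> nat \<times> (nat \<times> nat \<Rightarrow> nat)"

definition flood_instances :: "flood_instance set" where
  "flood_instances = {(n, c, \<omega>). n \<ge> 1 \<and> \<omega> \<in> board n \<rightarrow> {0..<c}}"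

fun flood_encode :: "flood_instance \<Rightarrow> nat list" where
  "flood_encode (n, c, \<omega>) =
     [n, c] @ map (\<lambda>j. \<omega> (1, j)) [1..<n + 1] @ map (\<lambda>j. \<omega> (2, j)) [1..<n + 1]"

fun flood_colours :: "flood_instance \<Rightarrow> nat" where
  "flood_colours (n, c, \<omega>) = c"

fun flood_moves :: "flood_instance \<Rightarrow> nat" where
  "flood_moves (n, c, \<omega>) = min_moves (board n) (board_adj n) {0..<c} \<omega>"

end

theory Submission
  imports Defs
begin

text \<open>
  If all vertices of a connected set are given the same colour, whatever this colour is, then at most
  one additional move is needed to flood the graph. It follows that additional edges do no harm,
  and that the number of moves is subadditive over disjoint vertex sets.

  Conversely, consider the region hit by the last move that hits a given vertex. No move made
  before crosses its boundary, so an optimal game splits into games on the region and on the rest.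
  On a board with two rows, a connected set that meets all columns of a section of the board (a spine)
  dominates the section. A cell off the spine is therefore absorbed at no cost when the spine
  runs through the colour of that cell, and the order of the colours is irrelevant. So it
  suffices to compute, for a section with possibly staggered borders, the rows of its end cells,
  a colour \<open>c\<close> and a set \<open>I\<close> of colours still to come, the number of moves that give some
  spine colour \<open>c\<close> while all other cells have colours in \<open>I\<close>. Either such a spine is put together
  from spines of a left and a right part of the section, or it had another colour before, which
  adds \<open>c\<close> to the colours to come. Derivations in this calculus have height \<open>O(n)\<close>, so \<open>O(n)\<close> rounds of
  relaxation over all instances of the rules find the optimum, once the colours are renamed
  so that there are at most \<open>2 * n\<close> of them.
\<close>


section \<open>Flooding moves\<close>

text \<open>On two rows the parts of a spine may run side by side in opposite rows, so a cut between
  them need not be a straight column. Hence borders and cuts are chosen for each row separately, and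
  a table entry is indexed by four borders. Of the colours to come only the set is recorded, because
  a colour absorbs all cells that have it at once, wherever they are. The instances of the rules are
  given by \<open>2 ^ k\<close> colour sets, \<open>k ^ 2\<close> pairs of colours and
  \<open>O(n ^ 6)\<close> borders and cuts, up to a constant for the rows. As \<open>k\<close> is at
  most \<open>2 * n\<close>, these are \<open>O(n ^ 8 * 2 ^ k)\<close>; the rounds make it
  \<open>O(n ^ 9 * 2 ^ k)\<close>, which leaves slack below the claimed bound. Without the renaming
  a factor \<open>c ^ 2\<close> would remain. An instance must be handled in constant time by a
  machine without multiplication and bit operations, so products and set insertions are looked up in
  tables computed beforehand.\<close>

definition recolour :: "'v set \<Rightarrow> 'c \<Rightarrow> ('v \<Rightarrow> 'c) \<Rightarrow> 'v \<Rightarrow> 'c" where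
  "recolour B e \<omega> = (\<lambda>u. if u \<in> B then e else \<omega> u)"

definition linked :: "'v rel \<Rightarrow> 'v set \<Rightarrow> bool" where
  "linked E B \<longleftrightarrow> (\<forall>u\<in>B. \<forall>v\<in>B. (u, v) \<in> (E \<inter> B \<times> B)\<^sup>*)"

definition reach :: "'v rel \<Rightarrow> 'v set \<Rightarrow> 'v \<Rightarrow> 'v set" where
  "reach E A v = {u. (v, u) \<in> (E \<inter> A \<times> A)\<^sup>*}"

definition floodable ::
    "'v set \<Rightarrow> 'v rel \<Rightarrow> 'c set \<Rightarrow> ('v \<Rightarrow> 'c) \<Rightarrow> 'c \<Rightarrow> nat \<Rightarrow> bool" where
  "floodable V E C \<omega> d k \<longleftrightarrow> (\<exists>ms. length ms \<le> k \<and> floods V E C \<omega> d ms)"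

section \<open>Connected sets and monochromatic components\<close>

lemma path_mono: "(u, v) \<in> (E \<inter> A \<times> A)\<^sup>* \<Longrightarrow> A \<subseteq> B \<Longrightarrow> (u, v) \<in> (E \<inter> B \<times> B)\<^sup>*"
  by (rule subsetD[OF rtrancl_mono]) auto

lemma path_sym: "sym E \<Longrightarrow> (u, v) \<in> (E \<inter> A \<times> A)\<^sup>* \<Longrightarrow> (v, u) \<in> (E \<inter> A \<times> A)\<^sup>*"
  by (rule symD[OF sym_rtrancl]) (auto simp: sym_def)

lemma reach_self: "v \<in> reach E A v"
  by (simp add: reach_def)

lemma reach_subset: "v \<in> A \<Longrightarrow> reach E A v \<subseteq> A"
  unfolding reach_def by (auto elim: rtranclE)

lemma reach_step:
  assumes "u \<in> reach E A v" "v \<in> A" "w \<in> A" "(u, w) \<in> E"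
  shows "w \<in> reach E A v"
  using assms reach_subset[OF assms(2), of E]
  unfolding reach_def by (auto intro: rtrancl_into_rtrancl)

lemma reach_maximal: "linked E B \<Longrightarrow> B \<subseteq> A \<Longrightarrow> v \<in> B \<Longrightarrow> B \<subseteq> reach E A v"
  unfolding linked_def reach_def by (blast intro: path_mono)

lemma linked_if_centre:
  assumes "sym E" "\<And>u. u \<in> B \<Longrightarrow> (v, u) \<in> (E \<inter> B \<times> B)\<^sup>*"
  shows "linked E B"
  unfolding linked_def using path_sym[OF assms(1) assms(2)] assms(2) rtrancl_trans by metis

lemma linked_reach:
  assumes "sym E"
  shows "linked E (reach E A v)"
proof (rule linked_if_centre[OF assms])
  fix u assume "u \<in> reach E A v"
  then have "(v, u) \<in> (E \<inter> A \<times> A)\<^sup>*" by (simp add: reach_def)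
  then show "(v, u) \<in> (E \<inter> reach E A v \<times> reach E A v)\<^sup>*"
  proof (induction rule: rtrancl_induct)
    case (step y z)
    have "(v, z) \<in> (E \<inter> A \<times> A)\<^sup>*" using step.hyps by (rule rtrancl_into_rtrancl)
    then have "(y, z) \<in> E \<inter> reach E A v \<times> reach E A v"
      using step.hyps by (auto simp: reach_def)
    then show ?case by (rule rtrancl_into_rtrancl[OF step.IH])
  qed simp
qed

lemma linked_Un:
  assumes "sym E" "linked E A" "linked E B" "v \<in> A" "v \<in> B"
  shows "linked E (A \<union> B)"
proof (rule linked_if_centre[OF assms(1)])
  fix u assume "u \<in> A \<union> B"
  then show "(v, u) \<in> (E \<inter> (A \<union> B) \<times> (A \<union> B))\<^sup>*"
    using assms(2-5) path_mono[of v u E A "A \<union> B"] path_mono[of v u E B "A \<union> B"]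
    unfolding linked_def by auto
qed

lemma linked_join:
  assumes "sym E" "linked E A" "linked E B" "u \<in> A" "v \<in> B" "(u, v) \<in> E"
  shows "linked E (A \<union> B)"
proof -
  have "linked E {u, v}"
    by (rule linked_if_centre[OF assms(1), of _ u]) (use assms(6) in auto)
  then have "linked E (A \<union> {u, v})" using assms linked_Un[of E A "{u, v}" u] by simp
  then have "linked E ((A \<union> {u, v}) \<union> B)" using assms linked_Un[of E "A \<union> {u, v}" B v] by simp
  moreover have "(A \<union> {u, v}) \<union> B = A \<union> B" using assms by auto
  ultimately show ?thesis by simp
qed

lemma mono_component_reach:
  "mono_component V E \<omega> v = reach E {u \<in> V. \<omega> u = \<omega> v} v"
  by (simp add: mono_component_def reach_def Let_def)

lemma play_recolour: "play V E (v, d) \<omega> = recolour (mono_component V E \<omega> v) d \<omega>"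
  by (simp add: play_def recolour_def)

lemma mono_component_self: "v \<in> mono_component V E \<omega> v"
  by (simp add: mono_component_reach reach_self)

lemma mono_component_mono:
  "v \<in> V \<Longrightarrow> u \<in> mono_component V E \<omega> v \<Longrightarrow> u \<in> V \<and> \<omega> u = \<omega> v"
  using reach_subset[of v "{u \<in> V. \<omega> u = \<omega> v}" E] by (auto simp: mono_component_reach)

lemma mono_component_linked: "sym E \<Longrightarrow> linked E (mono_component V E \<omega> v)"
  by (simp add: mono_component_reach linked_reach)

lemma mono_component_props:
  assumes "sym E" "v \<in> V"
  shows "linked E (mono_component V E \<omega> v)" "mono_component V E \<omega> v \<subseteq> V"
    "v \<in> mono_component V E \<omega> v" "\<And>u. u \<in> mono_component V E \<omega> v \<Longrightarrow> \<omega> u = \<omega> v"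
proof -
  show "linked E (mono_component V E \<omega> v)" by (rule mono_component_linked[OF assms(1)])
  show "mono_component V E \<omega> v \<subseteq> V" using mono_component_mono[OF assms(2)] by blast
  show "v \<in> mono_component V E \<omega> v" by (rule mono_component_self)
  show "\<omega> u = \<omega> v" if "u \<in> mono_component V E \<omega> v" for u
    using mono_component_mono[OF assms(2) that] by (rule conjunct2)
qed

lemma mono_component_maximal:
  "\<lbrakk>linked E B; B \<subseteq> V; v \<in> B; \<And>u. u \<in> B \<Longrightarrow> \<omega> u = \<omega> v\<rbrakk> \<Longrightarrow> B \<subseteq> mono_component V E \<omega> v"
  unfolding mono_component_reach by (rule reach_maximal) blast+

section \<open>Numbers of moves under merging, additional edges and unions\<close>

lemma floodable_0: "(\<And>u. u \<in> V \<Longrightarrow> \<omega> u = d) \<Longrightarrow> floodable V E C \<omega> d k"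
  unfolding floodable_def floods_def by (intro exI[of _ "[]"]) auto

lemma floodable_mono: "floodable V E C \<omega> d k \<Longrightarrow> k \<le> l \<Longrightarrow> floodable V E C \<omega> d l"
  unfolding floodable_def using order_trans by blast

lemma floodable_play:
  "\<lbrakk>v \<in> V; e \<in> C; floodable V E C (play V E (v, e) \<omega>) d k\<rbrakk> \<Longrightarrow> floodable V E C \<omega> d (Suc k)"
  unfolding floodable_def floods_def
  by (elim exE, rule exI[of _ "(v, e) # _"]) auto

lemma floodable_cases [consumes 1, case_names finished move]:
  assumes "floodable V E C \<omega> d k"
  obtains "\<And>u. u \<in> V \<Longrightarrow> \<omega> u = d"
  | k' v e where "k = Suc k'" "v \<in> V" "e \<in> C" "floodable V E C (play V E (v, e) \<omega>) d k'"
proof -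
  obtain ms where ms: "length ms \<le> k" "floods V E C \<omega> d ms"
    using assms by (auto simp: floodable_def)
  show thesis
  proof (cases ms)
    case Nil
    then show thesis using ms that(1) by (auto simp: floods_def)
  next
    case (Cons m ms')
    obtain v e where m: "m = (v, e)" by (cases m)
    obtain k' where k': "k = Suc k'" using ms(1) Cons by (cases k) auto
    have "floodable V E C (play V E (v, e) \<omega>) d k'"
      using ms Cons k' m by (auto simp: floodable_def floods_def)
    then show thesis using that(2)[of k' v e] ms k' m Cons by (auto simp: floods_def)
  qed
qed

text \<open>The merged region replays the histories of its parts one after the other; only the return
  from \<^term>\<open>e\<close> to the first of these colours is new.\<close>

lemma floodable_merge:
  assumes "sym E" "floodable V E C \<omega> d k" "\<omega> ` V \<subseteq> C" "d \<in> C"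
    "linked E B" "B \<subseteq> V" "B \<noteq> {}"
  shows "floodable V E C (recolour B e \<omega>) d (Suc k)"
  using assms(2-7)
proof (induction k arbitrary: \<omega> B e)
  have base: "floodable V E C (recolour B e \<omega>) d (Suc k)"
    if "\<And>u. u \<in> V \<Longrightarrow> \<omega> u = d" "linked E B" "B \<subseteq> V" "B \<noteq> {}" "d \<in> C" for \<omega> :: "'a \<Rightarrow> 'b" and B e k
  proof -
    obtain b where b: "b \<in> B" using \<open>B \<noteq> {}\<close> by blast
    have "B \<subseteq> mono_component V E (recolour B e \<omega>) b"
      by (rule mono_component_maximal) (use that b in \<open>auto simp: recolour_def\<close>)
    then have "floodable V E C (play V E (b, d) (recolour B e \<omega>)) d k"
      by (intro floodable_0) (use that in \<open>auto simp: play_recolour recolour_def\<close>)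
    then show ?thesis using floodable_play b that by (metis subsetD)
  qed
  {
    case 0
    then show ?case by (cases rule: floodable_cases) (use base 0 in auto)
  next
    case (Suc k)
    from Suc.prems(1) show ?case
    proof (cases rule: floodable_cases)
      case finished
      then show ?thesis using base Suc.prems by blast
    next
      case play: (move k' w c)
      define K where "K = mono_component V E \<omega> w"
      define \<omega>1 where "\<omega>1 = recolour B e \<omega>"
      define \<omega>2 where "\<omega>2 = recolour K c \<omega>"
      have \<omega>2: "floodable V E C \<omega>2 d k" "\<omega>2 ` V \<subseteq> C"
        using play Suc.prems(2) by (auto simp: \<omega>2_def K_def play_recolour recolour_def)
      have K: "linked E K" "K \<subseteq> V" "w \<in> K" "\<And>u. u \<in> K \<Longrightarrow> \<omega> u = \<omega> w"
        unfolding K_def using mono_component_props[OF assms(1) play(2)] by blast+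
      note IH = Suc.IH[OF \<omega>2 Suc.prems(3)]
      show ?thesis
      proof (cases "K \<inter> B = {}")
        case False
        then obtain b where b: "b \<in> K" "b \<in> B" by auto
        define F where "F = mono_component V E \<omega>1 b"
        have BF: "B \<subseteq> F" unfolding F_def
          by (rule mono_component_maximal) (use Suc.prems b in \<open>auto simp: \<omega>1_def recolour_def\<close>)
        have F: "linked E F" "F \<subseteq> V"
          unfolding F_def using mono_component_props[OF assms(1), of b V] b Suc.prems(5) by blast+
        \<comment> \<open>One move returns the component \<open>F\<close> of the merged region to
          \<open>\<omega> w\<close>, the colour that \<open>K\<close> had. This is the position
          after the original move with \<open>F \<union> K\<close> merged, so the induction
          hypothesis applies to the larger region.\<close>
        have "floodable V E C (recolour (F \<union> K) (\<omega> w) \<omega>2) d (Suc k)"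
          using F K(1-3) b BF assms(1) by (intro IH linked_Un[of E F K b]) auto
        moreover have "recolour (F \<union> K) (\<omega> w) \<omega>2 = play V E (b, \<omega> w) \<omega>1"
        proof
          fix u
          have "play V E (b, \<omega> w) \<omega>1 = recolour F (\<omega> w) \<omega>1" by (simp add: play_recolour F_def)
          then show "recolour (F \<union> K) (\<omega> w) \<omega>2 u = play V E (b, \<omega> w) \<omega>1 u"
            using K(4)[of u] BF by (auto simp: \<omega>1_def \<omega>2_def recolour_def)
        qed
        ultimately show ?thesis
          using floodable_play[of b V "\<omega> w" C E \<omega>1 d "Suc k"] b Suc.prems play by (auto simp: \<omega>1_def)
      next
        case KB: True
        define F where "F = mono_component V E \<omega>1 w"
        have F: "linked E F" "F \<subseteq> V" "w \<in> F" "\<And>u. u \<in> F \<Longrightarrow> \<omega>1 u = \<omega>1 w"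
          unfolding F_def using mono_component_props[OF assms(1) play(2)] by blast+
        have \<omega>1K: "\<omega>1 u = \<omega> u" if "u \<in> K" for u using KB that by (auto simp: \<omega>1_def recolour_def)
        have KF: "K \<subseteq> F" unfolding F_def
          by (rule mono_component_maximal[OF K(1-3)]) (metis \<omega>1K K(3,4))
        show ?thesis
        proof (cases "F \<inter> B = {}")
          case True
          then have "\<omega>1 u = \<omega> u" if "u \<in> F" for u using that by (auto simp: \<omega>1_def recolour_def)
          then have "F \<subseteq> K" unfolding K_def
            by (intro mono_component_maximal[OF F(1-3)]) (metis F(3,4))
          then have "play V E (w, c) \<omega>1 = recolour K c \<omega>1"
            using KF by (simp add: play_recolour F_def[symmetric])
          then have "play V E (w, c) \<omega>1 = recolour B e \<omega>2"
            using KB by (auto simp: \<omega>1_def \<omega>2_def recolour_def fun_eq_iff)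
          moreover have "floodable V E C (recolour B e \<omega>2) d (Suc k)" using IH Suc.prems by blast
          ultimately show ?thesis
            using floodable_play[of w V c C E \<omega>1 d "Suc k"] play by (auto simp: \<omega>1_def)
        next
          case False
          then obtain b where b: "b \<in> F" "b \<in> B" by auto
          have e: "\<omega>1 w = e" using F(4)[OF b(1)] b(2) by (simp add: \<omega>1_def recolour_def)
          \<comment> \<open>Here \<open>K\<close> had the colour \<open>e\<close> and is connected
            to the merged region. The position \<open>\<omega>1\<close> is itself
            \<open>\<omega>2\<close> with \<open>B \<union> F\<close> painted \<open>e\<close>, so
            the move at \<open>w\<close> is not played at all.\<close>
          have "floodable V E C (recolour (B \<union> F) e \<omega>2) d (Suc k)"
            using F b assms(1) Suc.prems by (intro IH linked_Un[of E B F b]) auto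
          moreover have "recolour (B \<union> F) e \<omega>2 = \<omega>1"
          proof
            fix u show "recolour (B \<union> F) e \<omega>2 u = \<omega>1 u"
              using F(4)[of u] e KF by (auto simp: \<omega>1_def \<omega>2_def recolour_def)
          qed
          ultimately show ?thesis
            using floodable_mono[of V E C \<omega>1 d "Suc k" "Suc (Suc k)"] by (simp add: \<omega>1_def)
        qed
      qed
    qed
  }
qed

text \<open>Additional edges only enlarge the component hit by a move, from \<open>K\<close> to
  \<open>K'\<close>. The position before the move arises from the position after it by painting the
  connected set \<open>K'\<close> in its old colour; \<open>floodable_merge\<close> charges one move
  for this, which is the move just undone.\<close>

lemma floodable_edge_mono:
  assumes "floodable V E C \<omega> d k" "E \<subseteq> E'" "sym E" "sym E'" "\<omega> ` V \<subseteq> C" "d \<in> C"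
  shows "floodable V E' C \<omega> d k"
  using assms(1,5)
proof (induction k arbitrary: \<omega>)
  case 0
  then show ?case by (cases rule: floodable_cases) (auto intro: floodable_0)
next
  case (Suc k)
  from Suc.prems(1) show ?case
  proof (cases rule: floodable_cases)
    case finished
    then show ?thesis by (rule floodable_0)
  next
    case play: (move k' w c)
    define K where "K = mono_component V E \<omega> w"
    define K' where "K' = mono_component V E' \<omega> w"
    have "E \<inter> U \<times> U \<subseteq> E' \<inter> U \<times> U" for U using assms(2) by blast
    then have K: "\<And>u. u \<in> K \<Longrightarrow> u \<in> K'"
      unfolding K_def K'_def mono_component_def Let_def using rtrancl_mono by blast
    have K': "linked E' K'" "K' \<subseteq> V" "w \<in> K'" "\<And>u. u \<in> K' \<Longrightarrow> \<omega> u = \<omega> w"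
      unfolding K'_def using mono_component_props[OF assms(4) play(2)] by blast+
    have im: "recolour K c \<omega> ` V \<subseteq> C" using play Suc.prems(2) by (auto simp: recolour_def)
    have "floodable V E' C (recolour K c \<omega>) d k"
      using play im by (intro Suc.IH) (auto simp: K_def play_recolour)
    then have "floodable V E' C (recolour K' (\<omega> w) (recolour K c \<omega>)) d (Suc k)"
      using floodable_merge[OF assms(4) _ im assms(6) K'(1,2)] K'(3) by auto
    moreover have "recolour K' (\<omega> w) (recolour K c \<omega>) = \<omega>"
      using K K'(4) by (auto simp: recolour_def fun_eq_iff)
    ultimately show ?thesis by simp
  qed
qed

lemma mono_component_cong:
  assumes "\<And>u. u \<in> V \<Longrightarrow> \<omega> u = \<omega>' u" "v \<in> V"
  shows "mono_component V E \<omega> v = mono_component V E \<omega>' v"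
proof -
  have "{u \<in> V. \<omega> u = \<omega> v} = {u \<in> V. \<omega>' u = \<omega>' v}" using assms by auto
  then show ?thesis by (simp add: mono_component_reach)
qed

lemma floodable_cong:
  assumes "floodable V E C \<omega> d k" "\<And>u. u \<in> V \<Longrightarrow> \<omega> u = \<omega>' u"
  shows "floodable V E C \<omega>' d k"
  using assms
proof (induction k arbitrary: \<omega> \<omega>')
  case 0
  then show ?case by (cases rule: floodable_cases) (auto intro: floodable_0)
next
  case (Suc k)
  from Suc.prems(1) show ?case
  proof (cases rule: floodable_cases)
    case finished
    then show ?thesis using Suc.prems(2) by (auto intro: floodable_0)
  next
    case play: (move k' w c)
    have "floodable V E C (play V E (w, c) \<omega>') d k"
      by (rule Suc.IH[of "play V E (w, c) \<omega>"]) (use play in simp,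
          simp add: play_recolour recolour_def Suc.prems(2) mono_component_cong[OF Suc.prems(2) play(2)])
    then show ?thesis using play floodable_play by fastforce
  qed
qed

lemma mono_component_Un:
  assumes "A \<inter> B = {}" "E' = E \<inter> (A \<times> A \<union> B \<times> B)" "v \<in> A"
  shows "mono_component (A \<union> B) E' \<omega> v = mono_component A E \<omega> v"
proof -
  let ?U = "{u \<in> A \<union> B. \<omega> u = \<omega> v}" and ?U' = "{u \<in> A. \<omega> u = \<omega> v}"
  have "(v, u) \<in> (E \<inter> ?U' \<times> ?U')\<^sup>*" if "(v, u) \<in> (E' \<inter> ?U \<times> ?U)\<^sup>*" for u
    using that
  proof (induction rule: rtrancl_induct)
    case (step y z)
    have "y \<in> A" using step.IH assms(3) by (auto elim: rtranclE)
    then have "(y, z) \<in> E \<inter> ?U' \<times> ?U'" using step.hyps(2) assms(1,2) by auto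
    then show ?case using step.IH by (rule rtrancl_into_rtrancl[rotated])
  qed simp
  moreover have "E \<inter> ?U' \<times> ?U' \<subseteq> E' \<inter> ?U \<times> ?U" using assms(2) by auto
  ultimately show ?thesis
    unfolding mono_component_def Let_def using rtrancl_mono by blast
qed

text \<open>With no edges between \<open>A\<close> and \<open>B\<close>, a move in one part leaves
  the other alone. The game on \<open>A\<close> is played to the end before the game on
  \<open>B\<close>.\<close>

lemma floodable_extend:
  assumes "floodable A E C \<omega> d i" "floodable B E C \<omega> d j" "A \<inter> B = {}"
    "E' = E \<inter> (A \<times> A \<union> B \<times> B)"
  shows "floodable (A \<union> B) E' C \<omega> d (i + j)"
  using assms(1,2)
proof (induction i arbitrary: \<omega>)
  have inB: "floodable (A \<union> B) E' C \<omega> d k"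
    if "floodable B E C \<omega> d k" "\<And>u. u \<in> A \<Longrightarrow> \<omega> u = d" for \<omega> k
    using that
  proof (induction k arbitrary: \<omega>)
    case 0
    then show ?case by (cases rule: floodable_cases) (auto intro: floodable_0)
  next
    case (Suc k)
    from Suc.prems(1) show ?case
    proof (cases rule: floodable_cases)
      case finished
      then show ?thesis using Suc.prems(2) by (auto intro: floodable_0)
    next
      case play: (move k' w c)
      have "mono_component (A \<union> B) E' \<omega> w = mono_component B E \<omega> w"
        using mono_component_Un[of B A E' E w \<omega>] play(2) assms(3,4) by (simp add: Un_commute Int_commute)
      moreover have "u \<notin> mono_component B E \<omega> w" if "u \<in> A" for u
        using mono_component_mono[OF play(2)] assms(3) that by blast
      then have "play B E (w, c) \<omega> u = d" if "u \<in> A" for u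
        using that Suc.prems(2) by (simp add: play_recolour recolour_def)
      then have "floodable (A \<union> B) E' C (play B E (w, c) \<omega>) d k"
        using play(1,4) by (intro Suc.IH) auto
      ultimately have "floodable (A \<union> B) E' C (play (A \<union> B) E' (w, c) \<omega>) d k"
        by (simp add: play_recolour)
      then show ?thesis using play(2,3) floodable_play[of w "A \<union> B" c C E' \<omega> d k] by simp
    qed
  qed
  {
    case 0
    then show ?case by (cases rule: floodable_cases) (use inB in auto)
  next
    case (Suc i)
    from Suc.prems(1) show ?case
    proof (cases rule: floodable_cases)
      case finished
      then show ?thesis using inB[OF Suc.prems(2)] by (auto intro: floodable_mono)
    next
      case play: (move k' w c)
      have "u \<notin> mono_component A E \<omega> w" if "u \<in> B" for u
        using mono_component_mono[OF play(2)] assms(3) that by blast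
      then have "floodable B E C (play A E (w, c) \<omega>) d j"
        by (intro floodable_cong[OF Suc.prems(2)]) (simp add: play_recolour recolour_def)
      then have "floodable (A \<union> B) E' C (play (A \<union> B) E' (w, c) \<omega>) d (i + j)"
        using Suc.IH[of "play A E (w, c) \<omega>"] play mono_component_Un[OF assms(3,4) play(2), of \<omega>]
        by (simp add: play_recolour)
      then show ?thesis using play floodable_play[of w "A \<union> B" c C E' \<omega>] by auto
    qed
  }
qed

text \<open>Delete the edges between the parts, play both games, and put the edges back by
  \<open>floodable_edge_mono\<close>.\<close>

lemma floodable_Un:
  assumes "sym E" "floodable A E C \<omega> d i" "floodable B E C \<omega> d j" "A \<inter> B = {}"
    "\<omega> ` (A \<union> B) \<subseteq> C" "d \<in> C"
  shows "floodable (A \<union> B) E C \<omega> d (i + j)"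
proof (rule floodable_edge_mono)
  show "floodable (A \<union> B) (E \<inter> (A \<times> A \<union> B \<times> B)) C \<omega> d (i + j)"
    using floodable_extend assms by metis
  show "sym (E \<inter> (A \<times> A \<union> B \<times> B))" using assms(1) by (auto simp: sym_def)
qed (use assms in auto)

lemma floodable_recolour:
  assumes "floodable Q E C \<omega> c' k" "linked E Q" "c \<in> C"
  shows "floodable Q E C \<omega> c (Suc k)"
proof (cases "Q = {}")
  case True
  then show ?thesis by (auto intro: floodable_0)
next
  case False
  then obtain q where q: "q \<in> Q" by auto
  obtain ms where ms: "length ms \<le> k" "floods Q E C \<omega> c' ms"
    using assms(1) by (auto simp: floodable_def)
  define \<eta> where "\<eta> = fold (play Q E) ms \<omega>"
  have "Q \<subseteq> mono_component Q E \<eta> q"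
    by (rule mono_component_maximal) (use assms(2) ms q in \<open>auto simp: \<eta>_def floods_def\<close>)
  then have "floods Q E C \<omega> c (ms @ [(q, c)])"
    using ms q assms(3) by (auto simp: floods_def play_recolour recolour_def \<eta>_def[symmetric])
  then show ?thesis using ms(1) unfolding floodable_def by (intro exI conjI) auto
qed

section \<open>Splitting a game along a boundary\<close>

text \<open>Neighbours of equal colour lie both inside or both outside the component hit, so no move
  separates them. This is used contrapositively: neighbours that differ at the end of a game differ
  throughout.\<close>

lemma play_persistent:
  assumes "\<omega> u = \<omega> w" "(u, w) \<in> E" "sym E" "u \<in> V" "w \<in> V" "v \<in> V"
  shows "play V E (v, e) \<omega> u = play V E (v, e) \<omega> w"
proof -
  have step: "y \<in> mono_component V E \<omega> v"
    if "x \<in> mono_component V E \<omega> v" "\<omega> x = \<omega> y" "(x, y) \<in> E" "y \<in> V" for x y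
    using reach_step[of x E "{u \<in> V. \<omega> u = \<omega> v}" v y] mono_component_mono[OF assms(6) that(1)] that assms(6)
    by (simp add: mono_component_reach)
  have "u \<in> mono_component V E \<omega> v \<longleftrightarrow> w \<in> mono_component V E \<omega> v"
    using step[of u w] step[of w u] assms symD[OF assms(3)] by metis
  then show ?thesis using assms(1) by (simp add: play_recolour recolour_def)
qed

lemma fold_play_persistent:
  assumes "\<omega> u = \<omega> w" "(u, w) \<in> E" "sym E" "u \<in> V" "w \<in> V" "fst ` set ms \<subseteq> V"
  shows "fold (play V E) ms \<omega> u = fold (play V E) ms \<omega> w"
  using assms
proof (induction ms arbitrary: \<omega>)
  case (Cons m ms)
  obtain v e where m: "m = (v, e)" by (cases m)
  have "play V E m \<omega> u = play V E m \<omega> w"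
    using Cons.prems unfolding m by (intro play_persistent) auto
  then show ?case using Cons by simp
qed simp

lemma mono_component_inside:
  assumes "sym E" "A \<subseteq> V" "v \<in> A"
    "\<And>u w. \<lbrakk>(u, w) \<in> E; u \<in> A; w \<in> V - A\<rbrakk> \<Longrightarrow> \<omega> u \<noteq> \<omega> w"
  shows "mono_component V E \<omega> v = mono_component A E \<omega> v"
proof -
  have "u \<in> reach E {u \<in> A. \<omega> u = \<omega> v} v" if "(v, u) \<in> (E \<inter> {u \<in> V. \<omega> u = \<omega> v} \<times> {u \<in> V. \<omega> u = \<omega> v})\<^sup>*" for u
    using that
  proof (induction rule: rtrancl_induct)
    case (step y z)
    have "y \<in> A" using step.IH reach_subset[of v "{u \<in> A. \<omega> u = \<omega> v}" E] assms(3) by auto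
    then have "z \<in> A" using step.hyps assms(4)[of y z] by auto
    then show ?case using step reach_step[OF step.IH, of z] assms(3) by auto
  qed (simp add: reach_self)
  moreover have "mono_component A E \<omega> v \<subseteq> mono_component V E \<omega> v"
  proof (rule mono_component_maximal)
    show "\<And>u. u \<in> mono_component A E \<omega> v \<Longrightarrow> \<omega> u = \<omega> v" "mono_component A E \<omega> v \<subseteq> V"
      using mono_component_mono[OF assms(3)] assms(2) by blast+
  qed (simp_all add: mono_component_linked mono_component_self assms(1))
  ultimately show ?thesis
    unfolding mono_component_reach reach_def by blast
qed

text \<open>The boundary of \<open>A\<close> is bichromatic at the end, hence by persistence at all
  times. Every component hit is then inside \<open>A\<close> or disjoint from it, and the moves in
  \<open>A\<close> form a game of their own. Agreement of the colourings is required on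
  \<open>A\<close> only, since moves outside change \<open>\<omega>\<close> there.\<close>

lemma fold_play_restrict:
  assumes "sym E" "A \<subseteq> V" "fst ` set ms \<subseteq> V"
    "\<And>u w. \<lbrakk>(u, w) \<in> E; u \<in> A; w \<in> V - A\<rbrakk>
       \<Longrightarrow> fold (play V E) ms \<omega> u \<noteq> fold (play V E) ms \<omega> w"
    "\<And>u. u \<in> A \<Longrightarrow> \<omega> u = \<omega>' u"
  shows "u \<in> A \<Longrightarrow> fold (play A E) (filter (\<lambda>m. fst m \<in> A) ms) \<omega>' u = fold (play V E) ms \<omega> u"
  using assms(3-5)
proof (induction ms arbitrary: \<omega> \<omega>')
  case (Cons m ms)
  obtain v e where m: "m = (v, e)" by (cases m)
  have cross: "\<omega> u \<noteq> \<omega> w" if "(u, w) \<in> E" "u \<in> A" "w \<in> V - A" for u w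
    using fold_play_persistent[of \<omega> u w E V "m # ms"] Cons.prems(2) Cons.prems(3)[OF that] that assms(1,2)
    by blast
  have prems: "u \<in> A" "fst ` set ms \<subseteq> V" using Cons.prems by auto
  have cross': "fold (play V E) ms (play V E m \<omega>) u \<noteq> fold (play V E) ms (play V E m \<omega>) w"
    if "(u, w) \<in> E" "u \<in> A" "w \<in> V - A" for u w
    using Cons.prems(3)[OF that] by simp
  show ?case
  proof (cases "v \<in> A")
    case True
    have "mono_component A E \<omega>' v = mono_component V E \<omega> v"
      using mono_component_inside[of E A V v \<omega>] mono_component_cong[of A \<omega> \<omega>' v E]
        assms(1,2) True cross Cons.prems(4) by metis
    then have "play V E m \<omega> x = play A E m \<omega>' x" if "x \<in> A" for x
      using Cons.prems(4) that by (simp add: m play_recolour recolour_def)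
    then show ?thesis using Cons.IH[OF prems cross', of "play A E m \<omega>'"] True by (simp add: m)
  next
    case False
    have v: "v \<in> V - A" using False Cons.prems(2) m by simp
    have "mono_component V E \<omega> v = mono_component (V - A) E \<omega> v"
      using cross assms(1) by (intro mono_component_inside) (use v in \<open>auto simp: sym_def, metis\<close>)
    then have "x \<notin> mono_component V E \<omega> v" if "x \<in> A" for x
      using mono_component_mono[OF v] that by blast
    then have "play V E m \<omega> x = \<omega>' x" if "x \<in> A" for x
      using Cons.prems(4) that by (simp add: m play_recolour recolour_def)
    then show ?thesis using Cons.IH[OF prems cross', of \<omega>'] False by (simp add: m)
  qed
qed simp

text \<open>Every move is played in exactly one of \<open>A\<close> and \<open>V - A\<close>, so the
  lengths add up. The case \<open>c \<noteq> d\<close> serves the region of the last move; for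
  \<open>c = d\<close> the boundary condition can only hold if no edge joins \<open>A\<close> to
  \<open>V - A\<close>, and this serves unions of components.\<close>

lemma floods_separate:
  assumes "sym E" "A \<subseteq> V" "set ms \<subseteq> V \<times> C"
    "\<And>u w. \<lbrakk>(u, w) \<in> E; u \<in> A; w \<in> V - A\<rbrakk>
       \<Longrightarrow> fold (play V E) ms \<omega> u \<noteq> fold (play V E) ms \<omega> w"
    "\<And>u. u \<in> A \<Longrightarrow> fold (play V E) ms \<omega> u = c"
    "\<And>u. u \<in> V - A \<Longrightarrow> fold (play V E) ms \<omega> u = d"
  obtains i j where "i + j \<le> length ms" "floodable A E C \<omega> c i" "floodable (V - A) E C \<omega> d j"
proof -
  let ?f = "\<lambda>B. filter (\<lambda>m. fst m \<in> B) ms"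
  have V: "fst ` set ms \<subseteq> V" using assms(3) by auto
  have A: "floods A E C \<omega> c (?f A)"
    using fold_play_restrict[OF assms(1,2) V, of \<omega> \<omega>] assms(3-5) by (auto simp: floods_def)
  have cross: "fold (play V E) ms \<omega> u \<noteq> fold (play V E) ms \<omega> w"
    if "(u, w) \<in> E" "u \<in> V - A" "w \<in> V - (V - A)" for u w
    using assms(1) assms(4)[of w u] that by (metis Diff_iff symD)
  have "floods (V - A) E C \<omega> d (?f (V - A))"
    using fold_play_restrict[OF assms(1) Diff_subset V, of A \<omega> \<omega>] cross assms(3,6) by (auto simp: floods_def)
  moreover have "length (?f A) + length (?f (V - A)) \<le> length ms"
    by (induction ms) auto
  ultimately show thesis using A that unfolding floodable_def by blast
qed

lemma floodable_components:
  assumes "sym E" "floodable V E C \<omega> d k" "A \<subseteq> V"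
    "\<And>u w. \<lbrakk>(u, w) \<in> E; u \<in> A\<rbrakk> \<Longrightarrow> w \<notin> V - A"
  obtains i j where "i + j \<le> k" "floodable A E C \<omega> d i" "floodable (V - A) E C \<omega> d j"
proof -
  obtain ms where "length ms \<le> k" "floods V E C \<omega> d ms" using assms(2) by (auto simp: floodable_def)
  then show thesis
    using floods_separate[of E A V ms C \<omega> d d] assms that unfolding floods_def
    by (smt (verit) order_trans subsetD Diff_iff)
qed

text \<open>The set \<^term>\<open>X\<close> is the region around \<^term>\<open>x\<close> hit by the last move at \<^term>\<open>x\<close>.\<close>

lemma floodable_last_region:
  assumes "sym E" "floodable V E C \<omega> c k" "\<omega> ` V \<subseteq> C" "c \<in> C" "x \<in> V"
  obtains X j where "x \<in> X" "X \<subseteq> V" "linked E X" "floodable (V - X) E C \<omega> c j"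
    "X = {x} \<and> \<omega> x = c \<and> j \<le> k \<or>
     (\<exists>c' i. c' \<in> C \<and> floodable X E C \<omega> c' i \<and> i + 1 + j \<le> k)"
proof -
  have "\<exists>X j. x \<in> X \<and> X \<subseteq> V \<and> linked E X \<and> floodable (V - X) E C \<omega> c j \<and>
    (X = {x} \<and> \<omega> x = c \<and> j \<le> k \<or>
     (\<exists>c' i. c' \<in> C \<and> floodable X E C \<omega> c' i \<and> i + 1 + j \<le> k))"
    using assms(2,3,5)
  proof (induction k arbitrary: V rule: less_induct)
    case (less k)
    obtain ms where ms: "length ms \<le> k" "floods V E C \<omega> c ms"
      using less.prems(1) by (auto simp: floodable_def)
    show ?case
    proof (cases ms rule: rev_cases)
      case Nil
      then have "\<forall>u\<in>V. \<omega> u = c" using ms by (auto simp: floods_def)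
      then show ?thesis using less.prems
        by (intro exI[of _ "{x}"] exI[of _ 0]) (auto simp: linked_def intro: floodable_0)
    next
      case (snoc ms' m)
      obtain v c1 where m: "m = (v, c1)" by (cases m)
      define \<eta> where "\<eta> = fold (play V E) ms' \<omega>"
      define X0 where "X0 = mono_component V E \<eta> v"
      have v: "v \<in> V" "set ms' \<subseteq> V \<times> C" using ms snoc m by (auto simp: floods_def)
      have fin: "recolour X0 c1 \<eta> u = c" if "u \<in> V" for u
        using ms that snoc m by (simp add: floods_def \<eta>_def X0_def play_recolour)
      have X0: "linked E X0" "X0 \<subseteq> V" "v \<in> X0" "\<And>u. u \<in> X0 \<Longrightarrow> \<eta> u = \<eta> v"
        unfolding X0_def using mono_component_props[OF assms(1) v(1)] by blast+
      have out: "\<eta> u = c" if "u \<in> V - X0" for u using fin[of u] that by (simp add: recolour_def)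
      have len: "length ms' < k" using ms snoc by simp
      have \<eta>C: "\<eta> u \<in> C" if "u \<in> V" for u
      proof -
        have "fold (play V E) ns \<xi> u \<in> C" if "set ns \<subseteq> V \<times> C" "\<xi> ` V \<subseteq> C" for ns \<xi>
          using that
        proof (induction ns arbitrary: \<xi>)
          case (Cons n ns)
          then show ?case by (cases n) (auto simp: play_recolour recolour_def image_subset_iff)
        qed (use \<open>u \<in> V\<close> in auto)
        then show ?thesis using v less.prems(2) by (simp add: \<eta>_def)
      qed
      show ?thesis
      proof (cases "\<eta> v = c")
        case True
        then have "floods V E C \<omega> c ms'"
          using out X0(4) v unfolding floods_def \<eta>_def[symmetric] by (metis DiffI)
        then have "floodable V E C \<omega> c (length ms')" by (auto simp: floodable_def)
        from less.IH[OF len this less.prems(2,3)] show ?thesis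
          using len by (fastforce intro: less_imp_le order_trans)
      next
        case False
        have "fold (play V E) ms' \<omega> u \<noteq> fold (play V E) ms' \<omega> w"
          if "u \<in> X0" "w \<in> V - X0" for u w
          using X0(4)[OF that(1)] out[OF that(2)] False unfolding \<eta>_def by metis
        then obtain i j where ij: "i + j \<le> length ms'" "floodable X0 E C \<omega> (\<eta> v) i"
            "floodable (V - X0) E C \<omega> c j"
          using floods_separate[OF assms(1) X0(2) v(2), of \<omega> "\<eta> v" c] X0(4) out
          unfolding \<eta>_def by blast
        show ?thesis
        proof (cases "x \<in> X0")
          case True
          have "\<exists>c' i. c' \<in> C \<and> floodable X0 E C \<omega> c' i \<and> i + 1 + j \<le> k"
            by (rule exI[of _ "\<eta> v"], rule exI[of _ i]) (use ij len \<eta>C v in auto)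
          then show ?thesis using True X0 ij by blast
        next
          \<comment> \<open>The region hit last misses \<open>x\<close> and is handed over to the
            complement of \<open>X\<close>. Giving it the colour \<open>c\<close> takes one move
            more than \<open>i\<close>, and this is the last move itself.\<close>
          case False
          have "j < k" using ij len by simp
          have im: "\<omega> ` (V - X0) \<subseteq> C" using less.prems(2) by blast
          then obtain X l where X: "x \<in> X" "X \<subseteq> V - X0" "linked E X" "floodable (V - X0 - X) E C \<omega> c l"
              "X = {x} \<and> \<omega> x = c \<and> l \<le> j \<or>
                (\<exists>c' i. c' \<in> C \<and> floodable X E C \<omega> c' i \<and> i + 1 + l \<le> j)"
            using less.IH[OF \<open>j < k\<close> ij(3) im] less.prems(3) False by blast
          have "floodable ((V - X0 - X) \<union> X0) E C \<omega> c (l + Suc i)"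
            by (intro floodable_Un floodable_recolour[OF ij(2)] X(4) assms X0(1))
               (use less.prems(2) X0(2) X(2) in auto)
          moreover have "(V - X0 - X) \<union> X0 = V - X" using X X0 by auto
          ultimately have "floodable (V - X) E C \<omega> c (l + Suc i)" by simp
          moreover have "X = {x} \<and> \<omega> x = c \<and> l + Suc i \<le> k \<or>
                (\<exists>c' i'. c' \<in> C \<and> floodable X E C \<omega> c' i' \<and> i' + 1 + (l + Suc i) \<le> k)"
            using X(5)
          proof
            assume "\<exists>c' i. c' \<in> C \<and> floodable X E C \<omega> c' i \<and> i + 1 + l \<le> j"
            then obtain c' i' where "c' \<in> C" "floodable X E C \<omega> c' i'" "i' + 1 + l \<le> j" by blast
            then show ?thesis using ij(1) len
              by (intro disjI2 exI[of _ c'] exI[of _ i']) auto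
          qed (use ij(1) len in auto)
          moreover have "X \<subseteq> V" using X by auto
          ultimately show ?thesis using X(1,3) by blast
        qed
      qed
    qed
  qed
  then show thesis using that by blast
qed

text \<open>A move can make only one colour disappear, that of the component it hits, and nothing
  but \<open>c\<close> survives.\<close>

lemma floodable_card_colours:
  assumes "floodable R E C \<omega> c j" "finite R"
  shows "card (\<omega> ` R - {c}) \<le> j"
  using assms(1)
proof (induction j arbitrary: \<omega>)
  case 0
  then show ?case
  proof (cases rule: floodable_cases)
    case finished
    then have "\<omega> ` R - {c} = {}" by auto
    then show ?thesis by (simp only: card.empty)
  qed simp
next
  case (Suc j)
  from Suc.prems show ?case
  proof (cases rule: floodable_cases)
    case finished
    then have "\<omega> ` R - {c} = {}" by auto
    then show ?thesis by (simp only: card.empty)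
  next
    case play: (move k' v e)
    let ?\<omega> = "play R E (v, e) \<omega>"
    have "\<omega> ` R - {c} \<subseteq> insert (\<omega> v) (?\<omega> ` R - {c})"
      using mono_component_mono[OF play(2), of _ E \<omega>]
      by (auto simp: play_recolour recolour_def image_iff)
    then have "card (\<omega> ` R - {c}) \<le> card (insert (\<omega> v) (?\<omega> ` R - {c}))"
      using assms(2) by (intro card_mono) auto
    also have "\<dots> \<le> Suc (card (?\<omega> ` R - {c}))"
      by (rule card_insert_le_m1) auto
    also have "\<dots> \<le> Suc j" using Suc.IH play by simp
    finally show ?thesis .
  qed
qed


section \<open>Spines of sections of the board\<close>

lemma board_adj_iff:
  "((i, j), (i', j')) \<in> board_adj n \<longleftrightarrow> (i, j) \<in> board n \<and> (i', j') \<in> board n \<and>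
     (i = i' \<and> (j' = Suc j \<or> j = Suc j') \<or> i \<noteq> i' \<and> j = j')"
  by (auto simp: board_adj_def)

lemma board_iff: "(i, j) \<in> board n \<longleftrightarrow> (i = 1 \<or> i = 2) \<and> 1 \<le> j \<and> j \<le> n"
  by (auto simp: board_def)

lemma sym_board_adj: "sym (board_adj n)"
  by (auto simp: sym_def board_adj_iff)

lemma finite_board: "finite (board n)"
  by (simp add: board_def)

text \<open>Each row has borders of its own, so both sides of a staggered cut are sections again; a
  row with \<open>R i < L i\<close> is empty.\<close>

definition sec :: "(nat \<Rightarrow> nat) \<Rightarrow> (nat \<Rightarrow> nat) \<Rightarrow> (nat \<times> nat) set" where
  "sec L R = {(i, j). (i = 1 \<or> i = 2) \<and> L i \<le> j \<and> j \<le> R i}"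

section \<open>Connected sets on a board with two rows\<close>

text \<open>The column changes by one along horizontal edges and not at all along vertical ones. A
  path to the right of column \<open>m\<close> must therefore step from \<open>m\<close> to
  \<open>Suc m\<close> within one row.\<close>

lemma linked_crossing:
  assumes "linked (board_adj n) Q" "(i, j) \<in> Q" "(i', j') \<in> Q" "j \<le> m" "m < j'"
  shows "\<exists>r. (r, m) \<in> Q \<and> (r, Suc m) \<in> Q"
proof -
  have "((i, j), (i', j')) \<in> (board_adj n \<inter> Q \<times> Q)\<^sup>*" using assms by (auto simp: linked_def)
  then have "(\<exists>r. (r, m) \<in> Q \<and> (r, Suc m) \<in> Q) \<or> snd (i', j') \<le> m"
  proof (induction rule: rtrancl_induct)
    case base
    then show ?case using assms by simp
  next
    case (step u v)
    obtain i j i' j' where [simp]: "u = (i, j)" "v = (i', j')" by (cases u, cases v)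
    have "i = i' \<and> (j' = Suc j \<or> j = Suc j') \<or> i \<noteq> i' \<and> j = j'" "(i, j) \<in> Q" "(i', j') \<in> Q"
      using step.hyps by (auto simp: board_adj_iff)
    then show ?case using step.IH by (cases "j' \<le> m") (auto simp: not_le le_less_Suc_eq le_Suc_eq)
  qed
  then show ?thesis using assms(5) by auto
qed

lemma linked_columns:
  assumes "linked (board_adj n) Q" "(i, j) \<in> Q" "(i', j') \<in> Q" "j \<le> m" "m \<le> j'"
  shows "\<exists>r. (r, m) \<in> Q"
  using linked_crossing[OF assms(1-3), of m] assms by (cases "m = j'") auto

text \<open>A detour to the columns up to \<open>t\<close> leaves and re-enters the right part
  through column \<open>Suc t\<close>. With only two rows the two cells used there are equal or
  adjacent, so the detour can be cut short.\<close>

lemma linked_right_part: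
  assumes "linked (board_adj n) Q" "Q \<subseteq> board n"
  shows "linked (board_adj n) {v \<in> Q. t < snd v}"
proof (unfold linked_def, intro ballI)
  let ?P = "{v \<in> Q. t < snd v}"
  fix u v assume u: "u \<in> ?P" and v: "v \<in> ?P"
  have "(u, v) \<in> (board_adj n \<inter> Q \<times> Q)\<^sup>*" using assms u v by (auto simp: linked_def)
  then have "(if t < snd v then (u, v) \<in> (board_adj n \<inter> ?P \<times> ?P)\<^sup>*
    else \<exists>r. (r, Suc t) \<in> Q \<and> (u, (r, Suc t)) \<in> (board_adj n \<inter> ?P \<times> ?P)\<^sup>*)"
  proof (induction rule: rtrancl_induct)
    case base
    then show ?case using u by simp
  next
    case (step w w')
    obtain i j i' j' where [simp]: "w = (i, j)" "w' = (i', j')" by (cases w, cases w')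
    have adj: "i = i' \<and> (j' = Suc j \<or> j = Suc j') \<or> i \<noteq> i' \<and> j = j'" "(i, j) \<in> Q" "(i', j') \<in> Q"
       "(w, w') \<in> board_adj n"
      using step.hyps by (auto simp: board_adj_iff)
    consider "t < j" "t < j'" | "t < j" "j' \<le> t" | "j \<le> t" "t < j'" | "j \<le> t" "j' \<le> t" by linarith
    then show ?case
    proof cases
      case 1
      then have "(u, w) \<in> (board_adj n \<inter> ?P \<times> ?P)\<^sup>*" "(w, w') \<in> board_adj n \<inter> ?P \<times> ?P"
        using step.IH adj by auto
      then show ?thesis using 1 by (auto intro: rtrancl_into_rtrancl)
    next
      case 2
      then have "j = Suc t" using adj by auto
      then show ?thesis using 2 step.IH adj by auto
    next
      case 3
      then have j': "j' = Suc t" using adj by auto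
      obtain r where r: "(r, Suc t) \<in> Q" "(u, (r, Suc t)) \<in> (board_adj n \<inter> ?P \<times> ?P)\<^sup>*"
        using step.IH 3 by auto
      show ?thesis
      proof (cases "r = i'")
        case True
        then show ?thesis using r j' by simp
      next
        case False
        then have "((r, Suc t), w') \<in> board_adj n \<inter> ?P \<times> ?P"
          using r(1) adj(3) j' assms(2) by (auto simp: board_adj_iff)
        with r(2) have "(u, w') \<in> (board_adj n \<inter> ?P \<times> ?P)\<^sup>*" by (rule rtrancl_into_rtrancl)
        then show ?thesis using j' by simp
      qed
    next
      case 4
      then show ?thesis using step.IH by auto
    qed
  qed
  then show "(u, v) \<in> (board_adj n \<inter> ?P \<times> ?P)\<^sup>*" using v by simp
qed

text \<open>All neighbours in \<open>Q\<close> of the removed component \<open>D\<close> belong to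
  \<open>D\<close> or \<open>X\<close>. After its last visit to \<open>D\<close> a path is therefore
  in \<open>X\<close>, and the rest of it avoids \<open>D\<close>.\<close>

lemma linked_without_component:
  assumes E: "sym E" and Q: "linked E Q" and X: "linked E X" "X \<subseteq> Q" "x \<in> X" and y: "y \<in> Q - X"
  shows "linked E (Q - reach E (Q - X) y)"
proof -
  define D where "D = reach E (Q - X) y"
  have D: "D \<subseteq> Q - X" unfolding D_def by (rule reach_subset[OF y])
  have XD: "X \<subseteq> Q - D" using D X by auto
  have "\<exists>x'\<in>X. (x', u) \<in> (E \<inter> (Q - D) \<times> (Q - D))\<^sup>*" if "(x, u) \<in> (E \<inter> Q \<times> Q)\<^sup>*" "u \<notin> D" for u
    using that
  proof (induction rule: rtrancl_induct)
    case (step v w)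
    have vw: "(v, w) \<in> E" "v \<in> Q" "w \<in> Q" using step.hyps by auto
    show ?case
    proof (cases "w \<in> X")
      case False
      then have "v \<notin> D" using reach_step[of v E "Q - X" y w] vw y step.prems by (auto simp: D_def)
      then obtain x' where x': "x' \<in> X" "(x', v) \<in> (E \<inter> (Q - D) \<times> (Q - D))\<^sup>*" using step.IH by auto
      have "(v, w) \<in> E \<inter> (Q - D) \<times> (Q - D)" using vw \<open>v \<notin> D\<close> step.prems by auto
      then show ?thesis using x' rtrancl_into_rtrancl by metis
    qed auto
  qed (use X in auto)
  moreover have "(x, x') \<in> (E \<inter> (Q - D) \<times> (Q - D))\<^sup>*" if "x' \<in> X" for x'
    using X that path_mono[OF _ XD] by (auto simp: linked_def)
  moreover have "(x, u) \<in> (E \<inter> Q \<times> Q)\<^sup>*" if "u \<in> Q" for u using Q X that by (auto simp: linked_def)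
  ultimately have "(x, u) \<in> (E \<inter> (Q - D) \<times> (Q - D))\<^sup>*" if "u \<in> Q - D" for u
    using that rtrancl_trans[of x _ "E \<inter> (Q - D) \<times> (Q - D)" u] by blast
  then show ?thesis unfolding D_def[symmetric] by (rule linked_if_centre[OF E])
qed

text \<open>A spine of a section is a connected set that meets all columns and contains the entry cell
  \<open>(a, L a)\<close> and the exit cell \<open>(b, R b)\<close>. The judgement says that some spine can be given colour
  \<open>c\<close> with \<open>k\<close> moves, all other cells having colours from \<open>I\<close>: these are the colours that
  the spine will run through afterwards. The number \<open>h\<close> bounds the height of the derivation.\<close>

inductive spine_cost :: "nat \<Rightarrow> 'c set \<Rightarrow> (nat \<times> nat \<Rightarrow> 'c) \<Rightarrow> nat \<Rightarrow> (nat \<Rightarrow> nat) \<Rightarrow> (nat \<Rightarrow> nat) \<Rightarrow>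
    nat \<Rightarrow> nat \<Rightarrow> 'c \<Rightarrow> 'c set \<Rightarrow> nat \<Rightarrow> bool" for n C \<omega> where
  base: "\<lbrakk>a = 1 \<or> a = 2; L a = R a; 1 \<le> L a; L a \<le> n; L a \<le> L (3 - a); R (3 - a) \<le> R a;
     \<omega> (a, L a) = c; L (3 - a) \<le> R (3 - a) \<and> \<omega> (3 - a, L a) \<notin> insert c I \<longrightarrow> 1 \<le> k\<rbrakk>
    \<Longrightarrow> spine_cost n C \<omega> (Suc h) L R a a c I k"
| split: "\<lbrakk>spine_cost n C \<omega> h L (\<lambda>i. min (p i) (R i)) a x c I k1;
     spine_cost n C \<omega> h (\<lambda>i. max (L i) (Suc (p i))) R y b c I k2;
     if x = y then max (L x) (Suc (p x)) = Suc (min (p x) (R x))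
     else max (L y) (Suc (p y)) \<le> min (p x) (R x);
     x = 1 \<or> x = 2; y = 1 \<or> y = 2; p 1 \<le> n; p 2 \<le> n; k1 + k2 \<le> k\<rbrakk>
    \<Longrightarrow> spine_cost n C \<omega> (Suc h) L R a b c I k"
| step: "\<lbrakk>spine_cost n C \<omega> h L R a b e (insert c I) k'; e \<in> C; c \<in> C; Suc k' \<le> k\<rbrakk>
    \<Longrightarrow> spine_cost n C \<omega> (Suc h) L R a b c I k"

lemma spine_cost_mono:
  assumes "spine_cost n C \<omega> h L R a b c I k" "h \<le> h'" "k \<le> k'"
  shows "spine_cost n C \<omega> h' L R a b c I k'"
  using assms
proof (induction arbitrary: h' k' rule: spine_cost.induct)
  case (base a L R c I k h)
  then obtain g where "h' = Suc g" by (cases h') auto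
  then show ?case using base by (auto intro: spine_cost.base)
next
  case (split h L p R a x c I k1 y b k2 k)
  then obtain g where g: "h' = Suc g" "h \<le> g" by (cases h') auto
  show ?case unfolding g(1)
    by (rule spine_cost.split[OF split.IH(1) split.IH(2)]) (use split g in auto)
next
  case (step h L R a b e c I l k)
  then obtain g where g: "h' = Suc g" "h \<le> g" by (cases h') auto
  show ?case unfolding g(1) by (rule spine_cost.step[OF step.IH]) (use step g in auto)
qed

lemma spine_cost_cong:
  assumes "spine_cost n C \<omega> h L R a b c I k" "L 1 = L' 1" "L 2 = L' 2" "R 1 = R' 1" "R 2 = R' 2"
  shows "spine_cost n C \<omega> h L' R' a b c I k"
  using assms
proof (induction arbitrary: L' R' rule: spine_cost.induct)
  case (base a L R c I k h)
  show ?case using base.hyps(1)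
    by (rule disjE; intro spine_cost.base) (use base in auto)
next
  case (split h L p R a x c I k1 y b k2 k)
  have "L x = L' x" "L y = L' y" "R x = R' x" using split by auto
  then show ?case
    by (intro spine_cost.split[of n C \<omega> h L' p R' a x c I k1 y b k2] split.IH) (use split in auto)
next
  case (step h L R a b e c I l k)
  then show ?case by (auto intro!: spine_cost.step)
qed

text \<open>Colours enter the rules through equations and memberships, which every map preserves,
  and through one non-membership that only makes the base rule dearer. So \<open>\<rho>\<close> need
  not be injective: identifying colours does not raise costs. This is what allows renaming in both
  directions.\<close>

lemma spine_cost_map:
  assumes "spine_cost n C \<omega> h L R a b c I k" "\<rho> ` C \<subseteq> C'" "\<And>v. v \<in> board n \<Longrightarrow> \<omega>' v = \<rho> (\<omega> v)"
  shows "spine_cost n C' \<omega>' h L R a b (\<rho> c) (\<rho> ` I) k"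
  using assms(1)
proof (induction rule: spine_cost.induct)
  case (base a L R c I k h)
  then have "(a, L a) \<in> board n" "(3 - a, L a) \<in> board n" by (auto simp: board_iff)
  then show ?case using base assms(3) by (auto intro!: spine_cost.base)
next
  case (split h L p R a x c I k1 y b k2 k)
  then show ?case by (intro spine_cost.split[where x = x and y = y])
next
  case (step h L R a b e c I l k)
  then show ?case using assms(2) by (intro spine_cost.step[where e = "\<rho> e"]) auto
qed

section \<open>Soundness of the calculus of spines\<close>

lemma sec_split: "sec L R = sec L (\<lambda>i. min (p i) (R i)) \<union> sec (\<lambda>i. max (L i) (Suc (p i))) R"
  "sec L (\<lambda>i. min (p i) (R i)) \<inter> sec (\<lambda>i. max (L i) (Suc (p i))) R = {}"
  by (auto simp: sec_def)

text \<open>The last two conditions place the entry and the exit cell in the outermost columns. A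
  connected set with these two cells then meets all columns, so this is not demanded
  separately.\<close>

definition spine :: "nat \<Rightarrow> (nat \<Rightarrow> nat) \<Rightarrow> (nat \<Rightarrow> nat) \<Rightarrow> nat \<Rightarrow> nat \<Rightarrow> (nat \<times> nat) set \<Rightarrow> bool" where
  "spine n L R a b Q \<longleftrightarrow> Q \<subseteq> sec L R \<and> sec L R \<subseteq> board n \<and> linked (board_adj n) Q \<and>
     (a, L a) \<in> Q \<and> (b, R b) \<in> Q \<and> L a \<le> L (3 - a) \<and> R (3 - b) \<le> R b"

lemma spine_ends:
  assumes "spine n L R a b Q"
  shows "a = 1 \<or> a = 2" "b = 1 \<or> b = 2" "\<And>i. i = 1 \<or> i = 2 \<Longrightarrow> L a \<le> L i \<and> R i \<le> R b"
  using assms by (auto simp: spine_def sec_def)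

lemma spine_columns:
  assumes "spine n L R a b Q" "(i, j) \<in> sec L R"
  shows "\<exists>r. (r, j) \<in> Q"
proof -
  have "i = 1 \<or> i = 2" "L i \<le> j" "j \<le> R i" using assms(2) by (auto simp: sec_def)
  then have "L a \<le> j" "j \<le> R b" using spine_ends(3)[OF assms(1), of i] by auto
  then show ?thesis using linked_columns assms(1) by (auto simp: spine_def)
qed

text \<open>In the column of any cell of the section the spine has a cell, which is that cell itself
  or its vertical neighbour.\<close>

lemma spine_absorb:
  assumes Q: "spine n L R a b Q" and P: "P \<subseteq> sec L R"
  shows "spine n L R a b (Q \<union> P)"
proof -
  have "linked (board_adj n) (Q \<union> P)"
  proof (rule linked_if_centre[OF sym_board_adj, of _ "(a, L a)"])
    fix u assume u: "u \<in> Q \<union> P"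
    have Qu: "((a, L a), v) \<in> (board_adj n \<inter> (Q \<union> P) \<times> (Q \<union> P))\<^sup>*" if "v \<in> Q" for v
      using Q that path_mono[of _ _ _ Q "Q \<union> P"] by (auto simp: spine_def linked_def)
    show "((a, L a), u) \<in> (board_adj n \<inter> (Q \<union> P) \<times> (Q \<union> P))\<^sup>*"
    proof (cases "u \<in> Q")
      case False
      obtain i j where ij: "u = (i, j)" by (cases u)
      then obtain r where r: "(r, j) \<in> Q" using spine_columns[OF Q] u P False by blast
      then have "((r, j), u) \<in> board_adj n \<inter> (Q \<union> P) \<times> (Q \<union> P)"
        using u False ij Q P by (auto simp: board_adj_iff spine_def)
      then show ?thesis using Qu[OF r] by (rule rtrancl_into_rtrancl[rotated])
    qed (rule Qu)
  qed
  then show ?thesis using Q P by (auto simp: spine_def)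
qed

text \<open>If exit and entry are in the same row, they are horizontal neighbours. In different rows
  it suffices that the two parts share a column: being disjoint, they occupy both of its cells, and
  these are adjacent.\<close>

lemma spine_join:
  assumes 1: "spine n L (\<lambda>i. min (p i) (R i)) a x Q1"
    and 2: "spine n (\<lambda>i. max (L i) (Suc (p i))) R y b Q2"
    and meet: "if x = y then max (L x) (Suc (p x)) = Suc (min (p x) (R x))
        else max (L y) (Suc (p y)) \<le> min (p x) (R x)"
  shows "spine n L R a b (Q1 \<union> Q2)"
proof -
  let ?R1 = "\<lambda>i. min (p i) (R i)" and ?L2 = "\<lambda>i. max (L i) (Suc (p i))"
  have sub: "Q1 \<subseteq> board n" "Q2 \<subseteq> board n" "Q1 \<inter> Q2 = {}"
    using 1 2 sec_split(2)[of L p R] by (auto simp: spine_def)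
  have ends: "(a, L a) \<in> Q1" "(x, ?R1 x) \<in> Q1" "(y, ?L2 y) \<in> Q2" "(b, R b) \<in> Q2"
    using 1 2 by (auto simp: spine_def)
  note e1 = spine_ends[OF 1] and e2 = spine_ends[OF 2]
  have in1: "L a \<le> ?R1 a" "L x \<le> ?R1 x" using ends 1 by (auto simp: spine_def sec_def)
  have in2: "?L2 y \<le> R y" "?L2 b \<le> R b" using ends 2 by (auto simp: spine_def sec_def)
  have "\<exists>u\<in>Q1. \<exists>v\<in>Q2. (u, v) \<in> board_adj n"
  proof (cases "x = y")
    case True
    then have "((x, ?R1 x), (y, ?L2 y)) \<in> board_adj n"
      using meet ends sub by (auto simp: board_adj_iff subset_iff)
    then show ?thesis using ends by blast
  next
    case False
    then have le: "?L2 y \<le> ?R1 x" using meet by simp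
    define j where "j = max (L a) (?L2 y)"
    have "L a \<le> L x" using e1(1,2) e1(3)[of x] by blast
    then have "j \<le> ?R1 x" using le in1 by (auto simp: j_def)
    then obtain r where r: "(r, j) \<in> Q1"
      using linked_columns[of n Q1 a "L a" x "?R1 x" j] 1 ends by (auto simp: spine_def j_def)
    have "?R1 x \<le> R b" using e2(3)[of x] e1(2) by auto
    then have "j \<le> R b" using \<open>j \<le> ?R1 x\<close> by linarith
    then obtain r' where r': "(r', j) \<in> Q2"
      using linked_columns[of n Q2 y "?L2 y" b "R b" j] 2 ends by (auto simp: spine_def j_def)
    have "r \<noteq> r'" using r r' sub by auto
    then have "((r, j), (r', j)) \<in> board_adj n" using r r' sub by (auto simp: board_adj_iff)
    then show ?thesis using r r' by blast
  qed
  then have "linked (board_adj n) (Q1 \<union> Q2)"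
    using linked_join[OF sym_board_adj] 1 2 unfolding spine_def by blast
  moreover have "Q1 \<union> Q2 \<subseteq> sec L R" "sec L R \<subseteq> board n"
    using 1 2 unfolding spine_def sec_split(1)[of L R p] by blast+
  moreover have "L a \<le> L (3 - a)" "R (3 - b) \<le> R b" using 1 2 by (auto simp: spine_def)
  ultimately show ?thesis using ends unfolding spine_def by blast
qed

lemma spine_cost_sound:
  assumes \<omega>: "\<omega> ` board n \<subseteq> C" and cost: "spine_cost n C \<omega> h L R a b c I k"
  shows "c \<in> C \<and> (\<exists>Q. spine n L R a b Q \<and> \<omega> ` (sec L R - Q) \<subseteq> I \<and>
    floodable Q (board_adj n) C \<omega> c k)"
  using cost
proof (induction rule: spine_cost.induct)
  case (base a L R c I k h)
  define j where "j = L a"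
  have a: "a = 1 \<or> a = 2" using base(1) .
  have S: "sec L R \<subseteq> {(a, j), (3 - a, j)}" "(a, j) \<in> sec L R"
    using base a by (auto simp: sec_def j_def)
  have c: "c = \<omega> (a, j)" "c \<in> C" "1 \<le> j" "j \<le> n"
    using base a \<omega> by (auto simp: j_def board_iff image_subset_iff)
  have sp: "spine n L R a a {(a, j)}"
    using S base a by (auto simp: spine_def j_def linked_def board_iff)
  show ?case
  proof (cases "\<omega> ` (sec L R - {(a, j)}) \<subseteq> insert c I")
    case True
    \<comment> \<open>All cells of colour \<open>c\<close> are taken into the spine free of charge,
      so that the colours left outside are in \<open>I\<close> even if \<open>I\<close> lacks
      \<open>c\<close>.\<close>
    define Q where "Q = {v \<in> sec L R. \<omega> v = c}"
    have "Q \<subseteq> sec L R" by (auto simp: Q_def)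
    have "spine n L R a a ({(a, j)} \<union> Q)" by (rule spine_absorb[OF sp]) (auto simp: Q_def)
    moreover have "{(a, j)} \<union> Q = Q" using S c by (auto simp: Q_def)
    moreover have "\<omega> ` (sec L R - Q) \<subseteq> I" using True c by (auto simp: Q_def)
    moreover have "floodable Q (board_adj n) C \<omega> c k" by (rule floodable_0) (simp add: Q_def)
    ultimately show ?thesis using c(2) by auto
  next
    case False
    then have o: "(3 - a, j) \<in> sec L R" "\<omega> (3 - a, j) \<notin> insert c I"
      using S by auto
    then have "1 \<le> k" using base a by (auto simp: sec_def j_def)
    have fl2: "floodable {(3 - a, j)} (board_adj n) C \<omega> c (Suc 0)"
      by (rule floodable_play[of "(3 - a, j)" _ c])
         (use c in \<open>auto intro!: floodable_0 simp: play_recolour recolour_def mono_component_self\<close>)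
    have fl1: "floodable {(a, j)} (board_adj n) C \<omega> c 0" by (rule floodable_0) (use c in auto)
    have disj: "{(a, j)} \<inter> {(3 - a, j)} = {}" using a by auto
    have im: "\<omega> ` ({(a, j)} \<union> {(3 - a, j)}) \<subseteq> C"
      using \<omega> a c by (auto simp: image_subset_iff board_iff)
    have "floodable ({(a, j)} \<union> {(3 - a, j)}) (board_adj n) C \<omega> c k"
      using floodable_mono[OF floodable_Un[OF sym_board_adj fl1 fl2 disj im c(2)]] \<open>1 \<le> k\<close> by simp
    moreover have "spine n L R a a ({(a, j)} \<union> {(3 - a, j)})" by (rule spine_absorb[OF sp]) (use o in simp)
    moreover have "sec L R - ({(a, j)} \<union> {(3 - a, j)}) = {}" using S by auto
    ultimately show ?thesis using c(2) by (metis empty_subsetI image_empty)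
  qed
next
  case (split h L p R a x c I k1 y b k2 k)
  obtain Q1 where Q1: "spine n L (\<lambda>i. min (p i) (R i)) a x Q1"
      "\<omega> ` (sec L (\<lambda>i. min (p i) (R i)) - Q1) \<subseteq> I" "floodable Q1 (board_adj n) C \<omega> c k1"
    using split.IH(1) by blast
  obtain Q2 where Q2: "spine n (\<lambda>i. max (L i) (Suc (p i))) R y b Q2"
      "\<omega> ` (sec (\<lambda>i. max (L i) (Suc (p i))) R - Q2) \<subseteq> I" "floodable Q2 (board_adj n) C \<omega> c k2"
    using split.IH(2) by blast
  have c: "c \<in> C" using split.IH(1) by blast
  have sp: "spine n L R a b (Q1 \<union> Q2)" by (rule spine_join[OF Q1(1) Q2(1) split.hyps(3)])
  have "\<omega> ` (sec L R - (Q1 \<union> Q2)) \<subseteq> I"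
    using Q1(2) Q2(2) unfolding sec_split(1)[of L R p] by blast
  moreover have "floodable (Q1 \<union> Q2) (board_adj n) C \<omega> c (k1 + k2)"
  proof (rule floodable_Un[OF sym_board_adj Q1(3) Q2(3) _ _ c])
    show "Q1 \<inter> Q2 = {}" using Q1(1) Q2(1) sec_split(2)[of L p R] unfolding spine_def by blast
    show "\<omega> ` (Q1 \<union> Q2) \<subseteq> C" using sp \<omega> unfolding spine_def by blast
  qed
  then have "floodable (Q1 \<union> Q2) (board_adj n) C \<omega> c k"
    by (rule floodable_mono) (rule split.hyps(8))
  ultimately show ?case using sp c by blast
next
  case (step h L R a b e c I k' k)
  obtain Q where Q: "spine n L R a b Q" "\<omega> ` (sec L R - Q) \<subseteq> insert c I"
      "floodable Q (board_adj n) C \<omega> e k'"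
    using step.IH by blast
  \<comment> \<open>Cells that have the colour \<open>c\<close> from the start need no move of their
    own. They join the spine when it takes this colour, and only colours of \<open>I\<close> are
    left outside.\<close>
  define P where "P = {v \<in> sec L R - Q. \<omega> v = c}"
  have sp: "spine n L R a b (Q \<union> P)" by (rule spine_absorb[OF Q(1)]) (auto simp: P_def)
  have "floodable Q (board_adj n) C \<omega> c (Suc k')"
    using floodable_recolour[OF Q(3)] Q(1) step.hyps(3) by (auto simp: spine_def)
  moreover have "floodable P (board_adj n) C \<omega> c 0" by (rule floodable_0) (auto simp: P_def)
  moreover have "\<omega> ` (Q \<union> P) \<subseteq> C" using sp \<omega> unfolding spine_def by blast
  ultimately have "floodable (Q \<union> P) (board_adj n) C \<omega> c (Suc k' + 0)"
    using step.hyps(3) by (intro floodable_Un[OF sym_board_adj]) (auto simp: P_def)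
  then have "floodable (Q \<union> P) (board_adj n) C \<omega> c k" using step.hyps(4) floodable_mono by fastforce
  moreover have "\<omega> ` (sec L R - (Q \<union> P)) \<subseteq> I" using Q(2) by (auto simp: P_def)
  ultimately show ?case using sp step.hyps(3) by blast
qed

section \<open>Completeness of the calculus of spines\<close>

text \<open>The spine takes the colours of \<open>J\<close> one after the other, in any order, each
  for one move; a colour taken no longer has to be among those to come.\<close>

lemma spine_cost_chain:
  assumes "finite J" "J \<subseteq> C" "spine_cost n C \<omega> h L R a b e (J \<union> I) k" "e \<in> C"
  shows "\<exists>e'\<in>C. spine_cost n C \<omega> (h + card J) L R a b e' I (k + card J)"
  using assms(1-3)
proof (induction J arbitrary: I rule: finite_induct)
  case empty
  then show ?case using assms(4) by auto
next
  case (insert g J)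
  have "spine_cost n C \<omega> h L R a b e (J \<union> insert g I) k" using insert.prems by simp
  then obtain e' where e': "e' \<in> C" "spine_cost n C \<omega> (h + card J) L R a b e' (insert g I) (k + card J)"
    using insert.IH[of "insert g I"] insert.prems by auto
  have "spine_cost n C \<omega> (Suc (h + card J)) L R a b g I (Suc (k + card J))"
    by (rule spine_cost.step[OF e'(2,1)]) (use insert.prems in auto)
  then show ?case using insert by auto
qed

text \<open>The first part of the spine, around the entry cell, is separated from the component that
  contains the exit cell; if the region of the last move at the entry cell contains the exit
  cell, it is itself a spine, and the colours of all other cells are left to be absorbed later.\<close>

lemma spine_cost_complete:
  assumes \<omega>: "\<omega> ` board n \<subseteq> C"
    and Q: "spine n L R a b Q" "\<omega> ` (sec L R - Q) \<subseteq> I"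
    and k: "floodable Q (board_adj n) C \<omega> c k" and c: "c \<in> C"
  shows "spine_cost n C \<omega> (k + card Q) L R a b c I k"
  using Q k c
\<comment> \<open>The measure bounds the height as well: passing to \<open>X\<close> saves a move,
  and a split leaves fewer cells in both parts. The additional steps for the colours of
  \<open>J\<close> are covered by the moves outside \<open>X\<close>.\<close>
proof (induction "k + card Q" arbitrary: k Q L R a b c I rule: less_induct)
  case less
  let ?E = "board_adj n"
  have Qb: "Q \<subseteq> board n" "Q \<subseteq> sec L R" "linked ?E Q"
    and ends: "(a, L a) \<in> Q" "(b, R b) \<in> Q" and valid: "L a \<le> L (3 - a)" "R (3 - b) \<le> R b"
    using less.prems(1) by (auto simp: spine_def)
  note rows = spine_ends[OF less.prems(1)]
  have fin: "finite Q" using Qb(1) finite_board finite_subset by blast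
  have \<omega>Q: "\<omega> ` Q \<subseteq> C" using \<omega> Qb by blast
  obtain X j where X: "(a, L a) \<in> X" "X \<subseteq> Q" "linked ?E X" "floodable (Q - X) ?E C \<omega> c j"
    and last: "X = {(a, L a)} \<and> \<omega> (a, L a) = c \<and> j \<le> k \<or>
     (\<exists>c' i. c' \<in> C \<and> floodable X ?E C \<omega> c' i \<and> i + 1 + j \<le> k)"
    using floodable_last_region[OF sym_board_adj less.prems(3) \<omega>Q less.prems(4) ends(1)] by blast
  show ?case
  proof (cases "(b, R b) \<in> X")
    case True
    from last show ?thesis
    proof
      assume X1: "X = {(a, L a)} \<and> \<omega> (a, L a) = c \<and> j \<le> k"
      then have ab: "b = a" "R a = L a" using True by auto
      have La: "(a, L a) \<in> board n" using ends Qb by auto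
      have "1 \<le> k" if o: "L (3 - a) \<le> R (3 - a)" "\<omega> (3 - a, L a) \<notin> insert c I"
      proof -
        have "L (3 - a) = L a" "R (3 - a) = L a" using valid ab o by auto
        then have S: "(3 - a, L a) \<in> sec L R" using rows(1) by (auto simp: sec_def)
        then have "(3 - a, L a) \<in> Q" using o(2) less.prems(2) by auto
        then have "(3 - a, L a) \<in> Q - X" using X1 rows(1) by auto
        with X(4) have "j \<noteq> 0"
          by (cases rule: floodable_cases) (use o(2) in auto)
        then show ?thesis using X1 by simp
      qed
      then have imp: "L (3 - a) \<le> R (3 - a) \<and> \<omega> (3 - a, L a) \<notin> insert c I \<longrightarrow> 1 \<le> k" by blast
      have "spine_cost n C \<omega> (Suc 0) L R a b c I k"
        unfolding ab(1)
        by (rule spine_cost.base[where L = L and R = R])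
           (use rows(1) ab La valid X1 imp in \<open>simp_all add: board_iff\<close>)
      moreover have "Suc 0 \<le> k + card Q" using ends(1) fin by (simp add: Suc_le_eq card_gt_0_iff) blast
      ultimately show ?thesis by (rule spine_cost_mono) simp
    next
      assume "\<exists>c' i. c' \<in> C \<and> floodable X ?E C \<omega> c' i \<and> i + 1 + j \<le> k"
      then obtain e i where e: "e \<in> C" "floodable X ?E C \<omega> e i" "i + 1 + j \<le> k" by blast
      \<comment> \<open>There are at most as many of these colours as moves made outside
        \<open>X\<close>. With these \<open>j\<close> moves the spine can run through all of them
        instead.\<close>
      define J where "J = \<omega> ` (Q - X) - {c}"
      have J: "finite J" "J \<subseteq> C" "card J \<le> j"
        using fin \<omega>Q floodable_card_colours[OF X(4)] by (auto simp: J_def)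
      have cards: "card X \<le> card Q" using X(2) fin by (simp add: card_mono)
      have spX: "spine n L R a b X"
        using X True less.prems(1) by (auto simp: spine_def)
      have "spine_cost n C \<omega> (i + card X) L R a b e (J \<union> insert c I) i"
      proof (rule less.hyps[OF _ spX _ e(2,1)])
        show "i + card X < k + card Q" using e(3) cards by simp
        show "\<omega> ` (sec L R - X) \<subseteq> J \<union> insert c I" using less.prems(2) by (auto simp: J_def)
      qed
      then obtain e' where e': "e' \<in> C"
          "spine_cost n C \<omega> (i + card X + card J) L R a b e' (insert c I) (i + card J)"
        using spine_cost_chain[OF J(1,2) _ e(1)] by blast
      have "spine_cost n C \<omega> (Suc (i + card X + card J)) L R a b c I k"
        by (rule spine_cost.step[OF e'(2,1) less.prems(4)]) (use e(3) J in auto)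
      then show ?thesis by (rule spine_cost_mono) (use e(3) J cards in auto)
    qed
  next
    case False
    \<comment> \<open>Only the component with the exit cell is cut off. The other components of
      \<open>Q - X\<close> stay with \<open>X\<close>, which keeps both parts connected.\<close>
    define Q2 where "Q2 = reach ?E (Q - X) (b, R b)"
    define Q1 where "Q1 = Q - Q2"
    have y: "(b, R b) \<in> Q - X" using False ends by auto
    have Q2: "Q2 \<subseteq> Q - X" "(b, R b) \<in> Q2" "linked ?E Q2"
      unfolding Q2_def using reach_subset[OF y] by (auto simp: reach_self linked_reach sym_board_adj)
    have Q2_closed: "w \<in> Q2" if "(u, w) \<in> ?E" "u \<in> Q2" "w \<in> Q - X" for u w
      using reach_step[of u ?E "Q - X" "(b, R b)" w] that y by (simp add: Q2_def)
    have Q1: "X \<subseteq> Q1" "linked ?E Q1"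
      using Q2 X linked_without_component[OF sym_board_adj Qb(3) X(3,2,1) y]
      by (auto simp: Q1_def Q2_def[symmetric])
    obtain j1 j2 where j: "j2 + j1 \<le> j" "floodable Q2 ?E C \<omega> c j2" "floodable (Q - X - Q2) ?E C \<omega> c j1"
      using floodable_components[OF sym_board_adj X(4) Q2(1)] Q2_closed by blast
    \<comment> \<open>In the second alternative of \<open>last\<close> the extra unit pays for
      turning \<open>X\<close> to \<open>c\<close>.\<close>
    have "\<exists>i. i + j \<le> k \<and> floodable X ?E C \<omega> c i"
      using last
    proof
      assume "X = {(a, L a)} \<and> \<omega> (a, L a) = c \<and> j \<le> k"
      then have "floodable X ?E C \<omega> c 0" "0 + j \<le> k" by (auto intro: floodable_0)
      then show ?thesis by blast
    next
      assume "\<exists>c' i. c' \<in> C \<and> floodable X ?E C \<omega> c' i \<and> i + 1 + j \<le> k"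
      then obtain c' i where "floodable X ?E C \<omega> c' i" "i + 1 + j \<le> k" by blast
      then show ?thesis using floodable_recolour[OF _ X(3) less.prems(4)]
        by (intro exI[of _ "Suc i"]) auto
    qed
    then obtain i where i: "i + j \<le> k" "floodable X ?E C \<omega> c i" by blast
    have "floodable (X \<union> (Q - X - Q2)) ?E C \<omega> c (i + j1)"
      using \<omega>Q X(2) by (intro floodable_Un[OF sym_board_adj i(2) j(3) _ _ less.prems(4)]) auto
    moreover have "X \<union> (Q - X - Q2) = Q1" using X Q2 by (auto simp: Q1_def)
    ultimately have fl1: "floodable Q1 ?E C \<omega> c (i + j1)" by simp
    have card1: "card Q1 < card Q" "card Q2 < card Q"
      using psubset_card_mono[OF fin] Q2 X(1,2) by (auto simp: Q1_def)
    define t where "t = Max (snd ` X)"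
    define z where "z = Min (snd ` Q2)"
    have finX: "finite X" "finite Q2" using fin X Q2 finite_subset by (blast, blast)
    have t: "v \<in> X \<Longrightarrow> snd v \<le> t" "t \<in> snd ` X" for v
      unfolding t_def using finX X(1) by (auto intro!: Max_in)
    have z: "v \<in> Q2 \<Longrightarrow> z \<le> snd v" "z \<in> snd ` Q2" for v
      unfolding z_def using finX Q2(2) by (auto intro!: Min_in)
    obtain xr where xr: "(xr, t) \<in> X" using t(2) by auto
    obtain zr where zr: "(zr, z) \<in> Q2" using z(2) by auto
    have Lat: "L a \<le> t" using t(1)[OF X(1)] by simp
    have zR: "z \<le> R b" using z(1)[OF Q2(2)] by simp
    have cols: "L a \<le> m \<and> m \<le> R b" if "(r, m) \<in> Q" for r m
    proof -
      have "(r = 1 \<or> r = 2) \<and> L r \<le> m \<and> m \<le> R r" using that Qb(2) by (auto simp: sec_def)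
      then show ?thesis using rows(3)[of r] by linarith
    qed
    \<comment> \<open>The cells of \<open>Q\<close> to the right of column \<open>t\<close> form a
      connected set that avoids \<open>X\<close> and includes the exit cell, so they all belong to
      \<open>Q2\<close>.\<close>
    have right: "(r, m) \<in> Q2" if "(r, m) \<in> Q" "t < m" for r m
    proof -
      let ?P = "{v \<in> Q. t < snd v}"
      have P: "(r, m) \<in> ?P" "(b, R b) \<in> ?P" using that ends cols[OF that(1)] by auto
      have "?P \<subseteq> Q - X" using t(1) by fastforce
      then have "?P \<subseteq> Q2" unfolding Q2_def
        by (rule reach_maximal[OF linked_right_part[OF Qb(3,1)] _ P(2)])
      then show ?thesis using P by blast
    qed
    have row12: "r = 1 \<or> r = 2" if "(r, m) \<in> Q" for r m using that Qb(1) by (auto simp: board_iff)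
    have other: "r = 3 - r'" if "(r, m) \<in> X" "(r', m) \<in> Q2" for r r' m
    proof -
      have "r \<noteq> r'" using that Q2 by auto
      moreover have "(r, m) \<in> Q" "(r', m) \<in> Q" using that X(2) Q2(1) by blast+
      ultimately show ?thesis using row12[of r m] row12[of r' m] by auto
    qed
    have tn: "t \<le> n" using xr X(2) Qb(1) by (auto simp: board_iff)
    have zn: "z \<le> n" using zr Q2(1) Qb(1) by (auto simp: board_iff)
    \<comment> \<open>The cut \<open>p\<close> has one column for each row and tells
      \<open>Q2\<close> from the rest of \<open>Q\<close>; \<open>x\<close> and \<open>y\<close> are
      the rows in which the left part ends and the right part begins.\<close>
    obtain p x y where p: "p 1 \<le> n" "p 2 \<le> n" "x = 1 \<or> x = 2" "y = 1 \<or> y = 2"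
      and parts: "\<And>r m. (r, m) \<in> Q \<Longrightarrow> (r, m) \<in> Q2 \<longleftrightarrow> p r < m"
      and exit: "(x, min (p x) (R x)) \<in> Q1" "min (p (3 - x)) (R (3 - x)) \<le> min (p x) (R x)"
      and entry: "(y, max (L y) (Suc (p y))) \<in> Q2"
        "max (L y) (Suc (p y)) \<le> max (L (3 - y)) (Suc (p (3 - y)))"
      and meet: "if x = y then max (L x) (Suc (p x)) = Suc (min (p x) (R x))
        else max (L y) (Suc (p y)) \<le> min (p x) (R x)"
    proof (cases "z \<le> t")
      case zt: True
      have X_col: "\<exists>r. (r, m) \<in> X" if "L a \<le> m" "m \<le> t" for m
        using linked_columns[OF X(3,1) xr that] .
      have Q2_col: "\<exists>r. (r, m) \<in> Q2" if "z \<le> m" "m \<le> R b" for m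
        using linked_columns[OF Q2(3) zr Q2(2) that] .
      have "L a \<le> z" using cols[of zr z] zr Q2(1) by blast
      have tR: "t \<le> R b" using cols[of xr t] xr X(2) by blast
      have xr12: "xr = 1 \<or> xr = 2" using row12 xr X(2) by blast
      \<comment> \<open>Where the parts overlap, each column has one cell of \<open>X\<close> and
        one of \<open>Q2\<close>. Being connected, \<open>X\<close> cannot change rows there, so it
        keeps the row \<open>xr\<close> of its last column. The induction goes from \<open>t\<close>
        down to \<open>z\<close>.\<close>
      have X_row: "(xr, m) \<in> X \<and> (3 - xr, m) \<in> Q2" if "z \<le> m" "m \<le> t" for m
        using that(2,1)
      proof (induction m rule: inc_induct)
        case base
        then obtain r where r: "(r, t) \<in> Q2" using Q2_col tR by blast
        then have "r = 1 \<or> r = 2" using row12 Q2(1) by blast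
        then have "r = 3 - xr" using other[OF xr r] by auto
        then show ?case using xr r by simp
      next
        case (step m)
        have m: "L a \<le> m" "m \<le> R b" using \<open>L a \<le> z\<close> step tR by auto
        obtain r where r: "(r, m) \<in> X" "(r, Suc m) \<in> X"
          using linked_crossing[OF X(3,1) xr m(1)] step by auto
        have S: "(3 - xr, Suc m) \<in> Q2" using step.IH step.prems by simp
        have "r = xr" using other[OF r(2) S] xr12 by auto
        obtain r' where r': "(r', m) \<in> Q2" using Q2_col m step.prems by blast
        then have "r' = 1 \<or> r' = 2" using row12 Q2(1) by blast
        then have "r' = 3 - xr" using other[OF r(1) r'] \<open>r = xr\<close> by auto
        then show ?case using r(1) r' \<open>r = xr\<close> by simp
      qed
      \<comment> \<open>Row \<open>xr\<close> is cut after the last column of \<open>X\<close>, the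
        other row just before the first column of \<open>Q2\<close>. As \<open>z\<close> is
        positive, the subtraction is exact.\<close>
      define p where "p = (\<lambda>i. if i = xr then t else z - 1)"
      have z1: "1 \<le> z" using zr Q2(1) Qb(1) by (auto simp: board_iff)
      have zQ2: "(3 - xr, z) \<in> Q2" using X_row zt by blast
      have 1: "L xr \<le> t" "t \<le> R xr" using xr X(2) Qb(2) by (auto simp: sec_def)
      have 2: "L (3 - xr) \<le> z" using zQ2 Q2(1) Qb(2) by (auto simp: sec_def)
      have px: "p xr = t" "p (3 - xr) = z - 1" using xr12 by (auto simp: p_def)
      show thesis
      proof (rule that[of p xr "3 - xr"])
        show "(r, m) \<in> Q2 \<longleftrightarrow> p r < m" if rm: "(r, m) \<in> Q" for r m
        proof (cases "r = xr")
          case True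
          have "(r, m) \<notin> Q2" if "m \<le> t"
          proof
            assume "(r, m) \<in> Q2"
            then show False using z(1) X_row[of m] that True Q2(1) by fastforce
          qed
          then show ?thesis using True px(1) right[OF rm] not_le by metis
        next
          case False
          then have r: "r = 3 - xr" using row12[OF rm] xr12 by auto
          show ?thesis
            using z(1)[of "(r, m)"] z1 X_row[of m] right[OF rm] r px
            by (cases "m \<le> t") auto
        qed
        show "(xr, min (p xr) (R xr)) \<in> Q1" using 1 px xr Q1(1) by auto
        show "(3 - xr, max (L (3 - xr)) (Suc (p (3 - xr)))) \<in> Q2" using 2 px zQ2 z1 by (simp add: max_def)
      qed (use px 1 2 zt z1 xr12 tn zn in \<open>auto simp: p_def\<close>)
    next
      case zt: False
      have "t < R b" using zt zR by simp
      \<comment> \<open>Without overlap the cut is straight, and \<open>r\<close> is a row in which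
        \<open>Q\<close> crosses it.\<close>
      then obtain r where r: "(r, t) \<in> Q" "(r, Suc t) \<in> Q"
        using linked_crossing[OF Qb(3) ends Lat] by blast
      then have z_eq: "z = Suc t" using right[OF r(2)] z(1) zt by fastforce
      have rR: "L r \<le> t" "Suc t \<le> R r" using r Qb(2) by (auto simp: sec_def)
      have r12: "r = 1 \<or> r = 2" using row12[OF r(1)] .
      have iff: "(r, m) \<in> Q2 \<longleftrightarrow> t < m" if "(r, m) \<in> Q" for r m
        using right[OF that] z(1)[of "(r, m)"] z_eq by auto
      show thesis
      proof (rule that[of "\<lambda>_. t" r r])
        show "(r, min t (R r)) \<in> Q1" using rR r iff by (simp add: Q1_def)
        show "(r, max (L r) (Suc t)) \<in> Q2" using rR right[OF r(2)] by (simp add: max_def)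
      qed (use rR r12 tn iff in auto)
    qed
    let ?R1 = "\<lambda>i. min (p i) (R i)" and ?L2 = "\<lambda>i. max (L i) (Suc (p i))"
    have S1: "Q1 = Q \<inter> sec L ?R1" and S2: "Q2 = Q \<inter> sec ?L2 R"
      using parts Qb(2) Q2(1) unfolding Q1_def by (auto simp: sec_def)
    have "sec L R \<subseteq> board n" using less.prems(1) by (simp add: spine_def)
    then have sp1: "spine n L ?R1 a x Q1" and sp2: "spine n ?L2 R y b Q2"
      using S1 S2 Q1 Q2 X(1) exit entry valid sec_split(1)[of L R p] unfolding spine_def by blast+
    have k: "i + j1 \<le> k" "j2 \<le> k" "(i + j1) + j2 \<le> k" using i(1) j(1) by auto
    have out1: "\<omega> ` (sec L ?R1 - Q1) \<subseteq> I" and out2: "\<omega> ` (sec ?L2 R - Q2) \<subseteq> I"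
      using less.prems(2) sec_split(1)[of L R p] S1 S2 by blast+
    let ?h = "k + card Q - 1"
    have 1: "spine_cost n C \<omega> ?h L ?R1 a x c I (i + j1)"
      using less.hyps[OF _ sp1 out1 fl1 less.prems(4)] card1 k by (auto intro: spine_cost_mono)
    have 2: "spine_cost n C \<omega> ?h ?L2 R y b c I j2"
      using less.hyps[OF _ sp2 out2 j(2) less.prems(4)] card1 k by (auto intro: spine_cost_mono)
    have "spine_cost n C \<omega> (Suc ?h) L R a b c I k"
      by (rule spine_cost.split[OF 1 2 meet p(3,4,1,2) k(3)])
    moreover have "Suc ?h = k + card Q" using card1 by simp
    ultimately show ?thesis by simp
  qed
qed

lemma sec_full_board: "sec (\<lambda>_. 1) (\<lambda>_. n) = board n"
  by (auto simp: sec_def board_iff)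

lemma spine_full_board:
  assumes "n \<ge> 1"
  shows "spine n (\<lambda>_. 1) (\<lambda>_. n) 1 1 (board n)"
proof -
  have "linked (board_adj n) {(1, 1)}" by (auto simp: linked_def)
  moreover have row: "linked (board_adj n) ({1} \<times> {1..m})" if "1 \<le> m" "m \<le> n" for m
    using that
  proof (induction m rule: dec_induct)
    case base
    then show ?case by (auto simp: linked_def)
  next
    case (step m)
    have L: "linked (board_adj n) ({1} \<times> {1..m} \<union> {(1, Suc m)})"
      by (rule linked_join[OF sym_board_adj, of _ _ _ "(1, m)" "(1, Suc m)"])
         (use step in \<open>auto simp: linked_def board_adj_iff board_iff\<close>)
    have "{1} \<times> {1..m} \<union> {(1, Suc m)} = {1} \<times> {1..Suc m}" using step by auto
    then show ?case using L by (rule subst)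
  qed
  have "spine n (\<lambda>_. 1) (\<lambda>_. n) 1 1 ({1} \<times> {1..n})"
    using row[of n] assms unfolding spine_def sec_full_board by (auto simp: board_iff)
  from spine_absorb[OF this, of "board n"] have "spine n (\<lambda>_. 1) (\<lambda>_. n) 1 1 ({1} \<times> {1..n} \<union> board n)"
    unfolding sec_full_board by simp
  moreover have "{1} \<times> {1..n} \<union> board n = board n" by (auto simp: board_iff)
  ultimately show ?thesis by simp
qed

text \<open>With no colours to come no cell may remain off the spine, so the spine is the whole
  board.\<close>

lemma floodable_if_spine_cost:
  assumes "\<omega> ` board n \<subseteq> C" "spine_cost n C \<omega> h (\<lambda>_. 1) (\<lambda>_. n) 1 1 c {} k"
  shows "c \<in> C" "floodable (board n) (board_adj n) C \<omega> c k"
proof -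
  obtain Q where Q: "c \<in> C" "spine n (\<lambda>_. 1) (\<lambda>_. n) 1 1 Q" "board n - Q = {}"
      "floodable Q (board_adj n) C \<omega> c k"
    using spine_cost_sound[OF assms] unfolding sec_full_board by auto
  moreover have "Q = board n" using Q by (auto simp: spine_def sec_full_board)
  ultimately show "c \<in> C" "floodable (board n) (board_adj n) C \<omega> c k" by auto
qed

text \<open>The board has \<open>2 * n\<close> cells. An optimal game has at most
  \<open>2 * n\<close> moves, so heights up to \<open>4 * n\<close> suffice; this determines the
  number of rounds.\<close>

lemma spine_cost_if_floodable:
  assumes "n \<ge> 1" "\<omega> ` board n \<subseteq> C" "c \<in> C" "floodable (board n) (board_adj n) C \<omega> c k"
  shows "spine_cost n C \<omega> (k + 2 * n) (\<lambda>_. 1) (\<lambda>_. n) 1 1 c I k"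
proof -
  have "card (board n) = 2 * n" by (simp add: board_def card_cartesian_product)
  moreover have "\<omega> ` (sec (\<lambda>_. 1) (\<lambda>_. n) - board n) \<subseteq> I"
    unfolding sec_full_board by simp
  ultimately show ?thesis
    using spine_cost_complete[OF assms(2) spine_full_board[OF assms(1)] _ assms(4,3)] by metis
qed


section \<open>Running time of programs\<close>

definition runs :: "com \<Rightarrow> nat \<Rightarrow> (state \<Rightarrow> bool) \<Rightarrow> (state \<Rightarrow> bool) \<Rightarrow> bool" where
  "runs P \<tau> A D \<longleftrightarrow> (\<forall>s. A s \<longrightarrow> (\<exists>t s'. exec P s t s' \<and> t \<le> \<tau> \<and> D s'))"

lemma runs_Seq:
  assumes "runs P \<tau>1 A B" "runs Q \<tau>2 B D"
  shows "runs (Seq P Q) (\<tau>1 + \<tau>2) A D"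
  using assms unfolding runs_def by (meson add_mono exec.Seq)

lemma runs_weaken:
  assumes "runs P \<tau> A D" "\<tau> \<le> \<tau>'" "\<And>s. A' s \<Longrightarrow> A s" "\<And>s. D s \<Longrightarrow> D' s"
  shows "runs P \<tau>' A' D'"
  using assms unfolding runs_def by (meson order_trans)

primrec straight :: "com \<Rightarrow> bool" where
  "straight Skip = True"
| "straight (Store b a e) = True"
| "straight (Seq P Q) = (straight P \<and> straight Q)"
| "straight (If e P Q) = (straight P \<and> straight Q)"
| "straight (While e P) = False"

text \<open>On loop-free programs execution is a function, which the simplifier can evaluate. The
  clause for \<open>While\<close> is a dummy that \<open>straight\<close> excludes.\<close>

primrec result :: "com \<Rightarrow> state \<Rightarrow> state" where
  "result Skip s = s"
| "result (Store b a e) s = s(b := (s b)(aval a s := aval e s))"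
| "result (Seq P Q) s = result Q (result P s)"
| "result (If e P Q) s = (if bval e s then result P s else result Q s)"
| "result (While e P) s = s"

text \<open>An upper bound is enough, so both branches of a conditional are charged.\<close>

primrec max_cost :: "com \<Rightarrow> nat" where
  "max_cost Skip = 1"
| "max_cost (Store b a e) = acost a + acost e + 1"
| "max_cost (Seq P Q) = max_cost P + max_cost Q"
| "max_cost (If e P Q) = bcost e + (max_cost P + max_cost Q) + 1"
| "max_cost (While e P) = 0"

lemma straight_exec: "straight P \<Longrightarrow> \<exists>t\<le>max_cost P. exec P s t (result P s)"
proof (induction P arbitrary: s)
  case Skip
  show ?case using exec.Skip by auto
next
  case (Store b a e)
  show ?case using exec.Store[of b a e s] unfolding result.simps max_cost.simps by blast
next
  case (Seq P Q)
  then obtain t1 t2 where "t1 \<le> max_cost P" "exec P s t1 (result P s)"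
    "t2 \<le> max_cost Q" "exec Q (result P s) t2 (result Q (result P s))"
    by (metis straight.simps(3))
  then show ?case by (auto intro!: exI[of _ "t1 + t2"] exec.Seq)
next
  case (If e P Q)
  show ?case
  proof (cases "bval e s")
    case True
    obtain t where "t \<le> max_cost P" "exec P s t (result P s)" using If by auto
    then show ?thesis using True by (auto intro!: exI[of _ "bcost e + t + 1"] exec.IfTrue simp del: add_Suc_right)
  next
    case False
    obtain t where "t \<le> max_cost Q" "exec Q s t (result Q s)" using If by auto
    then show ?thesis using False by (auto intro!: exI[of _ "bcost e + t + 1"] exec.IfFalse simp del: add_Suc_right)
  qed
qed simp

lemma runs_straight:
  assumes "straight P" "\<And>s. A s \<Longrightarrow> D (result P s)" "max_cost P \<le> \<tau>"
  shows "runs P \<tau> A D"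
  unfolding runs_def using straight_exec[OF assms(1)] assms(2,3) by (meson order_trans)

definition For :: "nat \<Rightarrow> aexp \<Rightarrow> com \<Rightarrow> com" where
  "For v bnd P = Seq (Store 1 (Num v) (Num 0)) (While (Less (Cell 1 (Num v)) bnd)
     (Seq P (Store 1 (Num v) (Add (Cell 1 (Num v)) (Num 1)))))"

text \<open>An iteration pays \<open>acost bnd + 3\<close> for the test, 6 for the increment and 1
  for the loop step in addition to the body; the failing test and the initialisation give the
  remaining \<open>acost bnd + 7\<close>. The bound is evaluated anew each time, so the invariant
  has to fix its value.\<close>

lemma runs_For:
  assumes body: "\<And>i. i < N \<Longrightarrow> runs P \<tau> (\<lambda>s. A i s \<and> s 1 v = i) (\<lambda>s. A (Suc i) s \<and> s 1 v = i)"
    and indep: "\<And>i s x. A i s \<Longrightarrow> A i (s(1 := (s 1)(v := x)))"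
    and bnd: "\<And>i s. A i s \<Longrightarrow> aval bnd s = N"
  shows "runs (For v bnd P) (N * (\<tau> + acost bnd + 10) + acost bnd + 7) (A 0) (A N)"
proof -
  let ?Q = "Seq P (Store 1 (Num v) (Add (Cell 1 (Num v)) (Num 1)))"
  let ?W = "While (Less (Cell 1 (Num v)) bnd) ?Q"
  have W: "\<exists>t s'. exec ?W s t s' \<and> t \<le> d * (\<tau> + acost bnd + 10) + acost bnd + 4 \<and> A N s'"
    if "d \<le> N" "A (N - d) s" "s 1 v = N - d" for d s
    using that
  proof (induction d arbitrary: s)
    case 0
    then have "\<not> bval (Less (Cell 1 (Num v)) bnd) s" using bnd[OF 0(2)] by simp
    from exec.WhileFalse[OF this, of ?Q] show ?case using 0 by (intro exI conjI) auto
  next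
    case (Suc d)
    let ?i = "N - Suc d"
    have i: "?i < N" "Suc ?i = N - d" using Suc.prems by auto
    have b: "bval (Less (Cell 1 (Num v)) bnd) s" using bnd[OF Suc.prems(2)] Suc.prems i by simp
    obtain t1 s1 where s1: "exec P s t1 s1" "t1 \<le> \<tau>" "A (N - d) s1" "s1 1 v = ?i"
      using body[OF i(1)] Suc.prems i unfolding runs_def by metis
    define s2 where "s2 = s1(1 := (s1 1)(v := N - d))"
    have "exec (Store 1 (Num v) (Add (Cell 1 (Num v)) (Num 1))) s1 6 s2"
      using exec.Store[of 1 "Num v" "Add (Cell 1 (Num v)) (Num 1)" s1] s1(4) i
      by (simp add: s2_def eval_nat_numeral)
    with s1(1) have "exec ?Q s (t1 + 6) s2" by (rule exec.Seq)
    moreover obtain t s' where t: "exec ?W s2 t s'" "t \<le> d * (\<tau> + acost bnd + 10) + acost bnd + 4" "A N s'"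
      using Suc.IH[of s2] Suc.prems(1) indep[OF s1(3), of "N - d"] unfolding s2_def[symmetric]
      by (fastforce simp: s2_def)
    ultimately have "exec ?W s (bcost (Less (Cell 1 (Num v)) bnd) + (t1 + 6) + t + 1) s'"
      using exec.WhileTrue[OF b] by blast
    then show ?case using s1(2) t(2,3) by (intro exI conjI) auto
  qed
  show ?thesis
    unfolding runs_def
  proof (intro allI impI)
    fix s assume "A 0 s"
    then have "A 0 (s(1 := (s 1)(v := 0)))" by (rule indep)
    then obtain t s' where t: "exec ?W (s(1 := (s 1)(v := 0))) t s'"
        "t \<le> N * (\<tau> + acost bnd + 10) + acost bnd + 4" "A N s'"
      using W[of N] by fastforce
    have "exec (Store 1 (Num v) (Num 0)) s 3 (s(1 := (s 1)(v := 0)))"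
      using exec.Store[of 1 "Num v" "Num 0" s] by (simp add: eval_nat_numeral)
    then have "exec (For v bnd P) s (3 + t) s'" unfolding For_def using t(1) by (rule exec.Seq)
    then show "\<exists>t s'. exec (For v bnd P) s t s' \<and> t \<le> N * (\<tau> + acost bnd + 10) + acost bnd + 7 \<and> A N s'"
      using t(2,3) by (intro exI conjI) auto
  qed
qed

section \<open>Nested loops\<close>

primrec loops :: "(nat \<times> aexp) list \<Rightarrow> com \<Rightarrow> com" where
  "loops [] P = P"
| "loops (x # xs) P = For (fst x) (snd x) (loops xs P)"

text \<open>Loop bounds cost at most 2 to evaluate, which turns the constants of
  \<open>runs_For\<close> into 12 and 9; their sum is the 21 in
  \<open>loops_time_le\<close>.\<close>

primrec loops_time :: "nat \<Rightarrow> nat list \<Rightarrow> nat" where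
  "loops_time \<tau> [] = \<tau>"
| "loops_time \<tau> (n # ns) = n * (loops_time \<tau> ns + 12) + 9"

lemma loops_time_le:
  assumes "\<forall>n\<in>set ns. 1 \<le> n"
  shows "loops_time \<tau> ns \<le> prod_list ns * (\<tau> + 21 * length ns)"
  using assms
proof (induction ns)
  case (Cons n ns)
  have "\<forall>n\<in>set ns. 1 \<le> n" "1 \<le> n" using Cons.prems by auto
  then have 1: "1 \<le> prod_list ns" by (induction ns) auto
  have "loops_time \<tau> (n # ns) \<le> n * (loops_time \<tau> ns + 21)" using \<open>1 \<le> n\<close> by (simp add: algebra_simps)
  also have "\<dots> \<le> n * (prod_list ns * (\<tau> + 21 * length ns) + prod_list ns * 21)"
    using Cons 1 by (intro mult_le_mono2 add_le_mono) auto
  also have "\<dots> = prod_list (n # ns) * (\<tau> + 21 * length (n # ns))" by (simp add: algebra_simps)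
  finally show ?case .
qed simp

text \<open>Here \<open>rel s s'\<close> expresses progress from \<open>s\<close> to \<open>s'\<close>, and \<open>eff e s\<close> that the body has
  taken effect for the values \<open>e\<close> of the loop variables.\<close>

lemma loops_exec:
  assumes bnd: "\<forall>(v, e)\<in>set vs. acost e \<le> 2 \<and> (\<forall>s. Inv s \<longrightarrow> aval e s = N v)"
    and body: "\<And>s. Inv s \<Longrightarrow> (\<forall>v\<in>V. s 1 v < N v) \<Longrightarrow>
      \<exists>t s'. exec P s t s' \<and> t \<le> \<tau> \<and> Inv s' \<and> s' 1 = s 1 \<and> rel s s' \<and> eff (s 1) s'"
    and Inv: "\<And>s f. Inv s \<Longrightarrow> Inv (s(1 := f))"
    and rel: "\<And>s f. rel s (s(1 := f))"
    and trans: "\<And>s s' s''. rel s s' \<Longrightarrow> rel s' s'' \<Longrightarrow> rel s s''"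
    and eff: "\<And>e s s'. eff e s \<Longrightarrow> rel s s' \<Longrightarrow> eff e s'"
    and "distinct (map fst vs)" "Inv s" "\<forall>v\<in>V - fst ` set vs. s 1 v < N v"
  shows "\<exists>t s'. exec (loops vs P) s t s' \<and> t \<le> loops_time \<tau> (map (N \<circ> fst) vs) \<and> Inv s' \<and>
    (\<forall>v. v \<notin> fst ` set vs \<longrightarrow> s' 1 v = s 1 v) \<and> rel s s' \<and>
    (\<forall>e. (\<forall>v. v \<notin> fst ` set vs \<longrightarrow> e v = s 1 v) \<longrightarrow> (\<forall>v\<in>fst ` set vs. e v < N v) \<longrightarrow> eff e s')"
  using bnd assms(7-9)
proof (induction vs arbitrary: s)
  case Nil
  then obtain t s' where s': "exec P s t s'" "t \<le> \<tau>" "Inv s'" "s' 1 = s 1" "rel s s'" "eff (s 1) s'"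
    using body by (metis Diff_empty image_empty list.set(1))
  have "e = s 1" if "\<forall>v. e v = s 1 v" for e :: "nat \<Rightarrow> nat" using that by auto
  then show ?case using s' by (intro exI[of _ t] exI[of _ s']) auto
next
  case (Cons x vs)
  obtain v bn where x: "x = (v, bn)" by (cases x)
  let ?F = "fst ` set vs"
  let ?\<tau> = "loops_time \<tau> (map (N \<circ> fst) vs)"
  have v: "v \<notin> ?F" "distinct (map fst vs)" using Cons.prems(2) x by auto
  have b: "\<forall>(v, e)\<in>set vs. acost e \<le> 2 \<and> (\<forall>s. Inv s \<longrightarrow> aval e s = N v)"
    using Cons.prems(1) by simp
  \<comment> \<open>Invariant of the outermost loop: the body has taken effect for all values of its
    variable below \<open>i\<close>, combined with all values of the inner variables.\<close>
  define A where "A = (\<lambda>i s'. Inv s' \<and> (\<forall>u. u \<notin> insert v ?F \<longrightarrow> s' 1 u = s 1 u) \<and> rel s s' \<and>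
    (\<forall>e. (\<forall>u. u \<notin> insert v ?F \<longrightarrow> e u = s 1 u) \<longrightarrow> e v < i \<longrightarrow> (\<forall>u\<in>?F. e u < N u) \<longrightarrow> eff e s'))"
  have "runs (loops vs P) ?\<tau> (\<lambda>s. A i s \<and> s 1 v = i) (\<lambda>s. A (Suc i) s \<and> s 1 v = i)" if "i < N v" for i
    unfolding runs_def
  proof (intro allI impI)
    fix s1 assume s1: "A i s1 \<and> s1 1 v = i"
    have inv: "Inv s1" using s1 by (simp add: A_def)
    have range: "\<forall>u\<in>V - ?F. s1 1 u < N u"
    proof
      fix u assume "u \<in> V - ?F"
      then show "s1 1 u < N u"
        using s1 \<open>i < N v\<close> Cons.prems(4) x by (cases "u = v") (auto simp: A_def)
    qed
    obtain t s2 where s2: "exec (loops vs P) s1 t s2" "t \<le> ?\<tau>" "Inv s2"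
        "\<forall>u. u \<notin> ?F \<longrightarrow> s2 1 u = s1 1 u" "rel s1 s2"
        "\<forall>e. (\<forall>u. u \<notin> ?F \<longrightarrow> e u = s1 1 u) \<longrightarrow> (\<forall>u\<in>?F. e u < N u) \<longrightarrow> eff e s2"
      using Cons.IH[OF b v(2) inv range] by blast
    have "eff e s2" if e: "\<forall>u. u \<notin> insert v ?F \<longrightarrow> e u = s 1 u" "e v < Suc i" "\<forall>u\<in>?F. e u < N u" for e
    proof (cases "e v = i")
      case True
      have "e u = s1 1 u" if "u \<notin> ?F" for u
        using e(1) s1 True that by (cases "u = v") (auto simp: A_def)
      then show ?thesis using s2(6) e(3) by blast
    next
      case False
      then have "e v < i" using e(2) by simp
      then show ?thesis using s1 e eff[OF _ s2(5)] by (auto simp: A_def)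
    qed
    moreover have "rel s s2" using trans s1 s2(5) by (auto simp: A_def)
    ultimately have "A (Suc i) s2 \<and> s2 1 v = i" using s1 s2(3,4) v unfolding A_def by auto
    then show "\<exists>t s'. exec (loops vs P) s1 t s' \<and> t \<le> ?\<tau> \<and> A (Suc i) s' \<and> s' 1 v = i"
      using s2(1,2) by blast
  qed
  then have "runs (For v bn (loops vs P)) (N v * (?\<tau> + acost bn + 10) + acost bn + 7) (A 0) (A (N v))"
  proof (rule runs_For)
    show "A i (s'(1 := (s' 1)(v := x)))" if "A i s'" for i s' x
      using that Inv trans[OF _ rel] eff[OF _ rel] unfolding A_def by auto
    show "aval bn s' = N v" if "A i s'" for i s'
      using that Cons.prems(1) x by (auto simp: A_def)
  qed
  moreover have "rel s s" using rel[of s "s 1"] by simp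
  then have "A 0 s" using Cons.prems(3) by (auto simp: A_def)
  ultimately obtain t s' where s': "exec (For v bn (loops vs P)) s t s'"
      "t \<le> N v * (?\<tau> + acost bn + 10) + acost bn + 7" "A (N v) s'"
    unfolding runs_def by blast
  have bn2: "acost bn \<le> 2" using Cons.prems(1) x by simp
  have "N v * (?\<tau> + acost bn + 10) \<le> N v * (?\<tau> + 12)" using bn2 by (intro mult_le_mono2) simp
  then have "t \<le> N v * (?\<tau> + 12) + 9" using s'(2) bn2 by linarith
  then show ?case using s'(1,3) x by (intro exI[of _ t] exI[of _ s']) (auto simp: A_def comp_def)
qed


section \<open>The table of spine costs\<close>

definition pr :: "nat \<Rightarrow> nat \<Rightarrow> nat \<Rightarrow> nat" where
  "pr u v = (\<lambda>i. if i = 1 then u else v)"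

lemma pr_simps [simp]: "pr u v 1 = u" "pr u v (Suc 0) = u" "pr u v 2 = v"
  by (simp_all add: pr_def)

definition bits :: "nat \<Rightarrow> nat set" where
  "bits m = {c. bit m c}"

text \<open>The amount by which the code of a set grows when \<open>c\<close> is inserted. It
  replaces bit operations: adding it inserts \<open>c\<close>, and it is positive exactly if
  \<open>c\<close> is not in the set.\<close>

definition missing :: "nat \<Rightarrow> nat \<Rightarrow> nat" where
  "missing m c = (if bit m c then 0 else 2 ^ c)"

lemma add_missing: "m + missing m c = set_bit c m"
  by (simp add: missing_def set_bit_eq)

lemma bits_add_missing: "bits (m + missing m c) = insert c (bits m)"
  by (auto simp: bits_def add_missing bit_set_bit_iff)

lemma add_missing_less: "m < 2 ^ k \<Longrightarrow> c < k \<Longrightarrow> m + missing m c < 2 ^ k"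
  unfolding add_missing by (simp add: take_bit_set_bit_eq flip: take_bit_nat_eq_self_iff)

lemma bits_0 [simp]: "bits 0 = {}"
  by (simp add: bits_def)

text \<open>The rows for \<open>2 * m\<close> and \<open>Suc (2 * m)\<close> result from the row for
  \<open>m\<close> by doubling, so additions suffice to fill the table.\<close>

lemma missing_even: "missing (2 * m) 0 = 1" "missing (2 * m) (Suc c) = 2 * missing m c"
  and missing_odd: "missing (Suc (2 * m)) 0 = 0" "missing (Suc (2 * m)) (Suc c) = 2 * missing m c"
  by (simp_all add: missing_def bit_0 bit_Suc)

text \<open>Horner form of a number with seven digits to the base \<open>B\<close>; the code of the
  colour set is put in front and may exceed \<open>B\<close>.\<close>

definition ix :: "nat \<Rightarrow> nat \<Rightarrow> nat \<Rightarrow> nat \<Rightarrow> nat \<Rightarrow> nat \<Rightarrow> nat \<Rightarrow> nat \<Rightarrow> nat \<Rightarrow> nat" where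
  "ix B l1 l2 r1 r2 a b c m = l1 + B * (l2 + B * (r1 + B * (r2 + B * (a + B * (b + B * (c + B * m))))))"

lemma digit_less: "x < B \<Longrightarrow> y < M \<Longrightarrow> x + B * y < B * (M::nat)"
proof -
  assume "x < B" "y < M"
  then have "B * Suc y \<le> B * M" by (intro mult_le_mono2) simp
  with \<open>x < B\<close> show ?thesis by simp
qed

lemma digit_inj: "x < B \<Longrightarrow> x' < B \<Longrightarrow> x + B * y = x' + B * y' \<longleftrightarrow> x = x' \<and> y = (y'::nat)"
proof -
  assume "x < B" "x' < B"
  then have "(x + B * y) mod B = x" "(x + B * y) div B = y" "(x' + B * y') mod B = x'" "(x' + B * y') div B = y'"
    by simp_all
  then show ?thesis by metis
qed

lemma ix_inj:
  assumes "l1 < B" "l2 < B" "r1 < B" "r2 < B" "a < B" "b < B" "c < B"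
    "l1' < B" "l2' < B" "r1' < B" "r2' < B" "a' < B" "b' < B" "c' < B"
  shows "ix B l1 l2 r1 r2 a b c m = ix B l1' l2' r1' r2' a' b' c' m' \<longleftrightarrow>
    l1 = l1' \<and> l2 = l2' \<and> r1 = r1' \<and> r2 = r2' \<and> a = a' \<and> b = b' \<and> c = c' \<and> m = m'"
  unfolding ix_def using assms by (simp only: digit_inj)

text \<open>The same scheme as an expression, each multiplication by \<open>B\<close> being a lookup
  in bank 5.\<close>

definition ixe :: "aexp \<Rightarrow> aexp \<Rightarrow> aexp \<Rightarrow> aexp \<Rightarrow> aexp \<Rightarrow> aexp \<Rightarrow> aexp \<Rightarrow> aexp \<Rightarrow> aexp" where
  "ixe l1 l2 r1 r2 a b c m = Add l1 (Cell 5 (Add l2 (Cell 5 (Add r1 (Cell 5 (Add r2 (Cell 5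
     (Add a (Cell 5 (Add b (Cell 5 (Add c (Cell 5 m)))))))))))))"

text \<open>Every number to be multiplied is below \<open>B ^ 7 * 2 ^ k\<close>, hence inside the
  table of multiples.\<close>

lemma aval_ixe:
  assumes tab: "\<forall>u<B ^ 7 * 2 ^ k. s 5 u = B * u"
    and B: "aval l2 s < B" "aval r1 s < B" "aval r2 s < B" "aval a s < B" "aval b s < B"
      "aval c s < B" "aval m s < 2 ^ k"
  shows "aval (ixe l1 l2 r1 r2 a b c m) s =
    ix B (aval l1 s) (aval l2 s) (aval r1 s) (aval r2 s) (aval a s) (aval b s) (aval c s) (aval m s)"
proof -
  define x1 where "x1 = aval c s + B * aval m s"
  define x2 where "x2 = aval b s + B * x1"
  define x3 where "x3 = aval a s + B * x2"
  define x4 where "x4 = aval r2 s + B * x3"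
  define x5 where "x5 = aval r1 s + B * x4"
  define x6 where "x6 = aval l2 s + B * x5"
  have 1: "x1 < B * 2 ^ k" unfolding x1_def by (intro digit_less B)
  have 2: "x2 < B * (B * 2 ^ k)" unfolding x2_def by (intro digit_less B 1)
  have 3: "x3 < B * (B * (B * 2 ^ k))" unfolding x3_def by (intro digit_less B 2)
  have 4: "x4 < B * (B * (B * (B * 2 ^ k)))" unfolding x4_def by (intro digit_less B 3)
  have 5: "x5 < B * (B * (B * (B * (B * 2 ^ k))))" unfolding x5_def by (intro digit_less B 4)
  have 6: "x6 < B * (B * (B * (B * (B * (B * 2 ^ k)))))" unfolding x6_def by (intro digit_less B 5)
  have B1: "1 \<le> B" using B by linarith
  have up: "s 5 x = B * x" if "x < B ^ i * 2 ^ k" "i \<le> 7" for x i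
  proof -
    have "B ^ i * 2 ^ k \<le> B ^ 7 * 2 ^ k" using that(2) B1 by (intro mult_le_mono1 power_increasing)
    then show ?thesis using tab order_less_le_trans[OF that(1)] by blast
  qed
  have "s 5 (aval m s) = B * aval m s" "s 5 x1 = B * x1" "s 5 x2 = B * x2" "s 5 x3 = B * x3"
    "s 5 x4 = B * x4" "s 5 x5 = B * x5" "s 5 x6 = B * x6"
    using up[of "aval m s" 0] up[of x1 1] up[of x2 2] up[of x3 3] up[of x4 4] up[of x5 5] up[of x6 6]
      1 2 3 4 5 6 B by (simp_all add: eval_nat_numeral mult.assoc)
  then show ?thesis
    unfolding ixe_def ix_def aval.simps
    by (simp add: x1_def[symmetric] x2_def[symmetric] x3_def[symmetric] x4_def[symmetric]
        x5_def[symmetric] x6_def[symmetric])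
qed

text \<open>Registers: bank 1 holds the loop variables, in cells 1 to 13 the code of the colour set, the
  colours \<open>c\<close> and \<open>e\<close>, the rows \<open>a, b, x, y\<close> and the pairs \<open>L, R, p\<close> of an instance of a rule for
  \<^const>\<open>spine_cost\<close>. Bank 2 holds constants, bank 3 the board with renamed colours, bank 4 the new
  name of a colour plus one, bank 5 multiples of the base of the mixed radix representation,
  bank 6 the table of \<^const>\<open>missing\<close>, bank 8 temporary values. Bank 7 is the table of the costs found
  so far; it contains the cost plus one, and 0 for infinity.\<close>

abbreviation var :: "nat \<Rightarrow> aexp" where "var i \<equiv> Cell 1 (Num i)"
abbreviation tmp :: "nat \<Rightarrow> aexp" where "tmp i \<equiv> Cell 8 (Num i)"

definition eqe :: "aexp \<Rightarrow> aexp \<Rightarrow> bexp" where "eqe u v = And (Not (Less u v)) (Not (Less v u))"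
definition mine :: "aexp \<Rightarrow> aexp \<Rightarrow> aexp" where "mine u v = Sub u (Sub u v)"
definition maxe :: "aexp \<Rightarrow> aexp \<Rightarrow> aexp" where "maxe u v = Add u (Sub v u)"

lemma bval_eqe [simp]: "bval (eqe u v) s \<longleftrightarrow> aval u s = aval v s"
  by (auto simp: eqe_def)

lemma aval_mine [simp]: "aval (mine u v) s = min (aval u s) (aval v s)"
  by (auto simp: mine_def)

lemma aval_maxe [simp]: "aval (maxe u v) s = max (aval u s) (aval v s)"
  by (auto simp: maxe_def)

text \<open>Cell 0 of bank 8 holds the address of the entry under consideration. As an entry 0 means
  infinity, being small is not enough for an entry to be kept.\<close>

definition upd :: "aexp \<Rightarrow> com" where
  "upd e = Seq (Store 8 (Num 1) e)
     (If (And (Less (Num 0) (Cell 7 (tmp 0))) (Not (Less (tmp 1) (Cell 7 (tmp 0))))) Skip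
       (Store 7 (tmp 0) (tmp 1)))"

definition rowL :: "aexp \<Rightarrow> aexp" where "rowL a = Cell 1 (Add (Num 7) a)"
definition rowR :: "aexp \<Rightarrow> aexp" where "rowR a = Cell 1 (Add (Num 9) a)"
definition rowP :: "aexp \<Rightarrow> aexp" where "rowP a = Cell 1 (Add (Num 11) a)"
text \<open>Cells 1 and 2 of bank 2 contain 1 and \<open>n + 1\<close>, the offsets of the rows. The
  addresses obtained are those of the squares in the input.\<close>

definition square :: "aexp \<Rightarrow> aexp \<Rightarrow> aexp" where "square a j = Cell 3 (Add (Cell 2 a) j)"

definition key :: aexp where
  "key = ixe (var 8) (var 9) (var 10) (var 11) (var 4) (var 5) (var 2) (var 1)"

definition base_cond :: bexp where
  "base_cond = (let a = var 4; a' = Sub (Num 3) a; j = rowL a in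
     And (eqe a (var 5)) (And (Less (Num 0) a) (And (eqe j (rowR a)) (And (Less (Num 0) j)
       (And (Not (Less (Cell 2 (Num 7)) j)) (And (Not (Less (rowL a') j))
       (And (Not (Less (rowR a) (rowR a'))) (eqe (square a j) (var 2)))))))))"

definition other_cond :: bexp where
  "other_cond = (let a = var 4; a' = Sub (Num 3) a; j = rowL a in
     And (Not (Less (rowR a') (rowL a'))) (And (Not (eqe (square a' j) (var 2)))
       (Less (Num 0) (Cell 6 (Add (square a' j) (Cell 5 (var 1)))))))"

text \<open>As entries are costs plus one, 2 and 1 stand for the costs 1 and 0.\<close>

definition base_prog :: com where
  "base_prog = If base_cond (If other_cond (upd (Num 2)) (upd (Num 1))) Skip"

definition split_cond :: bexp where
  "split_cond = And (And (Less (Num 0) (var 6)) (Less (Num 0) (var 7))) (And (And (Less (Num 0) (tmp 2))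
     (Less (Num 0) (tmp 3))) (And (Not (Less (Cell 2 (Num 7)) (var 12))) (Not (Less (Cell 2 (Num 7)) (var 13)))))"

text \<open>Both stored summands contain an additional unit, of which one is subtracted. A stored 0
  has to be excluded, since it means that no cost is known.\<close>

definition split_prog :: com where
  "split_prog = (let x = var 6; y = var 7; u = mine (rowP x) (rowR x);
       upd12 = upd (Sub (Add (tmp 2) (tmp 3)) (Num 1)) in
     Seq (Store 8 (Num 2) (Cell 7 (ixe (var 8) (var 9) (mine (var 12) (var 10)) (mine (var 13) (var 11))
       (var 4) x (var 2) (var 1))))
     (Seq (Store 8 (Num 3) (Cell 7 (ixe (maxe (var 8) (Add (var 12) (Num 1)))
       (maxe (var 9) (Add (var 13) (Num 1))) (var 10) (var 11) y (var 5) (var 2) (var 1))))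
     (If split_cond
       (If (eqe x y)
         (If (eqe (maxe (rowL x) (Add (rowP x) (Num 1))) (Add u (Num 1))) upd12 Skip)
         (If (Not (Less u (maxe (rowL y) (Add (rowP y) (Num 1))))) upd12 Skip))
       Skip)))"

definition step_prog :: com where
  "step_prog = Seq (Store 8 (Num 4) (Cell 7 (ixe (var 8) (var 9) (var 10) (var 11) (var 4) (var 5) (var 3)
       (Add (var 1) (Cell 6 (Add (var 2) (Cell 5 (var 1))))))))
     (If (Less (Num 0) (tmp 4)) (upd (Add (tmp 4) (Num 1))) Skip)"

definition relax_prog :: com where
  "relax_prog = Seq (Store 8 (Num 0) key) (Seq base_prog (Seq split_prog step_prog))"

definition ok :: "(nat \<Rightarrow> nat) \<Rightarrow> nat \<Rightarrow> nat \<Rightarrow> bool" where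
  "ok T i q \<longleftrightarrow> 0 < T i \<and> T i \<le> Suc q"

definition improves :: "(nat \<Rightarrow> nat) \<Rightarrow> (nat \<Rightarrow> nat) \<Rightarrow> bool" where
  "improves T T' \<longleftrightarrow> (\<forall>i. 0 < T i \<longrightarrow> 0 < T' i \<and> T' i \<le> T i)"

definition relax :: "(nat \<Rightarrow> nat) \<Rightarrow> nat \<Rightarrow> nat \<Rightarrow> nat \<Rightarrow> nat" where
  "relax T i v = (if 0 < T i \<and> T i \<le> v then T else T(i := v))"

lemma improves_refl [simp]: "improves T T"
  by (simp add: improves_def)

lemma improves_trans: "improves T T' \<Longrightarrow> improves T' T'' \<Longrightarrow> improves T T''"
  unfolding improves_def by (meson order_trans)

lemma ok_improves: "ok T i q \<Longrightarrow> improves T T' \<Longrightarrow> ok T' i q"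
  unfolding improves_def ok_def by (meson order_trans)

lemma improves_relax: "0 < v \<Longrightarrow> improves T (relax T i v)"
  by (auto simp: improves_def relax_def)

lemma ok_relax: "0 < v \<Longrightarrow> v \<le> Suc q \<Longrightarrow> ok (relax T i v) i q"
  by (auto simp: ok_def relax_def)

lemma result_upd:
  "result (upd e) s 7 = relax (s 7) (s 8 0) (aval e s)" "result (upd e) s 8 0 = s 8 0"
  "b \<noteq> 7 \<Longrightarrow> b \<noteq> 8 \<Longrightarrow> result (upd e) s b = s b"
  by (auto simp: upd_def relax_def)

section \<open>Invariants of the table\<close>

locale flood_table =
  fixes n k :: nat and w :: "nat \<times> nat \<Rightarrow> nat"
  assumes n: "1 \<le> n" and k: "1 \<le> k" "k \<le> 2 * n"
    and w: "\<And>v. v \<in> board n \<Longrightarrow> w v < k"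
begin

text \<open>The base has to exceed all colours below \<open>k \<le> 2 * n\<close> and all borders
  below \<open>N\<close>, but also \<open>Suc (p i)\<close> for \<open>p i < N\<close>; therefore
  \<open>B = N + 1\<close>.\<close>

abbreviation "B \<equiv> 2 * n + 3"
abbreviation "N \<equiv> 2 * n + 2"
abbreviation "idx \<equiv> ix B"
abbreviation "cost \<equiv> spine_cost n {..<k} w"

definition static :: "state \<Rightarrow> bool" where
  "static s \<longleftrightarrow> s 2 1 = 1 \<and> s 2 2 = n + 1 \<and> s 2 3 = N \<and> s 2 4 = B \<and> s 2 5 = k \<and> s 2 6 = 2 ^ k \<and>
     s 2 7 = n \<and> (\<forall>a j. (a, j) \<in> board n \<longrightarrow> s 3 (s 2 a + j) = w (a, j)) \<and>
     (\<forall>u<B ^ 7 * 2 ^ k. s 5 u = B * u) \<and> (\<forall>m<2 ^ k. \<forall>c<B. s 6 (c + B * m) = missing m c)"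

lemma static_cong: "static s \<Longrightarrow> (\<And>b. b \<in> {2, 3, 5, 6} \<Longrightarrow> s' b = s b) \<Longrightarrow> static s'"
  by (simp add: static_def)

definition sound :: "(nat \<Rightarrow> nat) \<Rightarrow> bool" where
  "sound T \<longleftrightarrow> (\<forall>l1 l2 r1 r2 a b c m. l1 < B \<longrightarrow> l2 < B \<longrightarrow> r1 < B \<longrightarrow> r2 < B \<longrightarrow> a < B \<longrightarrow> b < B \<longrightarrow>
     c < B \<longrightarrow> m < 2 ^ k \<longrightarrow> 0 < T (idx l1 l2 r1 r2 a b c m) \<longrightarrow>
     (\<exists>h. cost h (pr l1 l2) (pr r1 r2) a b c (bits m) (T (idx l1 l2 r1 r2 a b c m) - 1)))"

text \<open>The ranges are those of the loop variables. Soundness is stated for all digits instead,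
  because the program also reads entries with a border \<open>Suc (p i)\<close> outside these
  ranges.\<close>

definition complete :: "nat \<Rightarrow> (nat \<Rightarrow> nat) \<Rightarrow> bool" where
  "complete h T \<longleftrightarrow> (\<forall>l1 l2 r1 r2 a b c m q. l1 < N \<longrightarrow> l2 < N \<longrightarrow> r1 < N \<longrightarrow> r2 < N \<longrightarrow> a < 3 \<longrightarrow>
     b < 3 \<longrightarrow> c < k \<longrightarrow> m < 2 ^ k \<longrightarrow> cost h (pr l1 l2) (pr r1 r2) a b c (bits m) q \<longrightarrow>
     ok T (idx l1 l2 r1 r2 a b c m) q)"

lemma soundD:
  "\<lbrakk>sound T; 0 < T (idx l1 l2 r1 r2 a b c m); l1 < B; l2 < B; r1 < B; r2 < B; a < B; b < B; c < B;
    m < 2 ^ k\<rbrakk> \<Longrightarrow> \<exists>h. cost h (pr l1 l2) (pr r1 r2) a b c (bits m) (T (idx l1 l2 r1 r2 a b c m) - 1)"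
  by (simp add: sound_def)

lemma completeD:
  "\<lbrakk>complete h T; cost h (pr l1 l2) (pr r1 r2) a b c (bits m) q; l1 < N; l2 < N; r1 < N; r2 < N;
    a < 3; b < 3; c < k; m < 2 ^ k\<rbrakk> \<Longrightarrow> ok T (idx l1 l2 r1 r2 a b c m) q"
  by (simp add: complete_def)

definition in_range :: "(nat \<Rightarrow> nat) \<Rightarrow> bool" where
  "in_range e \<longleftrightarrow> e 1 < 2 ^ k \<and> e 2 < k \<and> e 3 < k \<and> e 4 < 3 \<and> e 5 < 3 \<and> e 6 < 3 \<and> e 7 < 3 \<and>
     e 8 < N \<and> e 9 < N \<and> e 10 < N \<and> e 11 < N \<and> e 12 < N \<and> e 13 < N"

definition the_key :: "(nat \<Rightarrow> nat) \<Rightarrow> nat" where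
  "the_key e = idx (e 8) (e 9) (e 10) (e 11) (e 4) (e 5) (e 2) (e 1)"

definition the_cost :: "(nat \<Rightarrow> nat) \<Rightarrow> nat \<Rightarrow> nat \<Rightarrow> bool" where
  "the_cost e h q \<longleftrightarrow> cost h (pr (e 8) (e 9)) (pr (e 10) (e 11)) (e 4) (e 5) (e 2) (bits (e 1)) q"

definition base_rule :: "(nat \<Rightarrow> nat) \<Rightarrow> nat \<Rightarrow> bool" where
  "base_rule e q \<longleftrightarrow> (let a = e 4; L = pr (e 8) (e 9); R = pr (e 10) (e 11) in
     a = e 5 \<and> 0 < a \<and> L a = R a \<and> 0 < L a \<and> L a \<le> n \<and> L a \<le> L (3 - a) \<and> R (3 - a) \<le> R a \<and>
     w (a, L a) = e 2 \<and> (L (3 - a) \<le> R (3 - a) \<and> w (3 - a, L a) \<notin> insert (e 2) (bits (e 1)) \<longrightarrow> 1 \<le> q))"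

definition pre :: "state \<Rightarrow> bool" where
  "pre s \<longleftrightarrow> static s \<and> sound (s 7) \<and> in_range (s 1) \<and> s 8 0 = the_key (s 1)"

definition post :: "state \<Rightarrow> state \<Rightarrow> bool" where
  "post s s' \<longleftrightarrow> (\<forall>b. b \<noteq> 7 \<longrightarrow> b \<noteq> 8 \<longrightarrow> s' b = s b) \<and> s' 8 0 = s 8 0 \<and> sound (s' 7) \<and>
     improves (s 7) (s' 7)"

lemma pre_post:
  assumes "pre s" "post s s'"
  shows "pre s'"
proof -
  have "static s'" by (rule static_cong[of s]) (use assms in \<open>auto simp: pre_def post_def\<close>)
  then show ?thesis using assms by (simp add: pre_def post_def)
qed

lemma post_trans: "post s s' \<Longrightarrow> post s' s'' \<Longrightarrow> post s s''"
  unfolding post_def using improves_trans by metis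

lemma post_refl: "pre s \<Longrightarrow> post s s"
  by (simp add: post_def pre_def)

lemma post_tmp: "pre s \<Longrightarrow> i \<noteq> 0 \<Longrightarrow> post s (s(8 := (s 8)(i := x)))"
  by (simp add: post_def pre_def)

lemma sound_relax:
  assumes "sound T" "in_range e" "\<exists>h. the_cost e h (v - 1)"
  shows "sound (relax T (the_key e) v)"
proof -
  have r: "e 8 < B" "e 9 < B" "e 10 < B" "e 11 < B" "e 4 < B" "e 5 < B" "e 2 < B"
    using assms(2) k n by (auto simp: in_range_def)
  show ?thesis
    using assms(1,3) unfolding sound_def relax_def the_key_def the_cost_def
    by (auto simp: ix_inj r)
qed

lemma post_upd:
  assumes "pre s" "\<exists>h. the_cost (s 1) h (aval e s - 1)" "0 < aval e s"
  shows "post s (result (upd e) s)"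
    "aval e s \<le> Suc q \<Longrightarrow> ok (result (upd e) s 7) (the_key (s 1)) q"
  using assms sound_relax[of "s 7" "s 1"]
  by (auto simp: post_def pre_def result_upd improves_relax ok_relax)


section \<open>Soundness and effect of a single relaxation\<close>

lemma result_base:
  assumes pre: "pre s"
  shows "post s (result base_prog s)"
    "base_rule (s 1) q \<Longrightarrow> ok (result base_prog s 7) (the_key (s 1)) q"
proof -
  define a where "a = s 1 4"
  define L where "L = pr (s 1 8) (s 1 9)"
  define R where "R = pr (s 1 10) (s 1 11)"
  define b where "b = (a = s 1 5 \<and> 0 < a \<and> L a = R a \<and> 0 < L a \<and> L a \<le> n \<and> L a \<le> L (3 - a) \<and>
    R (3 - a) \<le> R a \<and> w (a, L a) = s 1 2)"
  define d where "d = (L (3 - a) \<le> R (3 - a) \<and> w (3 - a, L a) \<notin> insert (s 1 2) (bits (s 1 1)))"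
  have st: "static s" and r: "in_range (s 1)" using pre by (auto simp: pre_def)
  have a3: "a < 3" using r by (simp add: a_def in_range_def)
  have a12: "a = 1 \<or> a = 2" if "0 < a" using a3 that by auto
  have sq: "s 3 (s 2 i + j) = w (i, j)" if "i = 1 \<or> i = 2" "0 < j" "j \<le> n" for i j
    using st that unfolding static_def by (simp add: board_iff)
  have n7: "s 2 7 = n" using st by (simp add: static_def)
  have mis: "0 < s 6 (w v + s 5 (s 1 1)) \<longleftrightarrow> w v \<notin> bits (s 1 1)" if "v \<in> board n" for v
  proof -
    have "w v < B" using w[OF that] k by simp
    moreover have "1 * 2 ^ k \<le> B ^ 7 * 2 ^ k" by (intro mult_le_mono1) simp
    then have "s 5 (s 1 1) = B * s 1 1"
      using st r unfolding static_def in_range_def by (metis mult_1 order_less_le_trans)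
    ultimately have "s 6 (w v + s 5 (s 1 1)) = missing (s 1 1) (w v)"
      using st r unfolding static_def in_range_def by simp
    then show ?thesis by (simp add: missing_def bits_def)
  qed
  have rows: "s 1 (7 + a) = L a" "s 1 (9 + a) = R a" "s 1 (7 + (3 - a)) = L (3 - a)"
      "s 1 (9 + (3 - a)) = R (3 - a)" if "0 < a"
    using a12[OF that] by (auto simp: L_def R_def)
  have bc: "bval base_cond s \<longleftrightarrow> b"
  \<comment> \<open>All conjuncts are evaluated, but the cell read in bank 3 is known to be a square
    of the board only for coordinates on the board. Otherwise another conjunct fails.\<close>
  proof (cases "0 < a \<and> 0 < L a \<and> L a \<le> n")
    case True
    then have "s 3 (s 2 a + L a) = w (a, L a)" using sq a12 by blast
    then show ?thesis
      using True rows n7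
      by (simp add: base_cond_def Let_def rowL_def rowR_def square_def a_def[symmetric] b_def not_less
          del: One_nat_def)
  next
    case False
    then show ?thesis
      using rows n7
      by (auto simp add: base_cond_def Let_def rowL_def rowR_def a_def[symmetric] b_def not_less
          simp del: One_nat_def)
  qed
  have oc: "bval other_cond s \<longleftrightarrow> d" if b
  proof -
    have j: "0 < a" "0 < L a" "L a \<le> n" using that by (auto simp: b_def)
    have "3 - a = 1 \<or> 3 - a = 2" using a12[OF j(1)] by auto
    then have "s 3 (s 2 (3 - a) + L a) = w (3 - a, L a)" and
      "0 < s 6 (w (3 - a, L a) + s 5 (s 1 1)) \<longleftrightarrow> w (3 - a, L a) \<notin> bits (s 1 1)"
      using sq mis j by (auto simp: board_iff)
    then show ?thesis
      using j rows
      by (simp add: other_cond_def Let_def rowL_def rowR_def square_def a_def[symmetric] d_def not_less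
          del: One_nat_def)
  qed
  have res: "result base_prog s = (if b then result (upd (Num (if d then 2 else 1))) s else s)"
    using bc oc by (simp add: base_prog_def)
  have cost: "\<exists>h. the_cost (s 1) h (if d then 1 else 0)" if b
  proof -
    have "cost (Suc 0) L R a a (s 1 2) (bits (s 1 1)) (if d then 1 else 0)"
      by (rule spine_cost.base) (use that a12 in \<open>auto simp: b_def d_def\<close>)
    then show ?thesis using that unfolding the_cost_def L_def R_def a_def b_def by metis
  qed
  show "post s (result base_prog s)"
    using res post_refl[OF pre] post_upd(1)[OF pre, of "Num (if d then 2 else 1)"] cost
    by (auto split: if_splits)
  show "ok (result base_prog s 7) (the_key (s 1)) q" if "base_rule (s 1) q"
  proof -
    have b "d \<longrightarrow> 1 \<le> q"
      using that unfolding base_rule_def b_def d_def Let_def a_def L_def R_def by blast+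
    then show ?thesis
      using res post_upd(2)[OF pre, of "Num (if d then 2 else 1)"] cost by (auto split: if_splits)
  qed
qed

definition split_rule :: "(nat \<Rightarrow> nat) \<Rightarrow> bool" where
  "split_rule e \<longleftrightarrow> (let x = e 6; y = e 7; L = pr (e 8) (e 9); R = pr (e 10) (e 11); p = pr (e 12) (e 13) in
     0 < x \<and> 0 < y \<and> p 1 \<le> n \<and> p 2 \<le> n \<and>
     (if x = y then max (L x) (Suc (p x)) = Suc (min (p x) (R x))
      else max (L y) (Suc (p y)) \<le> min (p x) (R x)))"

definition left_key :: "(nat \<Rightarrow> nat) \<Rightarrow> nat" where
  "left_key e = idx (e 8) (e 9) (min (e 12) (e 10)) (min (e 13) (e 11)) (e 4) (e 6) (e 2) (e 1)"

definition right_key :: "(nat \<Rightarrow> nat) \<Rightarrow> nat" where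
  "right_key e = idx (max (e 8) (Suc (e 12))) (max (e 9) (Suc (e 13))) (e 10) (e 11) (e 7) (e 5) (e 2) (e 1)"

definition step_key :: "(nat \<Rightarrow> nat) \<Rightarrow> nat" where
  "step_key e = idx (e 8) (e 9) (e 10) (e 11) (e 4) (e 5) (e 3) (e 1 + missing (e 1) (e 2))"

lemma static_ixe:
  assumes "static s" "aval l2 s < B" "aval r1 s < B" "aval r2 s < B" "aval a s < B" "aval b s < B"
      "aval c s < B" "aval m s < 2 ^ k"
  shows "aval (ixe l1 l2 r1 r2 a b c m) s =
    idx (aval l1 s) (aval l2 s) (aval r1 s) (aval r2 s) (aval a s) (aval b s) (aval c s) (aval m s)"
  by (rule aval_ixe[where k = k]) (use assms in \<open>auto simp: static_def\<close>)

lemma in_range_less: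
  assumes "in_range e"
  shows "e 1 < 2 ^ k" "e 2 < B" "e 3 < B" "e 4 < B" "e 5 < B" "e 6 < B" "e 7 < B" "e 8 < B" "e 9 < B"
    "e 10 < B" "e 11 < B" "e 12 < N" "e 13 < N"
  using assms k n unfolding in_range_def by auto

lemma max_min_pr: "(\<lambda>i. min (pr p1 p2 i) (pr r1 r2 i)) = pr (min p1 r1) (min p2 r2)"
  "(\<lambda>i. max (pr l1 l2 i) (Suc (pr p1 p2 i))) = pr (max l1 (Suc p1)) (max l2 (Suc p2))"
  by (auto simp: pr_def)

lemma result_split:
  assumes pre: "pre s"
  shows "post s (result split_prog s)"
    "split_rule (s 1) \<Longrightarrow> ok (s 7) (left_key (s 1)) q1 \<Longrightarrow> ok (s 7) (right_key (s 1)) q2 \<Longrightarrow>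
      ok (result split_prog s 7) (the_key (s 1)) (q1 + q2)"
proof -
  define e where "e = s 1"
  have st: "static s" and r: "in_range e" and snd: "sound (s 7)" using pre by (auto simp: pre_def e_def)
  note l = in_range_less[OF r]
  define t1 where "t1 = s 7 (left_key e)"
  define t2 where "t2 = s 7 (right_key e)"
  define s2 where "s2 = s(8 := (s 8)(2 := t1))"
  define s3 where "s3 = s(8 := (s 8)(2 := t1, 3 := t2))"
  have "aval (ixe (var 8) (var 9) (mine (var 12) (var 10)) (mine (var 13) (var 11))
       (var 4) (var 6) (var 2) (var 1)) s = left_key e"
    using l unfolding left_key_def e_def by (subst static_ixe[OF st]) auto
  then have 2: "result (Store 8 (Num 2) (Cell 7 (ixe (var 8) (var 9) (mine (var 12) (var 10)) (mine (var 13) (var 11))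
       (var 4) (var 6) (var 2) (var 1)))) s = s2"
    by (simp add: s2_def t1_def)
  have pre2: "post s s2" unfolding s2_def by (rule post_tmp[OF pre]) simp
  have st2: "static s2" using pre_post[OF pre pre2] by (simp add: pre_def)
  have "aval (ixe (maxe (var 8) (Add (var 12) (Num 1)))
       (maxe (var 9) (Add (var 13) (Num 1))) (var 10) (var 11) (var 7) (var 5) (var 2) (var 1)) s2 = right_key e"
    using l unfolding right_key_def e_def by (subst static_ixe[OF st2]) (auto simp: s2_def)
  then have 3: "result (Store 8 (Num 3) (Cell 7 (ixe (maxe (var 8) (Add (var 12) (Num 1)))
       (maxe (var 9) (Add (var 13) (Num 1))) (var 10) (var 11) (var 7) (var 5) (var 2) (var 1)))) s2 = s3"
    by (simp add: s2_def s3_def t2_def)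
  have post3: "post s s3"
    using post_trans[OF pre2 post_tmp[OF pre_post[OF pre pre2], of 3 t2]] by (simp add: s2_def s3_def)
  have pre3: "pre s3" by (rule pre_post[OF pre post3])
  have row: "e (7 + i) = pr (e 8) (e 9) i" "e (9 + i) = pr (e 10) (e 11) i" "e (11 + i) = pr (e 12) (e 13) i"
    if "i = 1 \<or> i = 2" for i
    using that by auto
  let ?u = "Sub (Add (tmp 2) (tmp 3)) (Num 1)"
  have "s 2 7 = n" using st by (simp add: static_def)
  then have sc: "bval split_cond s3 \<longleftrightarrow> 0 < e 6 \<and> 0 < e 7 \<and> 0 < t1 \<and> 0 < t2 \<and> e 12 \<le> n \<and> e 13 \<le> n"
    by (auto simp: split_cond_def s3_def e_def not_less)
  have res: "result split_prog s =
    (if split_rule e \<and> 0 < t1 \<and> 0 < t2 then result (upd ?u) s3 else s3)"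
  proof (cases "0 < e 6 \<and> 0 < e 7")
    case True
    then have xy: "e 6 = 1 \<or> e 6 = 2" "e 7 = 1 \<or> e 7 = 2" using r by (auto simp: in_range_def)
    have s31: "s3 1 = e" by (simp add: s3_def e_def)
    let ?x = "var 6" and ?y = "var 7"
    let ?v = "mine (rowP ?x) (rowR ?x)"
    have xy_eq: "bval (eqe ?x ?y) s3 \<longleftrightarrow> e 6 = e 7" by (simp add: s31 del: One_nat_def)
    have c1: "bval (eqe (maxe (rowL ?x) (Add (rowP ?x) (Num 1))) (Add ?v (Num 1))) s3 \<longleftrightarrow>
        max (pr (e 8) (e 9) (e 6)) (Suc (pr (e 12) (e 13) (e 6))) = Suc (min (pr (e 12) (e 13) (e 6)) (pr (e 10) (e 11) (e 6)))"
      by (simp add: rowL_def rowR_def rowP_def s31 row[OF xy(1)] Suc_eq_plus1 del: One_nat_def)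
    have c2: "bval (Not (Less ?v (maxe (rowL ?y) (Add (rowP ?y) (Num 1))))) s3 \<longleftrightarrow>
        max (pr (e 8) (e 9) (e 7)) (Suc (pr (e 12) (e 13) (e 7))) \<le> min (pr (e 12) (e 13) (e 6)) (pr (e 10) (e 11) (e 6))"
      by (simp add: rowL_def rowR_def rowP_def s31 row[OF xy(1)] row[OF xy(2)] Suc_eq_plus1 not_less del: One_nat_def)
    show ?thesis
      unfolding split_prog_def Let_def result.simps(1,3,4) 2 3 sc xy_eq c1 c2
      using True by (simp add: split_rule_def Let_def del: One_nat_def max.bounded_iff min.bounded_iff)
  next
    case False
    then have "\<not> bval split_cond s3" "\<not> split_rule e" using sc by (auto simp: split_rule_def Let_def)
    then show ?thesis unfolding split_prog_def Let_def result.simps(1,3,4) 2 3 by simp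
  qed
  have u: "aval ?u s3 = t1 + t2 - 1" by (simp add: s3_def)
  have s31: "s3 1 = e" by (simp add: s3_def e_def)
  have cost: "\<exists>h. the_cost e h (t1 + t2 - 1 - 1)" if c: "split_rule e" "0 < t1" "0 < t2"
  proof -
    obtain h1 where h1: "cost h1 (pr (e 8) (e 9)) (pr (min (e 12) (e 10)) (min (e 13) (e 11))) (e 4) (e 6) (e 2) (bits (e 1)) (t1 - 1)"
    proof -
      have "min (e 12) (e 10) < B" "min (e 13) (e 11) < B" using l by auto
      then show thesis
        using soundD[OF snd c(2)[unfolded t1_def left_key_def] l(8,9) _ _ l(4,6,2,1)] that
        unfolding t1_def left_key_def by blast
    qed
    obtain h2 where h2: "cost h2 (pr (max (e 8) (Suc (e 12))) (max (e 9) (Suc (e 13)))) (pr (e 10) (e 11)) (e 7) (e 5) (e 2) (bits (e 1)) (t2 - 1)"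
    proof -
      have "max (e 8) (Suc (e 12)) < B" "max (e 9) (Suc (e 13)) < B" using l by auto
      then show thesis
        using soundD[OF snd c(3)[unfolded t2_def right_key_def] _ _ l(10,11,7,5,2,1)] that
        unfolding t2_def right_key_def by blast
    qed
    have h: "cost (max h1 h2) (pr (e 8) (e 9)) (\<lambda>i. min (pr (e 12) (e 13) i) (pr (e 10) (e 11) i)) (e 4) (e 6) (e 2) (bits (e 1)) (t1 - 1)"
      "cost (max h1 h2) (\<lambda>i. max (pr (e 8) (e 9) i) (Suc (pr (e 12) (e 13) i))) (pr (e 10) (e 11)) (e 7) (e 5) (e 2) (bits (e 1)) (t2 - 1)"
      unfolding max_min_pr using spine_cost_mono[OF h1, of "max h1 h2"] spine_cost_mono[OF h2, of "max h1 h2"] by auto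
    have "the_cost e (Suc (max h1 h2)) (t1 + t2 - 1 - 1)"
      unfolding the_cost_def
      by (rule spine_cost.split[OF h]) (use c r in \<open>auto simp: split_rule_def Let_def in_range_def\<close>)
    then show ?thesis ..
  qed
  show "post s (result split_prog s)"
  proof (cases "split_rule e \<and> 0 < t1 \<and> 0 < t2")
    case True
    then have "post s3 (result (upd ?u) s3)"
      by (intro post_upd(1)[OF pre3]) (simp_all only: u s31 cost, simp)
    then show ?thesis using True res post_trans[OF post3] by simp
  qed (use res post3 in auto)
  show "ok (result split_prog s 7) (the_key (s 1)) (q1 + q2)"
    if "split_rule (s 1)" "ok (s 7) (left_key (s 1)) q1" "ok (s 7) (right_key (s 1)) q2"
  proof -
    have "split_rule e" "0 < t1" "0 < t2" "t1 + t2 - 1 \<le> Suc (q1 + q2)"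
      using that by (auto simp: ok_def t1_def t2_def e_def)
    note c = this
    have 1: "\<exists>h. the_cost (s3 1) h (aval ?u s3 - 1)" unfolding u s31 by (rule cost[OF c(1-3)])
    have 2: "0 < aval ?u s3" unfolding u using c by simp
    have "ok (result (upd ?u) s3 7) (the_key (s3 1)) (q1 + q2)"
      by (rule post_upd(2)[OF pre3 1 2]) (unfold u, rule c(4))
    then show ?thesis using res c s31 by (simp add: e_def)
  qed
qed

lemma result_step:
  assumes pre: "pre s"
  shows "post s (result step_prog s)"
    "ok (s 7) (step_key (s 1)) q \<Longrightarrow> ok (result step_prog s 7) (the_key (s 1)) (Suc q)"
proof -
  define e where "e = s 1"
  have st: "static s" and r: "in_range e" and snd: "sound (s 7)" using pre by (auto simp: pre_def e_def)
  note l = in_range_less[OF r]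
  define t where "t = s 7 (step_key e)"
  define s1 where "s1 = s(8 := (s 8)(4 := t))"
  have m: "e 1 + missing (e 1) (e 2) < 2 ^ k"
    by (rule add_missing_less) (use r in \<open>auto simp: in_range_def\<close>)
  have "1 * 2 ^ k \<le> B ^ 7 * 2 ^ k" by (intro mult_le_mono1) simp
  then have "s 5 (e 1) = B * e 1"
    using st l(1) unfolding static_def by (metis mult_1 order_less_le_trans)
  then have mis: "s 6 (e 2 + s 5 (e 1)) = missing (e 1) (e 2)"
    using st l(1,2) unfolding static_def by simp
  have "aval (ixe (var 8) (var 9) (var 10) (var 11) (var 4) (var 5) (var 3)
       (Add (var 1) (Cell 6 (Add (var 2) (Cell 5 (var 1)))))) s = step_key e"
    using l m mis unfolding step_key_def e_def by (subst static_ixe[OF st]) auto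
  then have 1: "result (Store 8 (Num 4) (Cell 7 (ixe (var 8) (var 9) (var 10) (var 11) (var 4) (var 5) (var 3)
       (Add (var 1) (Cell 6 (Add (var 2) (Cell 5 (var 1)))))))) s = s1"
    by (simp add: s1_def t_def)
  have post1: "post s s1" unfolding s1_def by (rule post_tmp[OF pre]) simp
  have pre1: "pre s1" by (rule pre_post[OF pre post1])
  let ?u = "Add (tmp 4) (Num 1)"
  have res: "result step_prog s = (if 0 < t then result (upd ?u) s1 else s1)"
    unfolding step_prog_def result.simps(3) 1 by (simp add: s1_def)
  have u: "aval ?u s1 = Suc t" and s11: "s1 1 = e" by (simp_all add: s1_def e_def)
  have cost: "\<exists>h. the_cost e h t" if pos: "0 < t"
  proof -
    obtain h where "cost h (pr (e 8) (e 9)) (pr (e 10) (e 11)) (e 4) (e 5) (e 3) (bits (e 1 + missing (e 1) (e 2))) (t - 1)"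
      using soundD[OF snd pos[unfolded t_def step_key_def] l(8,9,10,11,4,5,3) m]
      unfolding t_def step_key_def by blast
    then have "the_cost e (Suc h) t"
      unfolding the_cost_def bits_add_missing
      by (rule spine_cost.step) (use r pos in \<open>auto simp: in_range_def\<close>)
    then show ?thesis ..
  qed
  show "post s (result step_prog s)"
  proof (cases "0 < t")
    case True
    then have "post s1 (result (upd ?u) s1)"
      by (intro post_upd(1)[OF pre1]) (simp_all only: u s11 cost diff_Suc_1)
    then show ?thesis using True res post_trans[OF post1] by simp
  qed (use res post1 in auto)
  show "ok (result step_prog s 7) (the_key (s 1)) (Suc q)" if "ok (s 7) (step_key (s 1)) q"
  proof -
    have "0 < t" "Suc t \<le> Suc (Suc q)" using that by (auto simp: ok_def t_def e_def)
    note c = this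
    have 1: "\<exists>h. the_cost (s1 1) h (aval ?u s1 - 1)" unfolding u s11 diff_Suc_1 by (rule cost[OF c(1)])
    have 2: "0 < aval ?u s1" unfolding u by simp
    have "ok (result (upd ?u) s1 7) (the_key (s1 1)) (Suc q)"
      by (rule post_upd(2)[OF pre1 1 2]) (unfold u, rule c(2))
    then show ?thesis using res c s11 by (simp add: e_def)
  qed
qed

section \<open>Progress made by one round\<close>

text \<open>At the values \<open>e\<close> of the loop variables each rule has been applied to all
  premises of height up to \<open>h\<close>. The premises refer to derivations and not to table
  entries, so the property survives later improvements of the table.\<close>

definition settled :: "nat \<Rightarrow> (nat \<Rightarrow> nat) \<Rightarrow> (nat \<Rightarrow> nat) \<Rightarrow> bool" where
  "settled h e T \<longleftrightarrow> (\<forall>q. base_rule e q \<longrightarrow> ok T (the_key e) q) \<and>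
    (\<forall>q1 q2. split_rule e \<longrightarrow>
       cost h (pr (e 8) (e 9)) (pr (min (e 12) (e 10)) (min (e 13) (e 11))) (e 4) (e 6) (e 2) (bits (e 1)) q1 \<longrightarrow>
       cost h (pr (max (e 8) (Suc (e 12))) (max (e 9) (Suc (e 13)))) (pr (e 10) (e 11)) (e 7) (e 5) (e 2) (bits (e 1)) q2 \<longrightarrow>
       ok T (the_key e) (q1 + q2)) \<and>
    (\<forall>q. cost h (pr (e 8) (e 9)) (pr (e 10) (e 11)) (e 4) (e 5) (e 3) (insert (e 2) (bits (e 1))) q \<longrightarrow>
       ok T (the_key e) (Suc q))"

lemma settled_improves: "settled h e T \<Longrightarrow> improves T T' \<Longrightarrow> settled h e T'"
  unfolding settled_def using ok_improves by blast

lemma complete_improves: "complete h T \<Longrightarrow> improves T T' \<Longrightarrow> complete h T'"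
  unfolding complete_def using ok_improves by blast

text \<open>The table is updated in place. As entries only improve, completeness for height
  \<open>h\<close> persists between the three parts of the body, so each part finds its
  premises.\<close>

lemma result_relax:
  assumes st: "static s" and snd: "sound (s 7)" and cmp: "complete h (s 7)" and r: "in_range (s 1)"
  defines "s' \<equiv> result relax_prog s"
  shows "static s'" "sound (s' 7)" "s' 1 = s 1" "improves (s 7) (s' 7)" "settled h (s 1) (s' 7)"
proof -
  note l = in_range_less[OF r]
  define s0 where "s0 = s(8 := (s 8)(0 := the_key (s 1)))"
  define s1 where "s1 = result base_prog s0"
  define s2 where "s2 = result split_prog s1"
  have "aval key s = the_key (s 1)"
    unfolding key_def the_key_def using l by (subst static_ixe[OF st]) auto
  then have s': "s' = result step_prog s2"
    by (simp add: s'_def relax_prog_def s2_def s1_def s0_def)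
  have "static s0" unfolding s0_def by (rule static_cong[OF st]) auto
  then have pre0: "pre s0" using snd r by (simp add: s0_def pre_def)
  have p1: "post s0 s1" unfolding s1_def by (rule result_base(1)[OF pre0])
  have pre1: "pre s1" by (rule pre_post[OF pre0 p1])
  have p2: "post s1 s2" unfolding s2_def by (rule result_split(1)[OF pre1])
  have pre2: "pre s2" by (rule pre_post[OF pre1 p2])
  have p3: "post s2 s'" unfolding s' by (rule result_step(1)[OF pre2])
  have e: "s0 1 = s 1" "s1 1 = s 1" "s2 1 = s 1" "s' 1 = s 1"
    using p1 p2 p3 by (auto simp: post_def s0_def)
  have s07: "s0 7 = s 7" by (simp add: s0_def)
  have imp: "improves (s 7) (s1 7)" "improves (s1 7) (s2 7)" "improves (s2 7) (s' 7)"
    using p1 p2 p3 s07 by (auto simp: post_def)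
  show "static s'" "sound (s' 7)" "s' 1 = s 1" using pre_post[OF pre2 p3] e by (auto simp: pre_def)
  show "improves (s 7) (s' 7)" using imp improves_trans by blast
  have c1: "complete h (s1 7)" and c2: "complete h (s2 7)"
    using complete_improves[OF cmp imp(1)] complete_improves imp(2) by blast+
  show "settled h (s 1) (s' 7)"
    unfolding settled_def
  proof (intro conjI allI impI)
    fix q assume "base_rule (s 1) q"
    then have "ok (s1 7) (the_key (s 1)) q" using result_base(2)[OF pre0] e by (simp add: s1_def)
    then show "ok (s' 7) (the_key (s 1)) q" using imp ok_improves by blast
  next
    fix q1 q2
    assume rule: "split_rule (s 1)"
      and 1: "cost h (pr (s 1 8) (s 1 9)) (pr (min (s 1 12) (s 1 10)) (min (s 1 13) (s 1 11))) (s 1 4) (s 1 6) (s 1 2) (bits (s 1 1)) q1"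
      and 2: "cost h (pr (max (s 1 8) (Suc (s 1 12))) (max (s 1 9) (Suc (s 1 13)))) (pr (s 1 10) (s 1 11)) (s 1 7) (s 1 5) (s 1 2) (bits (s 1 1)) q2"
    have p: "s 1 12 \<le> n" "s 1 13 \<le> n" using rule by (auto simp: split_rule_def Let_def)
    have "ok (s1 7) (left_key (s 1)) q1"
      unfolding left_key_def
      by (rule completeD[OF c1 1]) (use r in \<open>auto simp: in_range_def\<close>)
    moreover have "max (s 1 8) (Suc (s 1 12)) < N" "max (s 1 9) (Suc (s 1 13)) < N"
      using p r by (auto simp: in_range_def)
    then have "ok (s1 7) (right_key (s 1)) q2"
      unfolding right_key_def
      by (intro completeD[OF c1 2]) (use r in \<open>auto simp: in_range_def\<close>)
    ultimately have "ok (s2 7) (the_key (s 1)) (q1 + q2)"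
      using result_split(2)[OF pre1] rule e by (simp add: s2_def)
    then show "ok (s' 7) (the_key (s 1)) (q1 + q2)" using imp(3) ok_improves by blast
  next
    fix q assume 1: "cost h (pr (s 1 8) (s 1 9)) (pr (s 1 10) (s 1 11)) (s 1 4) (s 1 5) (s 1 3) (insert (s 1 2) (bits (s 1 1))) q"
    have "s 1 1 + missing (s 1 1) (s 1 2) < 2 ^ k"
      by (rule add_missing_less) (use r in \<open>auto simp: in_range_def\<close>)
    then have "ok (s2 7) (step_key (s 1)) q"
      using 1 unfolding step_key_def bits_add_missing[symmetric]
      by (intro completeD[OF c2]) (use r in \<open>auto simp: in_range_def\<close>)
    then show "ok (s' 7) (the_key (s 1)) (Suc q)" using result_step(2)[OF pre2] e by (simp add: s')
  qed
qed

text \<open>The last rule of a derivation corresponds to some values of the loop variables, those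
  that the rule does not mention being set to 0. The parameters \<open>z\<close> and
  \<open>f\<close> are the contents of the other cells of bank 1, which the loops leave
  unchanged.\<close>

lemma complete_Suc:
  assumes "\<And>e. in_range e \<Longrightarrow> e 0 = z \<Longrightarrow> (\<And>v. 13 < v \<Longrightarrow> e v = f v) \<Longrightarrow> settled h e T"
  shows "complete (Suc h) T"
  unfolding complete_def
proof (intro allI impI)
  fix l1 l2 r1 r2 a b c m q
  assume r: "l1 < N" "l2 < N" "r1 < N" "r2 < N" "a < 3" "b < 3" "c < k" "m < 2 ^ k"
    and cost: "cost (Suc h) (pr l1 l2) (pr r1 r2) a b c (bits m) q"
  define env where "env = (\<lambda>e x y p1 p2 v. if 13 < v then f v
    else [z, m, c, e, a, b, x, y, l1, l2, r1, r2, p1, p2] ! v)"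
  have env: "settled h (env e x y p1 p2) T" if "e < k" "x < 3" "y < 3" "p1 < N" "p2 < N" for e x y p1 p2
    by (rule assms) (use that r in \<open>auto simp: env_def in_range_def\<close>)
  have the_key: "the_key (env e x y p1 p2) = idx l1 l2 r1 r2 a b c m" for e x y p1 p2
    by (simp add: env_def the_key_def)
  have ok_mono: "ok T i q' \<Longrightarrow> q' \<le> q \<Longrightarrow> ok T i q" for i q' by (auto simp: ok_def)
  from cost show "ok T (idx l1 l2 r1 r2 a b c m) q"
  proof (cases rule: spine_cost.cases)
    case base
    have "base_rule (env 0 0 0 0 0) q"
      using base by (auto simp: env_def base_rule_def Let_def)
    then show ?thesis using env[of 0 0 0 0 0] k(1) the_key by (simp add: settled_def)
  next
    case (split p x k1 y k2)
    let ?e = "env 0 x y (p 1) (p 2)"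
    have x: "x < 3" "y < 3" using split by auto
    have "split_rule ?e" using split by (auto simp: env_def split_rule_def Let_def)
    moreover have "cost h (pr l1 l2) (pr (min (p 1) r1) (min (p 2) r2)) a x c (bits m) k1"
      by (rule spine_cost_cong[OF split(1)]) auto
    moreover have "cost h (pr (max l1 (Suc (p 1))) (max l2 (Suc (p 2)))) (pr r1 r2) y b c (bits m) k2"
      by (rule spine_cost_cong[OF split(2)]) auto
    ultimately have "ok T (the_key ?e) (k1 + k2)"
      using env[of 0 x y "p 1" "p 2"] k(1) x split unfolding settled_def by (simp add: env_def)
    then show ?thesis using ok_mono split(8) the_key by simp
  next
    case (step e k')
    then have "ok T (the_key (env e 0 0 0 0)) (Suc k')"
      using env[of e 0 0 0 0] unfolding settled_def by (simp add: env_def)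
    then show ?thesis using ok_mono step(4) the_key by simp
  qed
qed

end


section \<open>The program\<close>

text \<open>Loops start at 0, so rows range over 0, 1 and 2; there are no derivations for row
  0.\<close>

definition loop_vars :: "(nat \<times> aexp) list" where
  "loop_vars = [(1, Cell 2 (Num 6)), (2, Cell 2 (Num 5)), (3, Cell 2 (Num 5)), (4, Num 3), (5, Num 3),
     (6, Num 3), (7, Num 3), (8, Cell 2 (Num 3)), (9, Cell 2 (Num 3)), (10, Cell 2 (Num 3)),
     (11, Cell 2 (Num 3)), (12, Cell 2 (Num 3)), (13, Cell 2 (Num 3))]"

text \<open>The \<open>2 * N\<close> rounds exceed \<open>4 * n\<close>, the greatest height
  needed.\<close>

definition rounds_prog :: com where
  "rounds_prog = For 0 (Add (Cell 2 (Num 3)) (Cell 2 (Num 3))) (loops loop_vars relax_prog)"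

definition final_key :: aexp where
  "final_key = ixe (Num 1) (Num 1) (Cell 2 (Num 7)) (Cell 2 (Num 7)) (Num 1) (Num 1) (var 0) (Num 0)"

definition finish_prog :: com where
  "finish_prog = Seq (Seq (Store 1 (Num 0) (Num 0)) (Store 8 (Num 5) (Cell 7 final_key)))
     (Seq (For 0 (Cell 2 (Num 5))
       (If (Less (Cell 7 final_key) (tmp 5)) (Store 8 (Num 5) (Cell 7 final_key)) Skip))
     (Store 0 (Num 0) (Sub (tmp 5) (Num 1))))"

definition power_prog :: com where
  "power_prog = Seq (Store 2 (Num 6) (Num 1))
     (For 0 (Cell 2 (Num 5)) (Store 2 (Num 6) (Add (Cell 2 (Num 6)) (Cell 2 (Num 6)))))"

definition range_prog :: com where
  "range_prog = Seq (Store 2 (Num 10) (Cell 2 (Num 6)))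
     (For 0 (Num 7) (Seq (Store 2 (Num 11) (Num 0))
       (Seq (For 1 (Cell 2 (Num 4)) (Store 2 (Num 11) (Add (Cell 2 (Num 11)) (Cell 2 (Num 10)))))
         (Store 2 (Num 10) (Cell 2 (Num 11))))))"

definition multiples_prog :: com where
  "multiples_prog = For 0 (Cell 2 (Num 10))
     (Store 5 (Add (var 0) (Num 1)) (Add (Cell 5 (var 0)) (Cell 2 (Num 4))))"

definition missing_prog :: com where
  "missing_prog = (let d = Add (var 0) (var 0); d' = Add d (Num 1); c' = Add (var 1) (Num 1);
       x = Cell 6 (Add (var 1) (Cell 5 (var 0))) in
     For 0 (Cell 2 (Num 6)) (Seq (Seq (Store 6 (Cell 5 d) (Num 1)) (Store 6 (Cell 5 d') (Num 0)))
       (For 1 (Cell 2 (Num 3)) (Seq (Store 6 (Add c' (Cell 5 d)) (Add x x))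
         (Store 6 (Add c' (Cell 5 d')) (Add x x))))))"

definition table_prog :: com where
  "table_prog = Seq (Seq power_prog range_prog) (Seq (Seq multiples_prog missing_prog) (Seq rounds_prog finish_prog))"

text \<open>The number \<open>324 = 3 ^ 4 * 2 ^ 2\<close> comes from four rows and two colours below
  \<open>k \<le> 2 * n\<close>, \<open>4 ^ 6\<close> from six borders below
  \<open>N \<le> 4 * n\<close>, and \<open>273 = 21 * 13\<close> from the overhead of 13 loops. The
  other numbers are rounded up generously.\<close>

definition time_factor :: nat where
  "time_factor = 2 * 10 ^ 7 + 16 * (324 * 4 ^ 6 * (max_cost relax_prog + 273))"

section \<open>Rounds of relaxation and the final minimum\<close>

context flood_table
begin

definition bound :: "nat \<Rightarrow> nat" where
  "bound v = (if v = 1 then 2 ^ k else if v \<le> 3 then k else if v \<le> 7 then 3 else N)"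

definition round_time :: nat where
  "round_time = loops_time (max_cost relax_prog) (map (bound \<circ> fst) loop_vars)"

lemma set_loop_vars: "fst ` set loop_vars = {1..13}"
  by (auto simp: loop_vars_def) presburger

lemma in_range_iff: "in_range e \<longleftrightarrow> (\<forall>v\<in>{1..13}. e v < bound v)"
proof -
  have "v \<in> {1..13} \<longleftrightarrow> v = 1 \<or> v = 2 \<or> v = 3 \<or> v = 4 \<or> v = 5 \<or> v = 6 \<or> v = 7 \<or> v = 8 \<or> v = 9 \<or>
      v = 10 \<or> v = 11 \<or> v = 12 \<or> v = 13" for v :: nat
    unfolding atLeastAtMost_iff by presburger
  then show ?thesis
    by (simp only: Ball_def imp_disjL all_conj_distrib simp_thms) (simp add: in_range_def bound_def)
qed

lemma straight_relax: "straight relax_prog"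
  by (simp add: relax_prog_def base_prog_def split_prog_def step_prog_def upd_def Let_def)

lemma runs_round:
  "runs (loops loop_vars relax_prog) round_time
     (\<lambda>s. (static s \<and> sound (s 7) \<and> complete h (s 7)) \<and> s 1 0 = i)
     (\<lambda>s. (static s \<and> sound (s 7) \<and> complete (Suc h) (s 7)) \<and> s 1 0 = i)"
  unfolding runs_def
proof (intro allI impI)
  fix s assume s: "(static s \<and> sound (s 7) \<and> complete h (s 7)) \<and> s 1 0 = i"
  let ?Inv = "\<lambda>s. static s \<and> sound (s 7) \<and> complete h (s 7)"
  have "\<exists>t s'. exec (loops loop_vars relax_prog) s t s' \<and> t \<le> round_time \<and> ?Inv s' \<and>
    (\<forall>v. v \<notin> fst ` set loop_vars \<longrightarrow> s' 1 v = s 1 v) \<and> improves (s 7) (s' 7) \<and>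
    (\<forall>e. (\<forall>v. v \<notin> fst ` set loop_vars \<longrightarrow> e v = s 1 v) \<longrightarrow> (\<forall>v\<in>fst ` set loop_vars. e v < bound v) \<longrightarrow>
      settled h e (s' 7))"
    unfolding round_time_def
  proof (rule loops_exec[where V = "{1..13}" and rel = "\<lambda>s s'. improves (s 7) (s' 7)" and
        eff = "\<lambda>e s. settled h e (s 7)"])
    show "\<forall>(v, e)\<in>set loop_vars. acost e \<le> 2 \<and> (\<forall>s. ?Inv s \<longrightarrow> aval e s = bound v)"
      by (auto simp: loop_vars_def bound_def static_def)
    show "\<exists>t s'. exec relax_prog s t s' \<and> t \<le> max_cost relax_prog \<and> ?Inv s' \<and> s' 1 = s 1 \<and>
        improves (s 7) (s' 7) \<and> settled h (s 1) (s' 7)"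
      if "?Inv s" "\<forall>v\<in>{1..13}. s 1 v < bound v" for s
    proof -
      have "in_range (s 1)" using that(2) by (simp only: in_range_iff)
      then show ?thesis
        using straight_exec[OF straight_relax, of s] result_relax[of s h] that(1)
          complete_improves[of h "s 7"] by blast
    qed
    show "?Inv (s(1 := f))" if "?Inv s" for s f
      using that by (auto intro: static_cong[of s])
    show "distinct (map fst loop_vars)" by (simp add: loop_vars_def)
    show "\<forall>v\<in>{1..13} - fst ` set loop_vars. s 1 v < bound v" unfolding set_loop_vars by simp
  qed (use s settled_improves improves_trans in auto)
  then obtain t s' where s': "exec (loops loop_vars relax_prog) s t s'" "t \<le> round_time" "?Inv s'"
      "s' 1 0 = s 1 0" "\<And>e. (\<And>v. v \<notin> {1..13} \<Longrightarrow> e v = s 1 v) \<Longrightarrow> (\<And>v. v \<in> {1..13} \<Longrightarrow> e v < bound v) \<Longrightarrow> settled h e (s' 7)"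
    unfolding set_loop_vars by auto
  have "complete (Suc h) (s' 7)"
  proof (rule complete_Suc[of "s 1 0" "s 1"])
    fix e assume e: "in_range e" "e 0 = s 1 0" "\<And>v. 13 < v \<Longrightarrow> e v = s 1 v"
    show "settled h e (s' 7)"
    proof (rule s'(5))
      show "e v = s 1 v" if "v \<notin> {1..13}" for v using that e by (cases "v = 0") auto
      show "e v < bound v" if "v \<in> {1..13}" for v
        using that e(1) unfolding in_range_iff by blast
    qed
  qed
  then show "\<exists>t s'. exec (loops loop_vars relax_prog) s t s' \<and> t \<le> round_time \<and>
    (static s' \<and> sound (s' 7) \<and> complete (Suc h) (s' 7)) \<and> s' 1 0 = i"
    using s' s by metis
qed

lemma runs_rounds:
  "runs rounds_prog (2 * N * (round_time + 15) + 12) (\<lambda>s. static s \<and> s 7 = (\<lambda>_. 0))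
     (\<lambda>s. static s \<and> sound (s 7) \<and> complete (2 * N) (s 7))"
proof -
  let ?A = "\<lambda>i s. static s \<and> sound (s 7) \<and> complete i (s 7)"
  have "runs rounds_prog (2 * N * (round_time + acost (Add (Cell 2 (Num 3)) (Cell 2 (Num 3))) + 10) +
    acost (Add (Cell 2 (Num 3)) (Cell 2 (Num 3))) + 7) (?A 0) (?A (2 * N))"
    unfolding rounds_prog_def
  proof (rule runs_For[where A = ?A, OF runs_round])
    show "?A i (s(1 := (s 1)(0 := x)))" if "?A i s" for i s x
      using that by (auto intro: static_cong[of s])
    show "aval (Add (Cell 2 (Num 3)) (Cell 2 (Num 3))) s = 2 * N" if "?A i s" for i s
      using that by (simp add: static_def)
  qed
  \<comment> \<open>No rule has a conclusion of height 0, so the table without finite entries is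
    complete for height 0; it is trivially sound.\<close>
  moreover have "?A 0 s" if "static s \<and> s 7 = (\<lambda>_. 0)" for s
    using that by (auto simp: sound_def complete_def elim: spine_cost.cases)
  ultimately show ?thesis by (auto intro: runs_weaken)
qed

definition out :: "(nat \<Rightarrow> nat) \<Rightarrow> nat \<Rightarrow> nat" where
  "out T d = T (idx 1 1 n n 1 1 d 0)"

lemma aval_final_key: "static s \<Longrightarrow> s 1 0 < B \<Longrightarrow> s 7 (aval final_key s) = out (s 7) (s 1 0)"
  unfolding final_key_def out_def by (subst static_ixe) (auto simp: static_def)

text \<open>An entry 0 would count as the least one here. That it does not occur for colours below
  \<open>k\<close> is shown in \<open>table_result\<close>.\<close>

lemma runs_finish:
  "runs finish_prog (k * 200 + 200) (\<lambda>s. static s \<and> s 7 = T)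
     (\<lambda>s. (\<exists>d<k. s 0 0 = out T d - 1) \<and> (\<forall>d<k. s 0 0 \<le> out T d - 1))"
proof -
  let ?A = "\<lambda>i s. static s \<and> s 7 = T \<and> (\<exists>d<k. s 8 5 = out T d) \<and> (\<forall>d<i. s 8 5 \<le> out T d)"
  let ?P = "If (Less (Cell 7 final_key) (tmp 5)) (Store 8 (Num 5) (Cell 7 final_key)) Skip"
  have c: "acost final_key = 25" by (simp add: final_key_def ixe_def)
  have kB: "k \<le> B" using k by simp
  have 1: "runs (Seq (Store 1 (Num 0) (Num 0)) (Store 8 (Num 5) (Cell 7 final_key))) 50
     (\<lambda>s. static s \<and> s 7 = T) (?A 0)"
  proof (rule runs_straight)
    fix s assume s: "static s \<and> s 7 = T"
    have zero: "\<exists>d<k. out T 0 = out T d" using k by (intro exI[of _ 0]) simp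
    define s1 where "s1 = s(1 := (s 1)(0 := 0))"
    have "static s1" using s by (auto simp: s1_def intro: static_cong[of s])
    moreover from this have "s1 7 (aval final_key s1) = out T 0" using s by (subst aval_final_key) (auto simp: s1_def)
    ultimately show "?A 0 (result (Seq (Store 1 (Num 0) (Num 0)) (Store 8 (Num 5) (Cell 7 final_key))) s)"
      using zero s by (auto simp: s1_def intro: static_cong[of s1])
  qed (simp_all add: c)
  have 2: "runs (For 0 (Cell 2 (Num 5)) ?P) (k * (60 + acost (Cell 2 (Num 5)) + 10) + acost (Cell 2 (Num 5)) + 7) (?A 0) (?A k)"
  proof (rule runs_For)
    show "runs ?P 60 (\<lambda>s. ?A i s \<and> s 1 0 = i) (\<lambda>s. ?A (Suc i) s \<and> s 1 0 = i)" if "i < k" for i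
    proof (rule runs_straight)
      fix s assume s: "?A i s \<and> s 1 0 = i"
      have key: "s 7 (aval final_key s) = out T i" using s that kB by (subst aval_final_key) auto
      show "?A (Suc i) (result ?P s) \<and> result ?P s 1 0 = i"
        using s key that by (auto simp: less_Suc_eq intro: static_cong[of s] order_trans less_imp_le)
    qed (simp_all add: c)
    show "?A i (s(1 := (s 1)(0 := x)))" if "?A i s" for i s x
      using that by (auto intro: static_cong[of s])
    show "aval (Cell 2 (Num 5)) s = k" if "?A i s" for i s
      using that by (simp add: static_def)
  qed
  have 3: "runs (Store 0 (Num 0) (Sub (tmp 5) (Num 1))) 10 (?A k)
     (\<lambda>s. (\<exists>d<k. s 0 0 = out T d - 1) \<and> (\<forall>d<k. s 0 0 \<le> out T d - 1))"
    by (rule runs_straight) (auto intro: diff_le_mono)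
  show ?thesis unfolding finish_prog_def
    by (rule runs_weaken[OF runs_Seq[OF 1 runs_Seq[OF 2 3]]]) auto
qed

section \<open>Tables that replace multiplication and bit operations\<close>

definition prepared :: "state \<Rightarrow> bool" where
  "prepared s \<longleftrightarrow> s 2 1 = 1 \<and> s 2 2 = n + 1 \<and> s 2 3 = N \<and> s 2 4 = B \<and> s 2 5 = k \<and> s 2 7 = n \<and>
     (\<forall>a j. (a, j) \<in> board n \<longrightarrow> s 3 (s 2 a + j) = w (a, j)) \<and> s 7 = (\<lambda>_. 0)"

lemma prepared_cong:
  assumes "prepared s" "s' 3 = s 3" "s' 7 = s 7" "\<And>i. i \<in> {1, 2, 3, 4, 5, 7} \<Longrightarrow> s' 2 i = s 2 i"
  shows "prepared s'"
proof -
  have eq: "s' 2 1 = s 2 1" "s' 2 2 = s 2 2" "s' 2 3 = s 2 3" "s' 2 4 = s 2 4" "s' 2 5 = s 2 5" "s' 2 7 = s 2 7"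
    using assms(4) by blast+
  have "s' 3 (s' 2 a + j) = w (a, j)" if "(a, j) \<in> board n" for a j
  proof -
    have "s' 2 a = s 2 a" using that eq(1,2) by (auto simp: board_iff)
    then show ?thesis using assms(1,2) that by (simp add: prepared_def)
  qed
  then show ?thesis using assms(1,3) eq by (simp add: prepared_def)
qed

lemma runs_power:
  "runs power_prog (k * 30 + 30) (\<lambda>s. prepared s \<and> s 5 = (\<lambda>_. 0)) (\<lambda>s. prepared s \<and> s 5 = (\<lambda>_. 0) \<and> s 2 6 = 2 ^ k)"
proof -
  let ?A = "\<lambda>i s. prepared s \<and> s 5 = (\<lambda>_. 0) \<and> s 2 6 = 2 ^ i"
  have 1: "runs (Store 2 (Num 6) (Num 1)) 3 (\<lambda>s. prepared s \<and> s 5 = (\<lambda>_. 0)) (?A 0)"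
    by (rule runs_straight) (auto intro: prepared_cong)
  have 2: "runs (For 0 (Cell 2 (Num 5)) (Store 2 (Num 6) (Add (Cell 2 (Num 6)) (Cell 2 (Num 6)))))
     (k * (10 + acost (Cell 2 (Num 5)) + 10) + acost (Cell 2 (Num 5)) + 7) (?A 0) (?A k)"
  proof (rule runs_For)
    show "runs (Store 2 (Num 6) (Add (Cell 2 (Num 6)) (Cell 2 (Num 6)))) 10 (\<lambda>s. ?A i s \<and> s 1 0 = i)
      (\<lambda>s. ?A (Suc i) s \<and> s 1 0 = i)" for i
      by (rule runs_straight) (auto intro: prepared_cong)
    show "?A i (s(1 := (s 1)(0 := x)))" if "?A i s" for i s x
      using that by (auto intro: prepared_cong)
    show "aval (Cell 2 (Num 5)) s = k" if "?A i s" for i s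
      using that by (simp add: prepared_def)
  qed
  show ?thesis unfolding power_prog_def by (rule runs_weaken[OF runs_Seq[OF 1 2]]) auto
qed

lemma runs_range:
  "runs range_prog (200 * B + 400) (\<lambda>s. prepared s \<and> s 5 = (\<lambda>_. 0) \<and> s 2 6 = 2 ^ k)
     (\<lambda>s. prepared s \<and> s 5 = (\<lambda>_. 0) \<and> s 2 6 = 2 ^ k \<and> s 2 10 = B ^ 7 * 2 ^ k)"
proof -
  let ?P = "\<lambda>s. prepared s \<and> s 5 = (\<lambda>_. 0) \<and> s 2 6 = 2 ^ k"
  let ?A = "\<lambda>i s. ?P s \<and> s 2 10 = B ^ i * 2 ^ k"
  let ?add = "Store 2 (Num 11) (Add (Cell 2 (Num 11)) (Cell 2 (Num 10)))"
  have 1: "runs (Store 2 (Num 10) (Cell 2 (Num 6))) 4 ?P (?A 0)"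
    by (rule runs_straight) (auto intro: prepared_cong)
  have 2: "runs (Seq (Store 2 (Num 11) (Num 0)) (Seq (For 1 (Cell 2 (Num 4)) ?add) (Store 2 (Num 10) (Cell 2 (Num 11)))))
      (3 + (B * (7 + acost (Cell 2 (Num 4)) + 10) + acost (Cell 2 (Num 4)) + 7 + 4)) (\<lambda>s. ?A i s \<and> s 1 0 = i) (\<lambda>s. ?A (Suc i) s \<and> s 1 0 = i)" for i
  proof -
    let ?A' = "\<lambda>j s. ?A i s \<and> s 1 0 = i \<and> s 2 11 = j * (B ^ i * 2 ^ k)"
    have a: "runs (Store 2 (Num 11) (Num 0)) 3 (\<lambda>s. ?A i s \<and> s 1 0 = i) (?A' 0)"
      by (rule runs_straight) (auto intro: prepared_cong)
    have b: "runs (For 1 (Cell 2 (Num 4)) ?add) (B * (7 + acost (Cell 2 (Num 4)) + 10) + acost (Cell 2 (Num 4)) + 7) (?A' 0) (?A' B)"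
    proof (rule runs_For)
      show "runs ?add 7 (\<lambda>s. ?A' j s \<and> s 1 1 = j) (\<lambda>s. ?A' (Suc j) s \<and> s 1 1 = j)" for j
        by (rule runs_straight) (auto intro: prepared_cong simp: algebra_simps)
      show "?A' j (s(1 := (s 1)(1 := x)))" if "?A' j s" for j s x
        using that by (auto intro: prepared_cong)
      show "aval (Cell 2 (Num 4)) s = B" if "?A' j s" for j s
        using that by (simp add: prepared_def)
    qed
    have c: "runs (Store 2 (Num 10) (Cell 2 (Num 11))) 4 (?A' B) (\<lambda>s. ?A (Suc i) s \<and> s 1 0 = i)"
      by (rule runs_straight) (auto intro: prepared_cong)
    show ?thesis by (rule runs_Seq[OF a runs_Seq[OF b c]])
  qed
  have 3: "runs (For 0 (Num 7) (Seq (Store 2 (Num 11) (Num 0)) (Seq (For 1 (Cell 2 (Num 4)) ?add) (Store 2 (Num 10) (Cell 2 (Num 11))))))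
     (7 * (3 + (B * (7 + acost (Cell 2 (Num 4)) + 10) + acost (Cell 2 (Num 4)) + 7 + 4) + acost (Num 7) + 10) + acost (Num 7) + 7) (?A 0) (?A 7)"
  proof (rule runs_For[OF 2])
    show "?A i (s(1 := (s 1)(0 := x)))" if "?A i s" for i s x
      using that by (auto intro: prepared_cong)
  qed simp
  show ?thesis unfolding range_prog_def
    by (rule runs_weaken[OF runs_Seq[OF 1 3]]) auto
qed

lemma runs_multiples:
  "runs multiples_prog (B ^ 7 * 2 ^ k * 30 + 30)
     (\<lambda>s. prepared s \<and> s 5 = (\<lambda>_. 0) \<and> s 2 6 = 2 ^ k \<and> s 2 10 = B ^ 7 * 2 ^ k)
     (\<lambda>s. prepared s \<and> s 2 6 = 2 ^ k \<and> (\<forall>u\<le>B ^ 7 * 2 ^ k. s 5 u = B * u))"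
proof -
  let ?A = "\<lambda>i s. prepared s \<and> s 2 6 = 2 ^ k \<and> s 2 10 = B ^ 7 * 2 ^ k \<and> (\<forall>u\<le>i. s 5 u = B * u)"
  have "runs multiples_prog (B ^ 7 * 2 ^ k * (15 + acost (Cell 2 (Num 10)) + 10) + acost (Cell 2 (Num 10)) + 7) (?A 0) (?A (B ^ 7 * 2 ^ k))"
    unfolding multiples_prog_def
  proof (rule runs_For)
    show "runs (Store 5 (Add (var 0) (Num 1)) (Add (Cell 5 (var 0)) (Cell 2 (Num 4)))) 15 (\<lambda>s. ?A i s \<and> s 1 0 = i)
      (\<lambda>s. ?A (Suc i) s \<and> s 1 0 = i)" for i
    proof (rule runs_straight)
      fix s assume s: "?A i s \<and> s 1 0 = i"
      then have "s 2 4 = B" by (simp add: prepared_def)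
      then show "?A (Suc i) (result (Store 5 (Add (var 0) (Num 1)) (Add (Cell 5 (var 0)) (Cell 2 (Num 4)))) s) \<and>
          result (Store 5 (Add (var 0) (Num 1)) (Add (Cell 5 (var 0)) (Cell 2 (Num 4)))) s 1 0 = i"
        using s by (auto intro: prepared_cong[of s] simp: le_Suc_eq)
    qed auto
    show "?A i (s(1 := (s 1)(0 := x)))" if "?A i s" for i s x
      using that by (auto intro: prepared_cong)
  qed simp
  then show ?thesis by (rule runs_weaken) auto
qed

lemma runs_missing:
  "runs missing_prog (2 ^ k * (N * 100 + 100) + 30)
     (\<lambda>s. prepared s \<and> s 2 6 = 2 ^ k \<and> (\<forall>u\<le>B ^ 7 * 2 ^ k. s 5 u = B * u)) (\<lambda>s. static s \<and> s 7 = (\<lambda>_. 0))"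
proof -
  let ?P = "\<lambda>s. prepared s \<and> s 2 6 = 2 ^ k \<and> (\<forall>u\<le>B ^ 7 * 2 ^ k. s 5 u = B * u)"
  let ?tab = "\<lambda>i s. \<forall>J<2 * i. \<forall>c<B. s 6 (c + B * J) = missing J c"
  let ?A = "\<lambda>i s. ?P s \<and> ?tab i s"
  let ?d = "Add (var 0) (var 0)"
  let ?d' = "Add ?d (Num 1)"
  let ?c' = "Add (var 1) (Num 1)"
  let ?x = "Cell 6 (Add (var 1) (Cell 5 (var 0)))"
  let ?init = "Seq (Store 6 (Cell 5 ?d) (Num 1)) (Store 6 (Cell 5 ?d') (Num 0))"
  let ?body = "Seq (Store 6 (Add ?c' (Cell 5 ?d)) (Add ?x ?x)) (Store 6 (Add ?c' (Cell 5 ?d')) (Add ?x ?x))"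
  have small: "u \<le> B ^ 7 * 2 ^ k" if "u \<le> 2 * 2 ^ k" for u
  proof -
    have "2 \<le> B ^ 7" using self_le_power[of B 7] by simp
    then have "2 * 2 ^ k \<le> B ^ 7 * 2 ^ k" by (rule mult_le_mono1)
    with that show ?thesis by (rule order_trans)
  qed
  have 2: "runs (Seq ?init (For 1 (Cell 2 (Num 3)) ?body))
      (30 + (N * (60 + acost (Cell 2 (Num 3)) + 10) + acost (Cell 2 (Num 3)) + 7)) (\<lambda>s. ?A i s \<and> s 1 0 = i) (\<lambda>s. ?A (Suc i) s \<and> s 1 0 = i)"
    if i: "i < 2 ^ k" for i
  proof -
    let ?A' = "\<lambda>j s. ?A i s \<and> s 1 0 = i \<and> (\<forall>c\<le>j. s 6 (c + B * (2 * i)) = missing (2 * i) c \<and>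
       s 6 (c + B * (Suc (2 * i))) = missing (Suc (2 * i)) c)"
    have mults: "s 5 i = B * i" "s 5 (i + i) = B * (2 * i)" "s 5 (i + i + 1) = B * (Suc (2 * i))" if "?P s" for s
    proof -
      have tab: "s 5 u = B * u" if "u \<le> 2 * 2 ^ k" for u using small[OF that] \<open>?P s\<close> by blast
      show "s 5 i = B * i" by (rule tab) (use i in simp)
      have "s 5 (2 * i) = B * (2 * i)" by (rule tab) (use i in simp)
      then show "s 5 (i + i) = B * (2 * i)" by (simp only: mult_2[symmetric])
      have "s 5 (Suc (2 * i)) = B * Suc (2 * i)" by (rule tab) (use i in simp)
      then show "s 5 (i + i + 1) = B * (Suc (2 * i))" by (simp only: mult_2[symmetric] Suc_eq_plus1)
    qed
    have a: "runs ?init 30 (\<lambda>s. ?A i s \<and> s 1 0 = i) (?A' 0)"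
    proof (rule runs_straight)
      fix s assume s: "?A i s \<and> s 1 0 = i"
      have m: "s 5 (i + i) = B * (2 * i)" "s 5 (i + i + 1) = B * (Suc (2 * i))" using mults s by blast+
      define s' where "s' = s(6 := (s 6)(0 + B * (2 * i) := 1, 0 + B * Suc (2 * i) := 0))"
      have r: "result ?init s = s'" using s m by (simp add: s'_def)
      have "prepared s'" using s by (auto simp: s'_def intro: prepared_cong)
      moreover have "s' 6 (c + B * J) = missing J c" if "J < 2 * i" "c < B" for J c
      proof -
        have "c + B * J \<noteq> 0 + B * (2 * i)" "c + B * J \<noteq> 0 + B * Suc (2 * i)"
          using that by (subst digit_inj; auto)+
        then have "s' 6 (c + B * J) = s 6 (c + B * J)" by (simp add: s'_def del: mult_Suc_right)
        then show ?thesis using s that by auto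
      qed
      moreover have "s' 6 (0 + B * (2 * i)) = missing (2 * i) 0" "s' 6 (0 + B * Suc (2 * i)) = missing (Suc (2 * i)) 0"
        by (simp_all add: s'_def missing_even missing_odd)
      moreover have "s' 5 = s 5" "s' 2 = s 2" "s' 1 = s 1" by (simp_all add: s'_def)
      ultimately show "?A' 0 (result ?init s)" unfolding r using s by simp
    qed simp_all
    have b: "runs (For 1 (Cell 2 (Num 3)) ?body) (N * (60 + acost (Cell 2 (Num 3)) + 10) + acost (Cell 2 (Num 3)) + 7) (?A' 0) (?A' N)"
    proof (rule runs_For)
      show "runs ?body 60 (\<lambda>s. ?A' j s \<and> s 1 1 = j) (\<lambda>s. ?A' (Suc j) s \<and> s 1 1 = j)" if j: "j < N" for j
      proof (rule runs_straight)
        fix s assume s: "?A' j s \<and> s 1 1 = j"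
        have m: "s 5 i = B * i" "s 5 (i + i) = B * (2 * i)" "s 5 (i + i + 1) = B * (Suc (2 * i))" using mults s by blast+
        \<comment> \<open>For \<open>i = 0\<close> the row to be read is the row
          \<open>2 * i\<close> being written, and the inner invariant supplies its entries up to
          \<open>j\<close>. For \<open>i > 0\<close> the row has been completed in an earlier
          iteration.\<close>
        have x: "s 6 (j + B * i) = missing i j"
        proof (cases "i = 0")
          case True
          have "s 6 (j + B * (2 * i)) = missing (2 * i) j" using s by blast
          then show ?thesis using True by simp
        next
          case False
          then show ?thesis using s j by simp
        qed
        define s' where "s' = s(6 := (s 6)(Suc j + B * (2 * i) := 2 * missing i j, Suc j + B * Suc (2 * i) := 2 * missing i j))"
        \<comment> \<open>The first store must not change the entry that the second store reads
          again.\<close>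
        have ne: "j + B * i \<noteq> Suc j + B * (2 * i)" using j by (subst digit_inj) auto
        define z u u' where "z = j + B * i" and "u = Suc j + B * (2 * i)" and "u' = Suc j + B * Suc (2 * i)"
        have addr: "j + s 5 i = z" "Suc (j + s 5 (i + i)) = u" "Suc (j + s 5 (Suc (i + i))) = u'"
          using m by (simp_all only: z_def u_def u'_def add_Suc Suc_eq_plus1[symmetric])
        have regs: "s 1 0 = i" "s 1 1 = j" using s by blast+
        have xz: "s 6 z = missing i j" "z \<noteq> u" using x ne by (simp_all only: z_def u_def) simp
        have "result ?body s = s(6 := (s 6)(u := missing i j + missing i j, u' := missing i j + missing i j))"
          using regs addr xz by simp
        then have r: "result ?body s = s'" unfolding s'_def u_def u'_def mult_2[of "missing i j"] .
        have "prepared s'" using s by (auto simp: s'_def intro: prepared_cong)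
        moreover have "s' 6 (c + B * J) = missing J c" if "J < 2 * i" "c < B" for J c
        proof -
          have "c + B * J \<noteq> Suc j + B * (2 * i)" "c + B * J \<noteq> Suc j + B * Suc (2 * i)"
            using that j by (subst digit_inj; auto)+
          then show ?thesis using s that by (simp add: s'_def del: mult_Suc_right)
        qed
        moreover have "s' 6 (c + B * (2 * i)) = missing (2 * i) c \<and> s' 6 (c + B * (Suc (2 * i))) = missing (Suc (2 * i)) c"
          if "c \<le> Suc j" for c
        proof -
          have c: "c < B" "Suc j < B" using that j by auto
          have old: "s 6 (c + B * (2 * i)) = missing (2 * i) c \<and> s 6 (c + B * (Suc (2 * i))) = missing (Suc (2 * i)) c"
            if "c \<noteq> Suc j" using that \<open>c \<le> Suc j\<close> s by auto
          show ?thesis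
            using old unfolding s'_def
            by (cases "c = Suc j") (simp_all add: digit_inj[OF c] digit_inj[OF c(2) c(2)] missing_even missing_odd
                del: mult_Suc_right add_Suc)
        qed
        moreover have "s' 5 = s 5" "s' 2 = s 2" "s' 1 = s 1" by (simp_all add: s'_def)
        ultimately show "?A' (Suc j) (result ?body s) \<and> result ?body s 1 1 = j"
          unfolding r using s by simp
      qed simp_all
      show "?A' j (s(1 := (s 1)(1 := x)))" if "?A' j s" for j s x
        using that by (auto intro: prepared_cong)
      show "aval (Cell 2 (Num 3)) s = N" if "?A' j s" for j s
        using that by (simp add: prepared_def)
    qed
    have c: "?A (Suc i) s" if "?A' N s" for s
    proof -
      have "s 6 (c + B * J) = missing J c" if J: "J < 2 * Suc i" and c: "c < B" for J c
      proof -
        have "c \<le> N" using c by simp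
        have "J < 2 * i \<or> J = 2 * i \<or> J = Suc (2 * i)" using J by auto
        then show ?thesis using \<open>?A' N s\<close> \<open>c \<le> N\<close> c by blast
      qed
      then show ?thesis using that by blast
    qed
    show ?thesis by (rule runs_weaken[OF runs_Seq[OF a b]]) (use c in blast)+
  qed
  have "runs missing_prog (2 ^ k * (30 + (N * (60 + acost (Cell 2 (Num 3)) + 10) + acost (Cell 2 (Num 3)) + 7) +
     acost (Cell 2 (Num 6)) + 10) + acost (Cell 2 (Num 6)) + 7) (?A 0) (?A (2 ^ k))"
    unfolding missing_prog_def Let_def
  proof (rule runs_For[OF 2])
    show "?A i (s(1 := (s 1)(0 := x)))" if "?A i s" for i s x
      using that by (auto intro: prepared_cong)
  qed auto
  then show ?thesis
  proof (rule runs_weaken)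
    show "static s \<and> s 7 = (\<lambda>_. 0)" if "?A (2 ^ k) s" for s
      using that by (auto simp: static_def prepared_def)
    have "2 ^ k * (30 + (N * (60 + acost (Cell 2 (Num 3)) + 10) + acost (Cell 2 (Num 3)) + 7) +
        acost (Cell 2 (Num 6)) + 10) \<le> 2 ^ k * (N * 100 + 100)"
      by (intro mult_le_mono2) simp
    from add_mono[OF this, of "acost (Cell 2 (Num 6)) + 7" 30]
    show "2 ^ k * (30 + (N * (60 + acost (Cell 2 (Num 3)) + 10) + acost (Cell 2 (Num 3)) + 7) +
        acost (Cell 2 (Num 6)) + 10) + acost (Cell 2 (Num 6)) + 7 \<le> 2 ^ k * (N * 100 + 100) + 30"
      by (simp only: add.assoc) simp
  qed auto
qed

end


section \<open>Renaming the colours\<close>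

text \<open>Names are given in the order of first occurrence. A colour serves as an address in bank
  4, where 0 marks a colour not seen yet; this takes constant time for each square, however large
  the colour is.\<close>

definition rename_prog :: com where
  "rename_prog = (let g = Cell 0 (Add (Num 2) (var 0)) in
     For 0 (Cell 2 (Num 9)) (Seq
       (If (Less (Num 0) (Cell 4 g)) Skip
         (Seq (Store 2 (Num 5) (Add (Cell 2 (Num 5)) (Num 1))) (Store 4 g (Cell 2 (Num 5)))))
       (Store 3 (Add (Num 2) (var 0)) (Sub (Cell 4 g) (Num 1)))))"

definition constants_prog :: com where
  "constants_prog = (let n = Cell 0 (Num 0) in
     Seq (Store 2 (Num 7) n) (Seq (Store 2 (Num 1) (Num 1)) (Seq (Store 2 (Num 2) (Add n (Num 1)))
     (Seq (Store 2 (Num 9) (Add n n)) (Seq (Store 2 (Num 3) (Add (Add n n) (Num 2)))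
     (Store 2 (Num 4) (Add (Add n n) (Num 3))))))))"

definition renamed :: "nat \<Rightarrow> (nat \<Rightarrow> nat) \<Rightarrow> state \<Rightarrow> bool" where
  "renamed n g s \<longleftrightarrow> s 2 1 = 1 \<and> s 2 2 = n + 1 \<and> s 2 3 = 2 * n + 2 \<and> s 2 4 = 2 * n + 3 \<and> s 2 7 = n \<and>
      s 5 = (\<lambda>_. 0) \<and> s 7 = (\<lambda>_. 0) \<and> bij_betw (s 4) (g ` {..<2 * n}) {1..s 2 5} \<and>
      (\<forall>v. v \<notin> g ` {..<2 * n} \<longrightarrow> s 4 v = 0) \<and> (\<forall>m<2 * n. s 3 (2 + m) = s 4 (g m) - 1)"

lemma runs_rename:
  assumes len: "length xs = 2 + 2 * n" and n: "xs ! 0 = n"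
  defines "g \<equiv> \<lambda>m. xs ! (2 + m)"
  shows "runs (Seq constants_prog rename_prog) (n * 200 + 200) (\<lambda>s. s = load xs) (renamed n g)"
proof -
  let ?C = "\<lambda>s::state. s 0 = load xs 0 \<and> s 2 1 = 1 \<and> s 2 2 = n + 1 \<and> s 2 3 = 2 * n + 2 \<and> s 2 4 = 2 * n + 3 \<and>
    s 2 7 = n \<and> s 2 9 = 2 * n \<and> s 5 = (\<lambda>_. 0) \<and> s 7 = (\<lambda>_. 0)"
  let ?A = "\<lambda>i s. ?C s \<and> bij_betw (s 4) (g ` {..<i}) {1..s 2 5} \<and>
    (\<forall>v. v \<notin> g ` {..<i} \<longrightarrow> s 4 v = 0) \<and> (\<forall>m<i. s 3 (2 + m) = s 4 (g m) - 1)"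
  let ?g = "Cell 0 (Add (Num 2) (var 0))"
  let ?new = "If (Less (Num 0) (Cell 4 ?g)) Skip
         (Seq (Store 2 (Num 5) (Add (Cell 2 (Num 5)) (Num 1))) (Store 4 ?g (Cell 2 (Num 5))))"
  have 1: "runs constants_prog 60 (\<lambda>s. s = load xs) (?A 0)"
  proof (rule runs_straight)
    show "?A 0 (result constants_prog s)" if "s = load xs" for s
      using n len unfolding that by (simp add: constants_prog_def Let_def load_def bij_betw_def fun_eq_iff)
  qed (simp_all add: constants_prog_def Let_def)
  have 2: "runs rename_prog (2 * n * (60 + acost (Cell 2 (Num 9)) + 10) + acost (Cell 2 (Num 9)) + 7) (?A 0) (?A (2 * n))"
    unfolding rename_prog_def Let_def
  proof (rule runs_For)
    show "runs (Seq ?new (Store 3 (Add (Num 2) (var 0)) (Sub (Cell 4 ?g) (Num 1)))) 60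
      (\<lambda>s. ?A i s \<and> s 1 0 = i) (\<lambda>s. ?A (Suc i) s \<and> s 1 0 = i)" if i: "i < 2 * n" for i
    proof (rule runs_straight)
      fix s assume s: "?A i s \<and> s 1 0 = i"
      have g: "s 0 (2 + i) = g i" using s i len by (simp add: load_def g_def)
      define s1 where "s1 = (if 0 < s 4 (g i) then s
        else s(2 := (s 2)(5 := Suc (s 2 5)), 4 := (s 4)(g i := Suc (s 2 5))))"
      have r: "result ?new s = s1" using s g by (auto simp: s1_def)
      have C1: "?C s1" "s1 1 0 = i" "s1 3 = s 3" using s by (auto simp: s1_def)
      have im: "g ` {..<Suc i} = insert (g i) (g ` {..<i})" by (auto simp: less_Suc_eq)
      have old: "s1 4 (g m) = s 4 (g m)" if "m < i" for m
      proof -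
        have "0 < s 4 (g m)" using s that unfolding bij_betw_def by fastforce
        then show ?thesis by (auto simp: s1_def)
      qed
      have bij: "bij_betw (s1 4) (g ` {..<Suc i}) {1..s1 2 5}" "\<forall>v. v \<notin> g ` {..<Suc i} \<longrightarrow> s1 4 v = 0"
      proof -
        show "\<forall>v. v \<notin> g ` {..<Suc i} \<longrightarrow> s1 4 v = 0" using s unfolding im by (auto simp: s1_def)
        show "bij_betw (s1 4) (g ` {..<Suc i}) {1..s1 2 5}"
        proof (cases "0 < s 4 (g i)")
          case True
          then have "g i \<in> g ` {..<i}" using s by (metis less_irrefl)
          then show ?thesis using s True unfolding im by (simp add: s1_def insert_absorb)
        next
          case False
          then have notin: "g i \<notin> g ` {..<i}" using s unfolding bij_betw_def by fastforce
          have "bij_betw (s1 4) (g ` {..<i}) {1..s 2 5}"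
            by (subst bij_betw_cong[of _ _ "s 4"]) (use s old in auto)
          moreover have "s1 4 (g i) = Suc (s 2 5)" "s1 2 5 = Suc (s 2 5)" using False by (auto simp: s1_def)
          ultimately show ?thesis
            unfolding im using notIn_Un_bij_betw[OF notin, of "s1 4" "{1..s 2 5}"]
            by (simp add: atLeastAtMostSuc_conv)
        qed
      qed
      define s2 where "s2 = s1(3 := (s1 3)(2 + i := s1 4 (g i) - 1))"
      have g1: "s1 0 (2 + i) = g i" using g C1(1) s by simp
      have r2: "result (Seq ?new (Store 3 (Add (Num 2) (var 0)) (Sub (Cell 4 ?g) (Num 1)))) s = s2"
        unfolding result.simps(3) r using g1 C1(2) by (simp add: s2_def)
      show "?A (Suc i) (result (Seq ?new (Store 3 (Add (Num 2) (var 0)) (Sub (Cell 4 ?g) (Num 1)))) s) \<and>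
        result (Seq ?new (Store 3 (Add (Num 2) (var 0)) (Sub (Cell 4 ?g) (Num 1)))) s 1 0 = i"
        unfolding r2 using C1 bij s old by (auto simp: s2_def less_Suc_eq)
    qed simp_all
    show "?A i (s(1 := (s 1)(0 := x)))" if "?A i s" for i s x
      using that by auto
    show "aval (Cell 2 (Num 9)) s = 2 * n" if "?A i s" for i s
      using that by simp
  qed
  show ?thesis by (rule runs_weaken[OF runs_Seq[OF 1 2]]) (auto simp: renamed_def)
qed

section \<open>The minimum number of moves and the time bound\<close>

lemma floodable_min_moves_le:
  assumes "floodable V E C \<omega> d q" "d \<in> C" "finite C"
  shows "min_moves V E C \<omega> \<le> q"
proof -
  obtain ms where ms: "length ms \<le> q" "floods V E C \<omega> d ms" using assms by (auto simp: floodable_def)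
  have "min_moves_to V E C \<omega> d \<le> length ms"
    unfolding min_moves_to_def by (rule Least_le) (use ms in blast)
  moreover have "min_moves V E C \<omega> \<le> min_moves_to V E C \<omega> d"
    unfolding min_moves_def using assms by (intro Min_le) auto
  ultimately show ?thesis using ms by simp
qed

lemma floodable_min_moves:
  assumes "finite V" "finite C" "C \<noteq> {}"
  shows "\<exists>d\<in>C. floodable V E C \<omega> d (min_moves V E C \<omega>)"
proof -
  have "min_moves V E C \<omega> \<in> min_moves_to V E C \<omega> ` C"
    unfolding min_moves_def using assms by (intro Min_in) auto
  then obtain d where d: "d \<in> C" "min_moves V E C \<omega> = min_moves_to V E C \<omega> d" by blast
  have "\<exists>k ms. length ms = k \<and> floods V E C \<omega> d ms" using floods_exists[OF assms(1) d(1)] by blast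
  then have "\<exists>ms. length ms = min_moves_to V E C \<omega> d \<and> floods V E C \<omega> d ms"
    unfolding min_moves_to_def by (rule LeastI_ex)
  then have "floodable V E C \<omega> d (min_moves V E C \<omega>)" unfolding floodable_def d(2) by (metis order_refl)
  then show ?thesis using d(1) by blast
qed

text \<open>A single vertex needs at most one move, and these moves add up by
  \<open>floodable_Un\<close>. This bounds the optimum and thereby the heights.\<close>

lemma floodable_card:
  assumes "sym E" "finite V" "\<omega> ` V \<subseteq> C" "d \<in> C"
  shows "floodable V E C \<omega> d (card V)"
  using assms(2,3)
proof (induction V rule: finite_induct)
  case empty
  then show ?case by (auto intro: floodable_0)
next
  case (insert v V)
  have "floodable {v} E C \<omega> d (Suc 0)"
    by (rule floodable_play[of v _ d])
       (use assms(4) in \<open>auto intro!: floodable_0 simp: play_recolour recolour_def mono_component_self\<close>)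
  then have "floodable ({v} \<union> V) E C \<omega> d (Suc 0 + card V)"
    using insert assms(4) by (intro floodable_Un[OF assms(1)]) auto
  then show ?case using insert by simp
qed

context flood_table
begin

definition table_time :: nat where
  "table_time = (k * 30 + 30) + (200 * B + 400) + ((B ^ 7 * 2 ^ k * 30 + 30) + (2 ^ k * (N * 100 + 100) + 30) +
     ((2 * N * (round_time + 15) + 12) + (k * 200 + 200)))"

lemma runs_table:
  "runs table_prog table_time (\<lambda>s. prepared s \<and> s 5 = (\<lambda>_. 0))
    (\<lambda>s. \<exists>T. sound T \<and> complete (2 * N) T \<and>
      (\<exists>d<k. s 0 0 = out T d - 1) \<and> (\<forall>d<k. s 0 0 \<le> out T d - 1))"
proof -
  have "runs (Seq rounds_prog finish_prog) ((2 * N * (round_time + 15) + 12) + (k * 200 + 200))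
     (\<lambda>s. static s \<and> s 7 = (\<lambda>_. 0)) (\<lambda>s. \<exists>T. sound T \<and> complete (2 * N) T \<and>
      (\<exists>d<k. s 0 0 = out T d - 1) \<and> (\<forall>d<k. s 0 0 \<le> out T d - 1))"
    unfolding runs_def[of "Seq _ _"]
  proof (intro allI impI)
    fix s assume "static s \<and> s 7 = (\<lambda>_. 0)"
    then obtain t1 s1 where 1: "exec rounds_prog s t1 s1" "t1 \<le> 2 * N * (round_time + 15) + 12"
        "static s1" "sound (s1 7)" "complete (2 * N) (s1 7)"
      using runs_rounds unfolding runs_def by blast
    then obtain t2 s2 where 2: "exec finish_prog s1 t2 s2" "t2 \<le> k * 200 + 200"
        "\<exists>d<k. s2 0 0 = out (s1 7) d - 1" "\<forall>d<k. s2 0 0 \<le> out (s1 7) d - 1"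
      using runs_finish[of "s1 7"] unfolding runs_def by blast
    show "\<exists>t s'. exec (Seq rounds_prog finish_prog) s t s' \<and>
        t \<le> 2 * N * (round_time + 15) + 12 + (k * 200 + 200) \<and>
        (\<exists>T. sound T \<and> complete (2 * N) T \<and> (\<exists>d<k. s' 0 0 = out T d - 1) \<and> (\<forall>d<k. s' 0 0 \<le> out T d - 1))"
      using exec.Seq[OF 1(1) 2(1)] add_mono[OF 1(2) 2(2)] 1(4,5) 2(3,4) by blast
  qed
  then show ?thesis
    unfolding table_prog_def table_time_def
    by (intro runs_Seq[OF runs_Seq[OF runs_power runs_range] runs_Seq[OF runs_Seq[OF runs_multiples runs_missing]]])
qed

lemma round_time_le: "round_time \<le> 2 ^ k * n ^ 8 * (324 * 4 ^ 6 * (max_cost relax_prog + 273))"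
proof -
  have "round_time \<le> prod_list (map (bound \<circ> fst) loop_vars) * (max_cost relax_prog + 21 * length (map (bound \<circ> fst) loop_vars))"
    unfolding round_time_def
    by (rule loops_time_le) (use k in \<open>auto simp: loop_vars_def bound_def\<close>)
  also have "prod_list (map (bound \<circ> fst) loop_vars) = 2 ^ k * k ^ 2 * 81 * N ^ 6"
    by (simp add: loop_vars_def bound_def eval_nat_numeral del: power_Suc mult_Suc_right mult_Suc add: power_Suc)
  also have "length (map (bound \<circ> fst) loop_vars) = 13" by (simp add: loop_vars_def)
  also have "2 ^ k * k ^ 2 * 81 * N ^ 6 \<le> 2 ^ k * (2 * n) ^ 2 * 81 * (4 * n) ^ 6"
    using k n by (intro mult_le_mono power_mono) auto
  also have "\<dots> = 2 ^ k * n ^ 8 * (324 * 4 ^ 6)" by (simp add: power_mult_distrib flip: power_add)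
  finally show ?thesis by (simp add: mult.assoc mult_le_mono)
qed

text \<open>Every phase is bounded by a multiple of \<open>2 ^ k * n ^ 11\<close>; the powers that
  dominate are \<open>n ^ 7\<close> from the table of multiples and \<open>n ^ 9\<close> from the
  rounds.\<close>

lemma table_time_le: "table_time \<le> 2 ^ k * n ^ 11 * time_factor"
proof -
  define X where "X = 2 ^ k * n ^ 11"
  define r where "r = 324 * 4 ^ 6 * (max_cost relax_prog + 273)"
  have X: "2 ^ k * n ^ i \<le> X" if "i \<le> 11" for i
    unfolding X_def using that n by (intro mult_le_mono2 power_increasing)
  have X': "n ^ i \<le> X" if "i \<le> 11" for i
    by (rule order_trans[OF _ X[OF that]]) simp
  have "n \<le> X" "1 \<le> X" "2 ^ k \<le> X" "2 ^ k * n \<le> X"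
    using X'[of 1] X'[of 0] X[of 0] X[of 1] by simp_all
  note small = this X[of 7] X[of 9] k(2)
  have "B ^ 7 \<le> (5 * n) ^ 7" using n by (intro power_mono) auto
  then have "B ^ 7 * 2 ^ k \<le> (5 * n) ^ 7 * 2 ^ k" by (rule mult_le_mono1)
  also have "\<dots> = 78125 * (2 ^ k * n ^ 7)" by (simp add: power_mult_distrib)
  also have "\<dots> \<le> 78125 * X" using X[of 7] by simp
  finally have m: "B ^ 7 * 2 ^ k \<le> 78125 * X" .
  have "n * round_time \<le> n * (2 ^ k * n ^ 8 * r)"
    using round_time_le unfolding r_def by (rule mult_le_mono2)
  also have "\<dots> = 2 ^ k * n ^ 9 * r" by (simp add: eval_nat_numeral)
  also have "\<dots> \<le> X * r" using X[of 9] by (intro mult_le_mono1) simp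
  finally have rt: "n * round_time \<le> X * r" .
  have "round_time \<le> n * round_time" using n by simp
  moreover have "2 * N * (round_time + 15) + 12 = 4 * (n * round_time) + 4 * round_time + 60 * n + 72"
    by (simp add: algebra_simps)
  ultimately have rt2: "2 * N * (round_time + 15) + 12 \<le> 8 * (X * r) + 132 * X"
    using rt small by linarith
  have ms: "2 ^ k * (N * 100 + 100) + 30 \<le> 530 * X"
    using small by (simp add: algebra_simps)
  have b1: "k * 30 + 30 \<le> 90 * X" using small by linarith
  have b2: "200 * B + 400 \<le> 1400 * X" using small(1,2) by simp
  have b3: "k * 200 + 200 \<le> 600 * X" using small by linarith
  have b4: "30 \<le> 30 * X" using small by linarith
  have "table_time \<le> (90 * X + 1400 * X) + ((78125 * X * 30 + 30 * X + 530 * X) +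
      (8 * (X * r) + 132 * X + 600 * X))"
    unfolding table_time_def by (intro add_mono b1 b2 b3 b4 mult_le_mono1[OF m] ms rt2)
  also have "\<dots> \<le> 20000000 * X + 16 * (X * r)" by simp
  finally have "table_time \<le> 20000000 * X + 16 * (X * r)" .
  then show ?thesis unfolding time_factor_def r_def[symmetric] X_def[symmetric] by (simp add: algebra_simps)
qed

text \<open>Derivations are translated rather than games: \<open>\<sigma>\<close> turns one for the
  renamed board into one for the given board, and \<open>\<rho>\<close> does the converse. Colours
  of \<open>C\<close> that are absent from the board may collide under
  \<open>\<rho>\<close>.\<close>

lemma table_result:
  assumes T: "sound T" "complete (2 * N) T" "\<exists>d<k. r = out T d - 1" "\<forall>d<k. r \<le> out T d - 1"
    and C: "finite C" "C \<noteq> {}" "\<omega> ` board n \<subseteq> C" "\<rho> ` C \<subseteq> {..<k}" "\<sigma> ` {..<k} \<subseteq> C"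
    and w\<omega>: "\<And>v. v \<in> board n \<Longrightarrow> w v = \<rho> (\<omega> v)" "\<And>v. v \<in> board n \<Longrightarrow> \<omega> v = \<sigma> (w v)"
  shows "r = min_moves (board n) (board_adj n) C \<omega>"
proof (rule antisym)
  have pr_const: "pr u u = (\<lambda>_. u)" for u by (auto simp: pr_def)
  have wC: "w ` board n \<subseteq> {..<k}" using w by auto
  have card: "card (board n) = 2 * n" by (simp add: board_def card_cartesian_product)
  have table: "ok T (idx 1 1 n n 1 1 d 0) q" if "cost h (\<lambda>_. 1) (\<lambda>_. n) 1 1 d {} q" "h \<le> 2 * N" "d < k" for d h q
    by (rule completeD[OF T(2)]) (use that n in \<open>auto simp: pr_const intro: spine_cost_mono\<close>)
  \<comment> \<open>Every colour can be reached with \<open>2 * n\<close> moves, so the table has a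
    finite entry for each and the minimum is not spoilt by a 0.\<close>
  have pos: "0 < out T d" if "d < k" for d
  proof -
    have "floodable (board n) (board_adj n) {..<k} w d (2 * n)"
      using floodable_card[OF sym_board_adj finite_board wC, of d n] that card by simp
    then have "cost (2 * n + 2 * n) (\<lambda>_. 1) (\<lambda>_. n) 1 1 d {} (2 * n)"
      using spine_cost_if_floodable[OF n wC] that by blast
    then show ?thesis using table[of "2 * n + 2 * n" d "2 * n"] that by (simp add: ok_def out_def)
  qed
  let ?m = "min_moves (board n) (board_adj n) C \<omega>"
  show "?m \<le> r"
  proof -
    obtain d where d: "d < k" "r = out T d - 1" using T(3) by blast
    obtain h where "cost h (pr 1 1) (pr n n) 1 1 d (bits 0) r"
      using soundD[OF T(1), of 1 1 n n 1 1 d 0] pos[OF d(1)] d k n by (auto simp: out_def)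
    then have "spine_cost n C \<omega> h (\<lambda>_. 1) (\<lambda>_. n) 1 1 (\<sigma> d) {} r"
      using spine_cost_map[OF _ C(5), of n w h _ _ 1 1 d "{}" r \<omega>] w\<omega>(2) by (simp add: pr_const)
    then show ?thesis
      using floodable_if_spine_cost[OF C(3)] floodable_min_moves_le C(1) by metis
  qed
  show "r \<le> ?m"
  proof -
    obtain d where d: "d \<in> C" "floodable (board n) (board_adj n) C \<omega> d ?m"
      using floodable_min_moves[OF finite_board C(1,2)] by blast
    have "?m \<le> 2 * n"
      using floodable_min_moves_le[OF floodable_card[OF sym_board_adj finite_board C(3) d(1)] d(1) C(1)] card by simp
    moreover have "cost (?m + 2 * n) (\<lambda>_. 1) (\<lambda>_. n) 1 1 (\<rho> d) {} ?m"
      using spine_cost_map[OF spine_cost_if_floodable[OF n C(3) d], of \<rho> "{..<k}" w "{}"] C(4) w\<omega>(1) by simp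
    moreover have "\<rho> d < k" using C(4) d by auto
    ultimately have "out T (\<rho> d) \<le> Suc ?m"
      using table[of "?m + 2 * n" "\<rho> d" ?m] by (simp add: ok_def out_def)
    then show ?thesis using T(4) \<open>\<rho> d < k\<close> by fastforce
  qed
qed

end

section \<open>Correctness on encoded boards\<close>

lemma flood_encode_nth:
  fixes n c \<omega>
  defines "g \<equiv> \<lambda>m. flood_encode (n, c, \<omega>) ! (2 + m)"
  shows "1 \<le> j \<Longrightarrow> j \<le> n \<Longrightarrow> g (j - 1) = \<omega> (1, j)" "1 \<le> j \<Longrightarrow> j \<le> n \<Longrightarrow> g (n + j - 1) = \<omega> (2, j)"
    "g ` {..<2 * n} = \<omega> ` board n"
proof -
  have len: "length [1..<n + 1] = n" by simp
  have 1: "g m = \<omega> (1, Suc m)" if "m < n" for m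
    using that by (simp add: g_def nth_append nth_Cons' del: upt_Suc)
  have 2: "g (n + m) = \<omega> (2, Suc m)" if "m < n" for m
    using that by (simp add: g_def nth_append nth_Cons' del: upt_Suc)
  show "g (j - 1) = \<omega> (1, j)" if "1 \<le> j" "j \<le> n" using 1[of "j - 1"] that by simp
  show "g (n + j - 1) = \<omega> (2, j)" if "1 \<le> j" "j \<le> n" using 2[of "j - 1"] that by simp
  show "g ` {..<2 * n} = \<omega> ` board n"
  proof
    show "g ` {..<2 * n} \<subseteq> \<omega> ` board n"
    proof
      fix y assume "y \<in> g ` {..<2 * n}"
      then obtain m where m: "m < 2 * n" "y = g m" by auto
      show "y \<in> \<omega> ` board n"
      proof (cases "m < n")
        case True
        then have "y = \<omega> (1, Suc m)" "(1, Suc m) \<in> board n" using m 1 by (auto simp: board_iff)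
        then show ?thesis by blast
      next
        case False
        then have "y = \<omega> (2, Suc (m - n))" "(2, Suc (m - n)) \<in> board n"
          using m 2[of "m - n"] by (auto simp: board_iff)
        then show ?thesis by blast
      qed
    qed
    show "\<omega> ` board n \<subseteq> g ` {..<2 * n}"
    proof
      fix y assume "y \<in> \<omega> ` board n"
      then obtain a j where j: "y = \<omega> (a, j)" "a = 1 \<or> a = 2" "1 \<le> j" "j \<le> n" by (auto simp: board_iff)
      show "y \<in> g ` {..<2 * n}"
      proof (cases "a = 1")
        case True
        then have "y = g (j - 1)" using j 1[of "j - 1"] by simp
        then show ?thesis using j by (intro image_eqI[of _ _ "j - 1"]) auto
      next
        case False
        then have "y = g (n + (j - 1))" using j 2[of "j - 1"] by simp
        then show ?thesis using j by (intro image_eqI[of _ _ "n + (j - 1)"]) auto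
      qed
    qed
  qed
qed

definition flood_prog :: com where
  "flood_prog = Seq (Seq constants_prog rename_prog) table_prog"

lemma flood_prog_correct:
  assumes n: "n \<ge> 1" and \<omega>: "\<omega> \<in> board n \<rightarrow> {0..<c}"
  shows "\<exists>t. computes_in flood_prog (flood_encode (n, c, \<omega>))
       (min_moves (board n) (board_adj n) {0..<c} \<omega>) t \<and> t \<le> (400 + time_factor) * (n ^ 11 * 2 ^ c)"
proof -
  let ?xs = "flood_encode (n, c, \<omega>)"
  define g where "g = (\<lambda>m. ?xs ! (2 + m))"
  have enc: "g (j - 1) = \<omega> (1, j)" "g (n + j - 1) = \<omega> (2, j)" if "1 \<le> j" "j \<le> n" for j
    unfolding g_def using that by (rule flood_encode_nth)+
  have im_g: "g ` {..<2 * n} = \<omega> ` board n" unfolding g_def by (rule flood_encode_nth)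
  have "length ?xs = 2 + 2 * n" "?xs ! 0 = n" by simp_all
  from runs_rename[OF this, folded g_def] obtain t1 s1 where
    t1: "exec (Seq constants_prog rename_prog) (load ?xs) t1 s1" "t1 \<le> n * 200 + 200"
    and s1: "renamed n g s1"
    unfolding runs_def by blast
  note s1 = t1 s1[unfolded renamed_def im_g]
  then have s1: "exec (Seq constants_prog rename_prog) (load ?xs) t1 s1"
      "t1 \<le> n * 200 + 200" "s1 2 1 = 1" "s1 2 2 = n + 1" "s1 2 3 = 2 * n + 2" "s1 2 4 = 2 * n + 3" "s1 2 7 = n"
      "s1 5 = (\<lambda>_. 0)" "s1 7 = (\<lambda>_. 0)" "bij_betw (s1 4) (\<omega> ` board n) {1..s1 2 5}"
      "\<And>v. v \<notin> \<omega> ` board n \<Longrightarrow> s1 4 v = 0" "\<And>m. m < 2 * n \<Longrightarrow> s1 3 (2 + m) = s1 4 (g m) - 1"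
    by simp_all
  define k where "k = s1 2 5"
  \<comment> \<open>Absent colours have the entry 0 in bank 4, and truncated subtraction sends them
    to 0 like the first colour. So \<open>\<rho>\<close> is below \<open>k\<close>
    everywhere.\<close>
  define \<rho> where "\<rho> = (\<lambda>v. s1 4 v - 1)"
  define w where "w = (\<lambda>v. \<rho> (\<omega> v))"
  define \<sigma> where "\<sigma> = (\<lambda>d. inv_into (\<omega> ` board n) (s1 4) (Suc d))"
  have im: "\<omega> ` board n \<subseteq> {0..<c}" using \<omega> by auto
  have kcard: "k = card (\<omega> ` board n)" using bij_betw_same_card[OF s1(10)] by (simp add: k_def)
  have ne: "(1, 1) \<in> board n" using n by (simp add: board_iff)
  have k1: "1 \<le> k" unfolding kcard using ne finite_board by (simp add: Suc_le_eq card_gt_0_iff) blast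
  have "card (board n) = 2 * n" by (simp add: board_def card_cartesian_product)
  then have kn: "k \<le> 2 * n" unfolding kcard using card_image_le[OF finite_board, of \<omega> n] by simp
  \<comment> \<open>Apart from \<open>n\<close>, the time depends only on the number
    \<open>k\<close> of colours that occur; this inequality turns \<open>2 ^ k\<close> into
    \<open>2 ^ c\<close>.\<close>
  have kc: "k \<le> c" unfolding kcard using card_mono[OF _ im] by simp
  have s4: "s1 4 v \<in> {1..k}" if "v \<in> \<omega> ` board n" for v
    using bij_betwE[OF s1(10)] that by (auto simp: k_def)
  have \<rho>k: "\<rho> v < k" for v
    using s4[of v] s1(11)[of v] k1 by (cases "v \<in> \<omega> ` board n") (auto simp: \<rho>_def)
  have \<sigma>: "\<sigma> d \<in> \<omega> ` board n" if "d < k" for d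
    unfolding \<sigma>_def using that s1(10) by (intro inv_into_into) (auto simp: bij_betw_def k_def)
  have \<sigma>w: "\<sigma> (w v) = \<omega> v" if "v \<in> board n" for v
  proof -
    have "Suc (\<rho> (\<omega> v)) = s1 4 (\<omega> v)" using s4[of "\<omega> v"] that by (auto simp: \<rho>_def)
    then show ?thesis
      using that s1(10) unfolding \<sigma>_def w_def by (simp add: bij_betw_def)
  qed
  interpret flood_table n k w
    by unfold_locales (use n k1 kn \<rho>k in \<open>auto simp: w_def\<close>)
  have cells: "s1 3 (s1 2 a + j) = w (a, j)" if "(a, j) \<in> board n" for a j
  proof -
    have j: "a = 1 \<or> a = 2" "1 \<le> j" "j \<le> n" using that by (auto simp: board_iff)
    from j(1) show ?thesis
    proof
      assume a: "a = 1"
      have "s1 2 a + j = 2 + (j - 1)" using a j s1(3) by simp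
      then show ?thesis using s1(12)[of "j - 1"] enc(1)[of j] j a by (simp add: w_def \<rho>_def)
    next
      assume a: "a = 2"
      have "s1 2 a + j = 2 + (n + j - 1)" using a j s1(4) by simp
      then show ?thesis using s1(12)[of "n + j - 1"] enc(2)[of j] j a by (simp add: w_def \<rho>_def)
    qed
  qed
  have "prepared s1" unfolding prepared_def using s1(3-9) cells by (simp add: k_def)
  then obtain t2 s2 T where s2: "exec table_prog s1 t2 s2" "t2 \<le> table_time"
      "sound T" "complete (2 * (2 * n + 2)) T" "\<exists>d<k. s2 0 0 = out T d - 1" "\<forall>d<k. s2 0 0 \<le> out T d - 1"
    using runs_table s1(8) unfolding runs_def by blast
  have "s2 0 0 = min_moves (board n) (board_adj n) {0..<c} \<omega>"
  proof (rule table_result[OF s2(3-6), where \<rho> = \<rho> and \<sigma> = \<sigma>])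
    show "{0..<c} \<noteq> {}" using im ne by auto
    show "\<sigma> ` {..<k} \<subseteq> {0..<c}" using \<sigma> im by blast
  qed (use im \<rho>k \<sigma>w in \<open>auto simp: w_def\<close>)
  moreover have "exec flood_prog (load ?xs) (t1 + t2) s2"
    unfolding flood_prog_def using s1(1) s2(1) by (rule exec.Seq)
  moreover have "t1 + t2 \<le> (400 + time_factor) * (n ^ 11 * 2 ^ c)"
  proof -
    let ?X = "n ^ 11 * 2 ^ c"
    have "n \<le> n ^ 11" "1 \<le> n ^ 11" using n by (auto intro: self_le_power)
    moreover have "n ^ 11 * 1 \<le> ?X" by (intro mult_le_mono2) simp
    ultimately have t1: "t1 \<le> 400 * ?X" using s1(2) by linarith
    have "2 ^ k * n ^ 11 * time_factor \<le> 2 ^ c * n ^ 11 * time_factor"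
      using kc by (intro mult_le_mono1) simp
    moreover have "2 ^ c * n ^ 11 * time_factor = ?X * time_factor" by (simp only: mult.commute)
    ultimately have "t2 \<le> ?X * time_factor" using s2(2) table_time_le by (metis order_trans)
    then have "t1 + t2 \<le> 400 * ?X + ?X * time_factor" using t1 by (rule add_mono[rotated])
    then show ?thesis by (simp add: algebra_simps)
  qed
  ultimately show ?thesis unfolding computes_in_def by blast
qed

text \<open>The literal \<open>K\<close> is doubled \<open>x\<close> times by additions.\<close>

lemma computable_exponential: "computable (\<lambda>x. K * 2 ^ x)"
proof -
  let ?dbl = "Store 2 (Num 0) (Add (Cell 2 (Num 0)) (Cell 2 (Num 0)))"
  let ?A = "\<lambda>x i (s::state). s 0 0 = x \<and> s 2 0 = K * 2 ^ i"
  have 1: "runs (Store 2 (Num 0) (Num K)) 3 (\<lambda>s. s = load [x]) (?A x 0)" for x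
    by (rule runs_straight) (auto simp: load_def)
  have 2: "runs (For 0 (Cell 0 (Num 0)) ?dbl) (x * (10 + acost (Cell 0 (Num 0)) + 10) + acost (Cell 0 (Num 0)) + 7)
    (?A x 0) (?A x x)" for x
  proof (rule runs_For)
    show "runs ?dbl 10 (\<lambda>s. ?A x i s \<and> s 1 0 = i) (\<lambda>s. ?A x (Suc i) s \<and> s 1 0 = i)" for i
      by (rule runs_straight) auto
  qed auto
  have 3: "runs (Store 0 (Num 0) (Cell 2 (Num 0))) 4 (?A x x) (\<lambda>s. s 0 0 = K * 2 ^ x)" for x
    by (rule runs_straight) auto
  show ?thesis
    using runs_Seq[OF 1 runs_Seq[OF 2 3]] unfolding computable_def computes_in_def runs_def by metis
qed

lemma length_le_input_size: "length xs \<le> input_size xs"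
  unfolding input_size_def by (induction xs) auto

theorem theorem1:
  "(\<exists>P K. \<forall>n c \<omega>. n \<ge> 1 \<longrightarrow> \<omega> \<in> board n \<rightarrow> {0..<c} \<longrightarrow>
           (\<exists>t. computes_in P (flood_encode (n, c, \<omega>))
                  (min_moves (board n) (board_adj n) {0..<c} \<omega>) t \<and>
                t \<le> K * (n ^ 11 * 2 ^ c)))
   \<and> fixed_parameter_tractable flood_instances flood_encode flood_colours flood_moves"
proof
  show "\<exists>P K. \<forall>n c \<omega>. n \<ge> 1 \<longrightarrow> \<omega> \<in> board n \<rightarrow> {0..<c} \<longrightarrow>
           (\<exists>t. computes_in P (flood_encode (n, c, \<omega>))
                  (min_moves (board n) (board_adj n) {0..<c} \<omega>) t \<and>
                t \<le> K * (n ^ 11 * 2 ^ c))"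
    using flood_prog_correct by blast
  define K where "K = 400 + time_factor"
  show "fixed_parameter_tractable flood_instances flood_encode flood_colours flood_moves"
    unfolding fixed_parameter_tractable_def
  proof (rule exI[of _ flood_prog], rule exI[of _ "\<lambda>c. K * 2 ^ c"], rule exI[of _ 11], rule conjI,
      rule computable_exponential, rule ballI)
    fix x assume "x \<in> flood_instances"
    then obtain n c \<omega> where x: "x = (n, c, \<omega>)" "n \<ge> 1" "\<omega> \<in> board n \<rightarrow> {0..<c}"
      by (auto simp: flood_instances_def)
    obtain t where t: "computes_in flood_prog (flood_encode x) (flood_moves x) t" "t \<le> K * (n ^ 11 * 2 ^ c)"
      using flood_prog_correct[OF x(2,3)] by (auto simp: x(1) K_def)
    \<comment> \<open>Every input word contributes at least 1 to the input size, and there are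
      \<open>2 + 2 * n\<close> words.\<close>
    have "n \<le> input_size (flood_encode x)"
    proof -
      have "length (flood_encode x) = 2 + 2 * n" by (simp add: x(1))
      then show ?thesis using length_le_input_size[of "flood_encode x"] by linarith
    qed
    then have "K * 2 ^ c * n ^ 11 \<le> K * 2 ^ c * input_size (flood_encode x) ^ 11"
      by (intro mult_le_mono2 power_mono) auto
    moreover have "K * (n ^ 11 * 2 ^ c) = K * 2 ^ c * n ^ 11" by (simp only: ac_simps)
    moreover have "flood_colours x = c" by (simp add: x(1))
    ultimately have "t \<le> K * 2 ^ flood_colours x * input_size (flood_encode x) ^ 11"
      using t(2) by (metis order_trans)
    then show "\<exists>t. computes_in flood_prog (flood_encode x) (flood_moves x) t \<and>
        t \<le> K * 2 ^ flood_colours x * input_size (flood_encode x) ^ 11"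
      using t(1) by blast
  qed
qed

end
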